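(* Let $\Bbbk$ be a commutative ring, $\mathcal{K}$ a $\Bbbk$-linear abelian category, $(\mathbb{X},\Gamma/{\sim})$ a triple with path category $C$ and $\Bbbk$-linear path category $\mathcal{C}$, $\mathcal{I}$ a path based ideal of $\mathcal{C}$, and $\mathcal{A}=\mathcal{C}/\mathcal{I}$. If $M$ is a representation in $\mathrm{Rep}_{\mathcal{K}}(\mathcal{A})$ and $\mathfrak{P}$ is a screen of $(\mathbb{X},\Gamma/{\sim})$ that pixelates $M$, then there exists a representation $\overline{M}$ of $\overline{\mathcal{Q}(\mathcal{A},\mathfrak{P})}$ with values in $\mathcal{K}$ such that $\pi^*(G^*(\overline{M}))=\overline{M}\circ G\circ\pi\cong M$. Likewise, if $M$ is a representation in $\mathrm{Rep}_{\mathcal{K}}(C)$ and $\mathfrak{P}$ is a screen that pixelates $M$, then there exists a representation $\overline{M}$ of $\overline{Q(C,\mathfrak{P})}$ with values in $\mathcal{K}$ such that $p^*(H^*(\overline{M}))=\overline{M}\circ H\circ p\cong M$.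
   Context: TRIPLES. A path in a nonempty set $\mathbb{X}$ is any function $\gamma:[0,1]\to\mathbb{X}$; $\mathrm{im}(\gamma)$ is its image. If $\gamma(1)=\gamma'(0)$, then $\gamma\cdot\gamma'$ is the path equal to $\gamma(2t)$ for $0\le t\le\frac12$ and to $\gamma'(2t-1)$ for $\frac12\le t\le1$. A triple $(\mathbb{X},\Gamma/{\sim})$ consists of a nonempty set $\mathbb{X}$, a set $\Gamma$ of paths in $\mathbb{X}$, and an equivalence relation $\sim$ on $\Gamma$ (equivalent paths have the same endpoints) such that: (a) $\gamma,\gamma'\in\Gamma$ with $\gamma(1)=\gamma'(0)$ implies $\gamma\cdot\gamma'\in\Gamma$; (b) if $\gamma\in\Gamma$ and $\phi:[0,1]\to[0,1]$ is weakly order preserving and sends intervals to intervals, then $\gamma\circ\phi\in\Gamma$; (c) all constant paths are in $\Gamma$; (d) a path equivalent to a constant path is constant; (e) if in (b) also $\phi(0)=0$, $\phi(1)=1$, then $\gamma\sim\gamma\circ\phi$; (f) if $\gamma,\gamma',\rho,\rho'\in\Gamma$ and $\rho\cdot\gamma\cdot\rho'$, $\rho\cdot\gamma'\cdot\rho'$ are defined and in $\Gamma$, then $\gamma\sim\gamma'$ if and only if $\rho\cdot\gamma\cdot\rho'\sim\rho\cdot\gamma'\cdot\rho'$. The class of $\gamma$ is $[\gamma]$. SCREENS. A screen of $(\mathbb{X},\Gamma/{\sim})$ is a partition $\mathfrak{P}$ of $\mathbb{X}$, whose elements are called pixels, such that: (S1) if $\gamma,\gamma'\in\Gamma$ have the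 same start and the same end and $\mathrm{im}(\gamma)\subset\mathsf{X}\in\mathfrak{P}$, then $\gamma\sim\gamma'$ if and only if $\mathrm{im}(\gamma')\subset\mathsf{X}$; (S2) any two points $x,y$ of a pixel $\mathsf{X}$ are joined by a finite walk $\gamma_0\cdot\gamma_1^{-1}\cdot\gamma_2\cdots\gamma_{2n-1}^{-1}\cdot\gamma_{2n}$ from $x$ to $y$ (where $\gamma^{-1}$ is $\gamma$ run backwards) with all $\gamma_i\in\Gamma$ and $\mathrm{im}(\gamma_i)\subset\mathsf{X}$; (S3) if $\rho,\gamma\in\Gamma$, $\rho(0)=\gamma(0)$ and $\mathrm{im}(\rho)$ lies in a pixel, then there are $\rho',\gamma'\in\Gamma$ with $\mathrm{im}(\rho')$ in a pixel and $\gamma\cdot\rho'\sim\rho\cdot\gamma'$; dually, if $\rho',\gamma'\in\Gamma$, $\rho'(1)=\gamma'(1)$ and $\mathrm{im}(\rho')$ lies in a pixel, then there are $\rho,\gamma\in\Gamma$ with $\mathrm{im}(\rho)$ in a pixel and $\gamma\cdot\rho'\sim\rho\cdot\gamma'$; (S4) for every $\gamma\in\Gamma$ there are a finite partition $\{I_i\}_{i=1}^n$ of $[0,1]$ into subintervals (listed in increasing order) and pixels $(\mathsf{X}_1,\dots,\mathsf{X}_n)$ with $\gamma(I_i)\subset\mathsf{X}_i$, where for $i\ne j$ the equality $\mathsf{X}_i=\mathsf{X}_j$ is allowed only if $|i-j|>1$; (S5) if $\gamma,\gamma'\in\Gamma$ have the same start and the same end and admit the same partition $\{I_i\}$ and the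 same list of pixels as in (S4), then $\gamma\sim\gamma'$. PATH CATEGORIES. $C$ has objects the points of $\mathbb{X}$, $\mathrm{Hom}_C(x,y)=\{[\gamma]\mid\gamma\in\Gamma,\gamma(0)=x,\gamma(1)=y\}$, composition $[\gamma']\circ[\gamma]=[\gamma\cdot\gamma']$. $\mathcal{C}$ has objects $\mathbb{X}\sqcup\{0\}$ with $0$ a zero object, $\mathrm{Hom}_{\mathcal{C}}(x,y)$ the free $\Bbbk$-module on $\mathrm{Hom}_C(x,y)$ for $x,y\in\mathbb{X}$, and bilinear composition. An ideal of $\mathcal{C}$ is path based if it is generated by finite sums $\sum_i\lambda_i[\gamma_i]$ with $\gamma_i\in\Gamma$, each $\lambda_i\in\Bbbk$ not a zero divisor (the zero ideal is allowed). PIXELATIONS. In $C$, $\Sigma_{\mathfrak{P}}$ is the class of $[\rho]$ with $\mathrm{im}(\rho)$ in a pixel; $p:C\to C[\Sigma_{\mathfrak{P}}^{-1}]$ is the localization. For the linear case: paths $\gamma,\gamma'\in\Gamma$ are $\mathfrak{P}$-equivalent if there are $\rho_1,\dots,\rho_4\in\Gamma$ with $\mathrm{im}(\rho_1)\cup\mathrm{im}(\rho_2)$ in one pixel, $\mathrm{im}(\rho_3)\cup\mathrm{im}(\rho_4)$ in one pixel, and $\rho_1\cdot\gamma\cdot\rho_3\sim\rho_2\cdot\gamma'\cdot\rho_4$; morphisms $\sum_{i=1}^m\lambda_i[\gamma_i]$, $\sum_{i=1}^m\lambda'_i[\gamma'_i]$ are $\mathfrak{P}$-equivalent if, up to permutation,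 $\lambda_i=\lambda'_i$ and $\gamma_i,\gamma'_i$ are $\mathfrak{P}$-equivalent for all $i$; $\overline{\mathcal{I}}^{\mathfrak{P}}$ is the ideal generated by all $f$ that are $\mathfrak{P}$-equivalent to some $g\in\mathcal{I}$; $\overline{\mathcal{A}}^{\mathfrak{P}}=\mathcal{C}/\overline{\mathcal{I}}^{\mathfrak{P}}$. A pixel is pre-dead if it contains $\mathrm{im}(\rho)$ for some $\rho\in\Gamma$ with $[\rho]=0$ in $\mathcal{A}$. In $\overline{\mathcal{A}}^{\mathfrak{P}}$, $\Sigma_{\mathfrak{P}}$ consists of the $[\rho]\ne0$ with $\mathrm{im}(\rho)$ in a pixel and of the zero morphisms $x\to y$ with $x,y$ in a common pre-dead pixel. Both classes admit a two-sided calculus of fractions. $\pi:\mathcal{A}\to\overline{\mathcal{A}}^{\mathfrak{P}}\to\overline{\mathcal{A}}^{\mathfrak{P}}[\Sigma_{\mathfrak{P}}^{-1}]$ is the quotient followed by the localization. A pixel is dead if it contains a point isomorphic to $0$ in $\overline{\mathcal{A}}^{\mathfrak{P}}[\Sigma_{\mathfrak{P}}^{-1}]$. CATEGORIES FROM QUIVERS. Choose a point $s_{\mathsf{X}}\in\mathsf{X}$ in each pixel. A pseudo arrow in $C[\Sigma_{\mathfrak{P}}^{-1}]$ is a morphism $[\rho]^{-1}[\gamma]$ with $[\rho]\in\Sigma_{\mathfrak{P}}$ such that $\gamma$ has a partition as in (S4) with exactly two elements; a pseudo arrow in $\overline{\mathcal{A}}^{\mathfrak{P}}[\Sigma_{\mathfrak{P}}^{-1}]$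 is a nonzero morphism $\sigma^{-1}\lambda[\gamma]$ with $\sigma\in\Sigma_{\mathfrak{P}}$, $\lambda\in\Bbbk$ and $\gamma$ as before. $Q(C,\mathfrak{P})$ is the quiver with vertex set $\mathfrak{P}$ and arrows $\mathsf{X}\to\mathsf{Y}$ the pseudo arrows $s_{\mathsf{X}}\to s_{\mathsf{Y}}$ in $C[\Sigma_{\mathfrak{P}}^{-1}]$ (at most one). $\Psi$ is the functor from the free category on $Q(C,\mathfrak{P})$ to $C[\Sigma_{\mathfrak{P}}^{-1}]$, $\mathsf{X}\mapsto s_{\mathsf{X}}$, sending each arrow to its pseudo arrow; $\overline{Q(C,\mathfrak{P})}$ is the quotient of the free category identifying parallel $f,g$ with $\Psi(f)=\Psi(g)$. $Q(\mathcal{A},\mathfrak{P})$ is the quiver with vertices the non-dead pixels and arrows $\mathsf{X}\to\mathsf{Y}$ the pseudo arrows $s_{\mathsf{X}}\to s_{\mathsf{Y}}$ in $\overline{\mathcal{A}}^{\mathfrak{P}}[\Sigma_{\mathfrak{P}}^{-1}]$ modulo nonzero scalars (at most one). $\mathcal{Q}(\mathcal{A},\mathfrak{P})$ is the free $\Bbbk$-linear category on it together with a zero object; $\Phi:\mathcal{Q}(\mathcal{A},\mathfrak{P})\to\overline{\mathcal{A}}^{\mathfrak{P}}[\Sigma_{\mathfrak{P}}^{-1}]$ is the $\Bbbk$-linear functor $\mathsf{X}\mapsto s_{\mathsf{X}}$ sending each arrow to the corresponding pseudo arrow of the form $[\rho]^{-1}[\gamma]$; $\overline{\mathcal{Q}(\mathcal{A},\mathfrak{P})}=\mathcal{Q}(\mathcal{A},\mathfrak{P})/\{f\mid\Phi(f)=0\}$.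 There are equivalences $H:C[\Sigma_{\mathfrak{P}}^{-1}]\to\overline{Q(C,\mathfrak{P})}$ and ($\Bbbk$-linear) $G:\overline{\mathcal{A}}^{\mathfrak{P}}[\Sigma_{\mathfrak{P}}^{-1}]\to\overline{\mathcal{Q}(\mathcal{A},\mathfrak{P})}$, both sending a point $x\in\mathsf{X}$ to $\mathsf{X}$ ($G$ sends points of dead pixels to $0$), fractions $\sigma^{-1}\sigma'$ with $\sigma,\sigma'\in\Sigma_{\mathfrak{P}}$ (between points of a non-dead pixel, in the linear case) to identities, and pseudo arrows $x\to y$ with $x\in\mathsf{X},y\in\mathsf{Y}$ to the (scalar multiples of the) arrow $\mathsf{X}\to\mathsf{Y}$. REPRESENTATIONS. $\mathrm{Rep}_{\mathcal{K}}(\mathcal{D})$ is the category of functors $\mathcal{D}\to\mathcal{K}$, required to be $\Bbbk$-linear and additive when $\mathcal{D}$ is $\Bbbk$-linear. $\mathfrak{P}$ pixelates $M\in\mathrm{Rep}_{\mathcal{K}}(C)$ if $M([\rho])$ is an isomorphism for all $[\rho]\in\Sigma_{\mathfrak{P}}$. $\mathfrak{P}$ pixelates $M\in\mathrm{Rep}_{\mathcal{K}}(\mathcal{A})$ if $M(\sigma)$ is an isomorphism for all $\sigma\in\Sigma_{\mathfrak{P}}$; explicitly, $M([\rho])$ is an isomorphism whenever $\mathrm{im}(\rho)$ lies in a pixel and $[\rho]\ne0$ in $\overline{\mathcal{A}}^{\mathfrak{P}}$, and $M(0:x\to y)$ is an isomorphism for $x,y$ in a common pre-dead pixel. *)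

theory Defs
  imports
    "HOL-Analysis.Analysis"
    "HOL-Algebra.FiniteProduct"
    "HOL-Library.Poly_Mapping"
    "HOL-Library.Disjoint_Sets"
begin

section \<open>Categories and functors\<close>

text \<open>
  Hom-sets need not be disjoint, so every operation on morphisms takes the objects involved as
  arguments: \<open>cmp D x y z g f\<close> is the composite of \<open>f : x \<rightarrow> y\<close> followed by \<open>g : y \<rightarrow> z\<close>.
\<close>

record ('o, 'm) cat =
  obj :: "'o set"
  Hom :: "'o \<Rightarrow> 'o \<Rightarrow> 'm set"
  idm :: "'o \<Rightarrow> 'm"
  cmp :: "'o \<Rightarrow> 'o \<Rightarrow> 'o \<Rightarrow> 'm \<Rightarrow> 'm \<Rightarrow> 'm"

locale category =
  fixes D :: "('o, 'm, 'z) cat_scheme"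
  assumes idm_closed: "x \<in> obj D \<Longrightarrow> idm D x \<in> Hom D x x"
    and cmp_closed: "\<lbrakk>x \<in> obj D; y \<in> obj D; z \<in> obj D; f \<in> Hom D x y; g \<in> Hom D y z\<rbrakk>
      \<Longrightarrow> cmp D x y z g f \<in> Hom D x z"
    and cmp_idm_right: "\<lbrakk>x \<in> obj D; y \<in> obj D; f \<in> Hom D x y\<rbrakk> \<Longrightarrow> cmp D x x y f (idm D x) = f"
    and cmp_idm_left: "\<lbrakk>x \<in> obj D; y \<in> obj D; f \<in> Hom D x y\<rbrakk> \<Longrightarrow> cmp D x y y (idm D y) f = f"
    and cmp_assoc: "\<lbrakk>w \<in> obj D; x \<in> obj D; y \<in> obj D; z \<in> obj D;
        f \<in> Hom D w x; g \<in> Hom D x y; h \<in> Hom D y z\<rbrakk>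
      \<Longrightarrow> cmp D w y z h (cmp D w x y g f) = cmp D w x z (cmp D x y z h g) f"

definition is_iso :: "('o, 'm, 'z) cat_scheme \<Rightarrow> 'o \<Rightarrow> 'o \<Rightarrow> 'm \<Rightarrow> bool" where
  "is_iso D x y f \<longleftrightarrow> f \<in> Hom D x y \<and>
     (\<exists>g\<in>Hom D y x. cmp D x y x g f = idm D x \<and> cmp D y x y f g = idm D y)"

definition isomorphic :: "('o, 'm, 'z) cat_scheme \<Rightarrow> 'o \<Rightarrow> 'o \<Rightarrow> bool" where
  "isomorphic D x y \<longleftrightarrow> x \<in> obj D \<and> y \<in> obj D \<and> (\<exists>f. is_iso D x y f)"

definition is_mono :: "('o, 'm, 'z) cat_scheme \<Rightarrow> 'o \<Rightarrow> 'o \<Rightarrow> 'm \<Rightarrow> bool" where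
  "is_mono D x y f \<longleftrightarrow> f \<in> Hom D x y \<and>
     (\<forall>w\<in>obj D. \<forall>g\<in>Hom D w x. \<forall>h\<in>Hom D w x. cmp D w x y f g = cmp D w x y f h \<longrightarrow> g = h)"

definition is_epi :: "('o, 'm, 'z) cat_scheme \<Rightarrow> 'o \<Rightarrow> 'o \<Rightarrow> 'm \<Rightarrow> bool" where
  "is_epi D x y f \<longleftrightarrow> f \<in> Hom D x y \<and>
     (\<forall>z\<in>obj D. \<forall>g\<in>Hom D y z. \<forall>h\<in>Hom D y z. cmp D x y z g f = cmp D x y z h f \<longrightarrow> g = h)"

definition zero_object :: "('o, 'm, 'z) cat_scheme \<Rightarrow> 'o \<Rightarrow> bool" where
  "zero_object D z \<longleftrightarrow> z \<in> obj D \<and>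
     (\<forall>x\<in>obj D. (\<exists>!f. f \<in> Hom D x z) \<and> (\<exists>!f. f \<in> Hom D z x))"

record ('o, 'm, 'p, 'n) func =
  fobj :: "'o \<Rightarrow> 'p"
  farr :: "'o \<Rightarrow> 'o \<Rightarrow> 'm \<Rightarrow> 'n"

definition is_functor ::
  "('o, 'm, 'z) cat_scheme \<Rightarrow> ('p, 'n, 'y) cat_scheme \<Rightarrow> ('o, 'm, 'p, 'n) func \<Rightarrow> bool" where
  "is_functor D E F \<longleftrightarrow>
     (\<forall>x\<in>obj D. fobj F x \<in> obj E) \<and>
     (\<forall>x\<in>obj D. \<forall>y\<in>obj D. \<forall>f\<in>Hom D x y. farr F x y f \<in> Hom E (fobj F x) (fobj F y)) \<and>
     (\<forall>x\<in>obj D. farr F x x (idm D x) = idm E (fobj F x)) \<and>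
     (\<forall>x\<in>obj D. \<forall>y\<in>obj D. \<forall>z\<in>obj D. \<forall>f\<in>Hom D x y. \<forall>g\<in>Hom D y z.
        farr F x z (cmp D x y z g f) =
        cmp E (fobj F x) (fobj F y) (fobj F z) (farr F y z g) (farr F x y f))"

definition id_func :: "('o, 'm, 'o, 'm) func" where
  "id_func = \<lparr>fobj = \<lambda>x. x, farr = \<lambda>x y f. f\<rparr>"

definition func_comp ::
  "('p, 'n, 'q, 'l) func \<Rightarrow> ('o, 'm, 'p, 'n) func \<Rightarrow> ('o, 'm, 'q, 'l) func"  (infixl "\<circ>\<^sub>F" 55) where
  "G \<circ>\<^sub>F F = \<lparr>fobj = \<lambda>x. fobj G (fobj F x),
             farr = \<lambda>x y f. farr G (fobj F x) (fobj F y) (farr F x y f)\<rparr>"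

definition nat_isomorphic :: "('o, 'm, 'z) cat_scheme \<Rightarrow> ('p, 'n, 'y) cat_scheme \<Rightarrow>
    ('o, 'm, 'p, 'n) func \<Rightarrow> ('o, 'm, 'p, 'n) func \<Rightarrow> bool" where
  "nat_isomorphic D E F G \<longleftrightarrow> (\<exists>\<eta>.
     (\<forall>x\<in>obj D. is_iso E (fobj F x) (fobj G x) (\<eta> x)) \<and>
     (\<forall>x\<in>obj D. \<forall>y\<in>obj D. \<forall>f\<in>Hom D x y.
        cmp E (fobj F x) (fobj F y) (fobj G y) (\<eta> y) (farr F x y f) =
        cmp E (fobj F x) (fobj G x) (fobj G y) (farr G x y f) (\<eta> x)))"

definition is_equivalence ::
  "('o, 'm, 'z) cat_scheme \<Rightarrow> ('p, 'n, 'y) cat_scheme \<Rightarrow> ('o, 'm, 'p, 'n) func \<Rightarrow> bool" where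
  "is_equivalence D E F \<longleftrightarrow> is_functor D E F \<and>
     (\<exists>F'. is_functor E D F' \<and> nat_isomorphic D D (F' \<circ>\<^sub>F F) id_func \<and>
           nat_isomorphic E E (F \<circ>\<^sub>F F') id_func)"

section \<open>Linear and abelian categories\<close>

text \<open>
  The sort \<open>{comm_ring, comm_monoid_mult}\<close> is that of commutative unital rings; unlike
  \<open>comm_ring_1\<close> it does not exclude the zero ring.
\<close>

record ('o, 'm, 'k) lincat = "('o, 'm) cat" +
  hadd :: "'o \<Rightarrow> 'o \<Rightarrow> 'm \<Rightarrow> 'm \<Rightarrow> 'm"
  hzero :: "'o \<Rightarrow> 'o \<Rightarrow> 'm"
  hscale :: "'o \<Rightarrow> 'o \<Rightarrow> 'k \<Rightarrow> 'm \<Rightarrow> 'm"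

definition hom_group :: "('o, 'm, 'k, 'z) lincat_scheme \<Rightarrow> 'o \<Rightarrow> 'o \<Rightarrow> 'm monoid" where
  "hom_group D x y = \<lparr>carrier = Hom D x y, monoid.mult = hadd D x y, one = hzero D x y\<rparr>"

locale linear_category = category D
  for D :: "('o, 'm, 'k :: {comm_ring, comm_monoid_mult}, 'z) lincat_scheme" +
  assumes hom_comm_group: "\<lbrakk>x \<in> obj D; y \<in> obj D\<rbrakk> \<Longrightarrow> comm_group (hom_group D x y)"
    and hscale_closed: "\<lbrakk>x \<in> obj D; y \<in> obj D; f \<in> Hom D x y\<rbrakk> \<Longrightarrow> hscale D x y a f \<in> Hom D x y"
    and hscale_one: "\<lbrakk>x \<in> obj D; y \<in> obj D; f \<in> Hom D x y\<rbrakk> \<Longrightarrow> hscale D x y 1 f = f"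
    and hscale_mult: "\<lbrakk>x \<in> obj D; y \<in> obj D; f \<in> Hom D x y\<rbrakk>
      \<Longrightarrow> hscale D x y (a * b) f = hscale D x y a (hscale D x y b f)"
    and hscale_add_left: "\<lbrakk>x \<in> obj D; y \<in> obj D; f \<in> Hom D x y\<rbrakk>
      \<Longrightarrow> hscale D x y (a + b) f = hadd D x y (hscale D x y a f) (hscale D x y b f)"
    and hscale_add_right: "\<lbrakk>x \<in> obj D; y \<in> obj D; f \<in> Hom D x y; g \<in> Hom D x y\<rbrakk>
      \<Longrightarrow> hscale D x y a (hadd D x y f g) = hadd D x y (hscale D x y a f) (hscale D x y a g)"
    and cmp_add_right: "\<lbrakk>x \<in> obj D; y \<in> obj D; z \<in> obj D;
        f \<in> Hom D x y; f' \<in> Hom D x y; g \<in> Hom D y z\<rbrakk>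
      \<Longrightarrow> cmp D x y z g (hadd D x y f f') = hadd D x z (cmp D x y z g f) (cmp D x y z g f')"
    and cmp_add_left: "\<lbrakk>x \<in> obj D; y \<in> obj D; z \<in> obj D;
        f \<in> Hom D x y; g \<in> Hom D y z; g' \<in> Hom D y z\<rbrakk>
      \<Longrightarrow> cmp D x y z (hadd D y z g g') f = hadd D x z (cmp D x y z g f) (cmp D x y z g' f)"
    and cmp_scale_right: "\<lbrakk>x \<in> obj D; y \<in> obj D; z \<in> obj D; f \<in> Hom D x y; g \<in> Hom D y z\<rbrakk>
      \<Longrightarrow> cmp D x y z g (hscale D x y a f) = hscale D x z a (cmp D x y z g f)"
    and cmp_scale_left: "\<lbrakk>x \<in> obj D; y \<in> obj D; z \<in> obj D; f \<in> Hom D x y; g \<in> Hom D y z\<rbrakk>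
      \<Longrightarrow> cmp D x y z (hscale D y z a g) f = hscale D x z a (cmp D x y z g f)"

definition is_kernel ::
  "('o, 'm, 'k, 'z) lincat_scheme \<Rightarrow> 'o \<Rightarrow> 'o \<Rightarrow> 'm \<Rightarrow> 'o \<Rightarrow> 'm \<Rightarrow> bool" where
  "is_kernel D x y f k i \<longleftrightarrow> k \<in> obj D \<and> i \<in> Hom D k x \<and> cmp D k x y f i = hzero D k y \<and>
     (\<forall>w\<in>obj D. \<forall>g\<in>Hom D w x. cmp D w x y f g = hzero D w y \<longrightarrow>
        (\<exists>!h. h \<in> Hom D w k \<and> cmp D w k x i h = g))"

definition is_cokernel ::
  "('o, 'm, 'k, 'z) lincat_scheme \<Rightarrow> 'o \<Rightarrow> 'o \<Rightarrow> 'm \<Rightarrow> 'o \<Rightarrow> 'm \<Rightarrow> bool" where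
  "is_cokernel D x y f c q \<longleftrightarrow> c \<in> obj D \<and> q \<in> Hom D y c \<and> cmp D x y c q f = hzero D x c \<and>
     (\<forall>z\<in>obj D. \<forall>g\<in>Hom D y z. cmp D x y z g f = hzero D x z \<longrightarrow>
        (\<exists>!h. h \<in> Hom D c z \<and> cmp D y c z h q = g))"

definition is_biproduct ::
  "('o, 'm, 'k, 'z) lincat_scheme \<Rightarrow> 'o \<Rightarrow> 'o \<Rightarrow> 'o \<Rightarrow> bool" where
  "is_biproduct D x y b \<longleftrightarrow> b \<in> obj D \<and>
     (\<exists>i\<in>Hom D x b. \<exists>j\<in>Hom D y b. \<exists>p\<in>Hom D b x. \<exists>q\<in>Hom D b y.
        cmp D x b x p i = idm D x \<and> cmp D y b y q j = idm D y \<and>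
        cmp D x b y q i = hzero D x y \<and> cmp D y b x p j = hzero D y x \<and>
        hadd D b b (cmp D b x b i p) (cmp D b y b j q) = idm D b)"

locale abelian_category = linear_category D
  for D :: "('o, 'm, 'k :: {comm_ring, comm_monoid_mult}, 'z) lincat_scheme" +
  assumes ex_zero_object: "\<exists>z. zero_object D z"
    and ex_biproduct: "\<lbrakk>x \<in> obj D; y \<in> obj D\<rbrakk> \<Longrightarrow> \<exists>b. is_biproduct D x y b"
    and ex_kernel: "\<lbrakk>x \<in> obj D; y \<in> obj D; f \<in> Hom D x y\<rbrakk> \<Longrightarrow> \<exists>k i. is_kernel D x y f k i"
    and ex_cokernel: "\<lbrakk>x \<in> obj D; y \<in> obj D; f \<in> Hom D x y\<rbrakk> \<Longrightarrow> \<exists>c q. is_cokernel D x y f c q"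
    and mono_normal: "\<lbrakk>x \<in> obj D; y \<in> obj D; is_mono D x y f\<rbrakk>
      \<Longrightarrow> \<exists>z\<in>obj D. \<exists>g\<in>Hom D y z. is_kernel D y z g x f"
    and epi_normal: "\<lbrakk>x \<in> obj D; y \<in> obj D; is_epi D x y f\<rbrakk>
      \<Longrightarrow> \<exists>w\<in>obj D. \<exists>g\<in>Hom D w x. is_cokernel D w x g y f"

text \<open>A linear functor preserves zero objects and biproducts, so it is additive.\<close>

definition linear_functor :: "('o, 'm, 'k, 'z) lincat_scheme \<Rightarrow> ('p, 'n, 'k, 'y) lincat_scheme \<Rightarrow>
    ('o, 'm, 'p, 'n) func \<Rightarrow> bool" where
  "linear_functor D E F \<longleftrightarrow> is_functor D E F \<and>
     (\<forall>x\<in>obj D. \<forall>y\<in>obj D. \<forall>f\<in>Hom D x y. \<forall>g\<in>Hom D x y.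
        farr F x y (hadd D x y f g) = hadd E (fobj F x) (fobj F y) (farr F x y f) (farr F x y g)) \<and>
     (\<forall>x\<in>obj D. \<forall>y\<in>obj D. \<forall>f\<in>Hom D x y. \<forall>a.
        farr F x y (hscale D x y a f) = hscale E (fobj F x) (fobj F y) a (farr F x y f))"

subsection \<open>Free linear categories and adjoined zero objects\<close>

definition pm_scale :: "'k \<Rightarrow> ('a \<Rightarrow>\<^sub>0 'k) \<Rightarrow> ('a \<Rightarrow>\<^sub>0 'k :: {comm_ring, comm_monoid_mult})" where
  "pm_scale a f = Poly_Mapping.map ((*) a) f"

definition linearization ::
  "('o, 'm) cat \<Rightarrow> ('o, 'm \<Rightarrow>\<^sub>0 'k, 'k :: {comm_ring, comm_monoid_mult}) lincat" where
  "linearization D = \<lparr>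
     obj = obj D,
     Hom = \<lambda>x y. {f. Poly_Mapping.keys f \<subseteq> Hom D x y},
     idm = \<lambda>x. Poly_Mapping.single (idm D x) 1,
     cmp = \<lambda>x y z g f. \<Sum>a\<in>Poly_Mapping.keys f. \<Sum>b\<in>Poly_Mapping.keys g.
       Poly_Mapping.single (cmp D x y z b a) (Poly_Mapping.lookup g b * Poly_Mapping.lookup f a),
     hadd = \<lambda>x y. (+),
     hzero = \<lambda>x y. 0,
     hscale = \<lambda>x y. pm_scale\<rparr>"

text \<open>The object \<open>None\<close> is the adjoined zero object.\<close>

definition adjoin_zero :: "('o, 'm :: zero, 'k) lincat \<Rightarrow> ('o option, 'm, 'k) lincat" where
  "adjoin_zero D = \<lparr>
     obj = insert None (Some ` obj D),
     Hom = \<lambda>x y. case (x, y) of (Some x', Some y') \<Rightarrow> Hom D x' y' | _ \<Rightarrow> {0},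
     idm = \<lambda>x. case x of Some x' \<Rightarrow> idm D x' | None \<Rightarrow> 0,
     cmp = \<lambda>x y z g f. case (x, y, z) of
       (Some x', Some y', Some z') \<Rightarrow> cmp D x' y' z' g f
     | (Some x', None, Some z') \<Rightarrow> hzero D x' z'
     | _ \<Rightarrow> 0,
     hadd = \<lambda>x y f g. case (x, y) of (Some x', Some y') \<Rightarrow> hadd D x' y' f g | _ \<Rightarrow> 0,
     hzero = \<lambda>x y. case (x, y) of (Some x', Some y') \<Rightarrow> hzero D x' y' | _ \<Rightarrow> 0,
     hscale = \<lambda>x y a f. case (x, y) of (Some x', Some y') \<Rightarrow> hscale D x' y' a f | _ \<Rightarrow> 0\<rparr>"

subsection \<open>Quotient categories\<close>

definition congruence :: "('o, 'm) cat \<Rightarrow> ('o \<Rightarrow> 'o \<Rightarrow> 'm rel) \<Rightarrow> bool" where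
  "congruence D E \<longleftrightarrow>
     (\<forall>x\<in>obj D. \<forall>y\<in>obj D. equiv (Hom D x y) (E x y)) \<and>
     (\<forall>x\<in>obj D. \<forall>y\<in>obj D. \<forall>z\<in>obj D. \<forall>(f, f')\<in>E x y. \<forall>(g, g')\<in>E y z.
        (cmp D x y z g f, cmp D x y z g' f') \<in> E x z)"

definition congruence_gen :: "('o, 'm) cat \<Rightarrow> ('o \<Rightarrow> 'o \<Rightarrow> 'm rel) \<Rightarrow> 'o \<Rightarrow> 'o \<Rightarrow> 'm rel" where
  "congruence_gen D r x y =
     \<Inter>{E x y | E. congruence D E \<and> (\<forall>u\<in>obj D. \<forall>v\<in>obj D. r u v \<subseteq> E u v)}"

definition quotient_cat ::
  "('o, 'm) cat \<Rightarrow> ('o \<Rightarrow> 'o \<Rightarrow> 'm rel) \<Rightarrow> ('o, 'm set) cat" where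
  "quotient_cat D E = \<lparr>
     obj = obj D,
     Hom = \<lambda>x y. Hom D x y // E x y,
     idm = \<lambda>x. E x x `` {idm D x},
     cmp = \<lambda>x y z g f. E x z `` {cmp D x y z b a | a b. a \<in> f \<and> b \<in> g}\<rparr>"

definition is_ideal :: "('o, 'm, 'k) lincat \<Rightarrow> ('o \<Rightarrow> 'o \<Rightarrow> 'm set) \<Rightarrow> bool" where
  "is_ideal D I \<longleftrightarrow>
     (\<forall>x\<in>obj D. \<forall>y\<in>obj D. I x y \<subseteq> Hom D x y \<and> hzero D x y \<in> I x y \<and>
        (\<forall>f\<in>I x y. \<forall>g\<in>I x y. hadd D x y f g \<in> I x y) \<and>
        (\<forall>f\<in>I x y. \<forall>a. hscale D x y a f \<in> I x y)) \<and>
     (\<forall>x\<in>obj D. \<forall>y\<in>obj D. \<forall>z\<in>obj D.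
        (\<forall>f\<in>I x y. \<forall>g\<in>Hom D y z. cmp D x y z g f \<in> I x z) \<and>
        (\<forall>f\<in>Hom D x y. \<forall>g\<in>I y z. cmp D x y z g f \<in> I x z))"

definition ideal_gen ::
  "('o, 'm, 'k) lincat \<Rightarrow> ('o \<Rightarrow> 'o \<Rightarrow> 'm set) \<Rightarrow> 'o \<Rightarrow> 'o \<Rightarrow> 'm set" where
  "ideal_gen D S x y = \<Inter>{I x y | I. is_ideal D I \<and> (\<forall>u\<in>obj D. \<forall>v\<in>obj D. S u v \<subseteq> I u v)}"

definition coset ::
  "('o, 'm, 'k) lincat \<Rightarrow> ('o \<Rightarrow> 'o \<Rightarrow> 'm set) \<Rightarrow> 'o \<Rightarrow> 'o \<Rightarrow> 'm \<Rightarrow> 'm set" where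
  "coset D I x y f = hadd D x y f ` I x y"

definition lin_quotient ::
  "('o, 'm, 'k) lincat \<Rightarrow> ('o \<Rightarrow> 'o \<Rightarrow> 'm set) \<Rightarrow> ('o, 'm set, 'k) lincat" where
  "lin_quotient D I = \<lparr>
     obj = obj D,
     Hom = \<lambda>x y. coset D I x y ` Hom D x y,
     idm = \<lambda>x. coset D I x x (idm D x),
     cmp = \<lambda>x y z g f. \<Union>a\<in>f. \<Union>b\<in>g. coset D I x z (cmp D x y z b a),
     hadd = \<lambda>x y f g. \<Union>a\<in>f. \<Union>b\<in>g. coset D I x y (hadd D x y a b),
     hzero = \<lambda>x y. coset D I x y (hzero D x y),
     hscale = \<lambda>x y c f. \<Union>a\<in>f. coset D I x y (hscale D x y c a)\<rparr>"

text \<open>For ideals \<open>I \<subseteq> J\<close>: the functor \<open>D/I \<rightarrow> D/J\<close> induced by the identity of \<open>D\<close>.\<close>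

definition quotient_func :: "('o, 'm, 'k) lincat \<Rightarrow> ('o \<Rightarrow> 'o \<Rightarrow> 'm set) \<Rightarrow>
    ('o, 'm set, 'o, 'm set) func" where
  "quotient_func D J = \<lparr>fobj = \<lambda>x. x, farr = \<lambda>x y f. \<Union>a\<in>f. coset D J x y a\<rparr>"

subsection \<open>Quivers and free categories\<close>

record ('v, 'a) quiver =
  Verts :: "'v set"
  Arrows :: "'v \<Rightarrow> 'v \<Rightarrow> 'a set"

type_synonym ('v, 'a) word = "('v \<times> 'v \<times> 'a) list"

text \<open>A word lists the arrows of a path in the quiver from its start to its end.\<close>

fun is_word :: "('v, 'a) quiver \<Rightarrow> 'v \<Rightarrow> 'v \<Rightarrow> ('v, 'a) word \<Rightarrow> bool" where
  "is_word Q u v [] \<longleftrightarrow> u = v \<and> u \<in> Verts Q"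
| "is_word Q u v ((a, b, e) # w) \<longleftrightarrow>
     a = u \<and> a \<in> Verts Q \<and> b \<in> Verts Q \<and> e \<in> Arrows Q a b \<and> is_word Q b v w"

definition free_cat :: "('v, 'a) quiver \<Rightarrow> ('v, ('v, 'a) word) cat" where
  "free_cat Q = \<lparr>
     obj = Verts Q,
     Hom = \<lambda>u v. {w. is_word Q u v w},
     idm = \<lambda>u. [],
     cmp = \<lambda>u v w q p. p @ q\<rparr>"

text \<open>The value on a word from \<open>u\<close> to \<open>v\<close> of the functor given by \<open>\<phi>\<close> on vertices, \<open>\<alpha>\<close> on arrows.\<close>

fun word_ext :: "('o, 'm, 'z) cat_scheme \<Rightarrow> ('v \<Rightarrow> 'o) \<Rightarrow> ('v \<Rightarrow> 'v \<Rightarrow> 'a \<Rightarrow> 'm) \<Rightarrow>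
    'v \<Rightarrow> 'v \<Rightarrow> ('v, 'a) word \<Rightarrow> 'm" where
  "word_ext D \<phi> \<alpha> u v [] = idm D (\<phi> u)"
| "word_ext D \<phi> \<alpha> u v ((a, b, e) # w) =
     cmp D (\<phi> u) (\<phi> b) (\<phi> v) (word_ext D \<phi> \<alpha> b v w) (\<alpha> a b e)"

definition lin_word_ext :: "('o, 'm, 'k :: zero, 'z) lincat_scheme \<Rightarrow> ('v \<Rightarrow> 'o) \<Rightarrow>
    ('v \<Rightarrow> 'v \<Rightarrow> 'a \<Rightarrow> 'm) \<Rightarrow> 'v \<Rightarrow> 'v \<Rightarrow> (('v, 'a) word \<Rightarrow>\<^sub>0 'k) \<Rightarrow> 'm" where
  "lin_word_ext D \<phi> \<alpha> u v f = finprod (hom_group D (\<phi> u) (\<phi> v))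
     (\<lambda>w. hscale D (\<phi> u) (\<phi> v) (Poly_Mapping.lookup f w) (word_ext D \<phi> \<alpha> u v w))
     (Poly_Mapping.keys f)"

subsection \<open>Localizations\<close>

text \<open>
  The Gabriel--Zisman construction: adjoin formal inverses of the morphisms in \<open>S\<close> and divide the
  free category on the resulting quiver by the relations below.  In the linear case the free
  linear category is divided by the ideal of these relations and of those that make the canonical
  functor linear; this is the universal linear functor inverting \<open>S\<close>, and when \<open>S\<close> admits a calculus
  of fractions it agrees with the ordinary localization and its induced linear structure.
\<close>

datatype 'm zigzag = Fwd 'm | Bwd 'm

definition zigzag_quiver ::
  "('o, 'm, 'z) cat_scheme \<Rightarrow> ('o \<Rightarrow> 'o \<Rightarrow> 'm set) \<Rightarrow> ('o, 'm zigzag) quiver" where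
  "zigzag_quiver D S =
     \<lparr>Verts = obj D, Arrows = \<lambda>x y. Fwd ` Hom D x y \<union> Bwd ` (S y x \<inter> Hom D y x)\<rparr>"

inductive_set loc_rel :: "('o, 'm, 'z) cat_scheme \<Rightarrow> ('o \<Rightarrow> 'o \<Rightarrow> 'm set) \<Rightarrow> 'o \<Rightarrow> 'o \<Rightarrow>
    ('o, 'm zigzag) word rel"
  for D :: "('o, 'm, 'z) cat_scheme" and S :: "'o \<Rightarrow> 'o \<Rightarrow> 'm set"
    and x :: 'o and y :: 'o where
  loc_cmp: "\<lbrakk>x \<in> obj D; z \<in> obj D; y \<in> obj D; f \<in> Hom D x z; g \<in> Hom D z y\<rbrakk>
    \<Longrightarrow> ([(x, z, Fwd f), (z, y, Fwd g)], [(x, y, Fwd (cmp D x z y g f))]) \<in> loc_rel D S x y"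
| loc_id: "\<lbrakk>x \<in> obj D; x = y\<rbrakk> \<Longrightarrow> ([(x, y, Fwd (idm D x))], []) \<in> loc_rel D S x y"
| loc_inv_left: "\<lbrakk>x \<in> obj D; z \<in> obj D; x = y; s \<in> S x z; s \<in> Hom D x z\<rbrakk>
    \<Longrightarrow> ([(x, z, Fwd s), (z, y, Bwd s)], []) \<in> loc_rel D S x y"
| loc_inv_right: "\<lbrakk>x \<in> obj D; z \<in> obj D; x = y; s \<in> S z x; s \<in> Hom D z x\<rbrakk>
    \<Longrightarrow> ([(x, z, Bwd s), (z, y, Fwd s)], []) \<in> loc_rel D S x y"

definition loc_cong :: "('o, 'm) cat \<Rightarrow> ('o \<Rightarrow> 'o \<Rightarrow> 'm set) \<Rightarrow> 'o \<Rightarrow> 'o \<Rightarrow>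
    ('o, 'm zigzag) word rel" where
  "loc_cong D S = congruence_gen (free_cat (zigzag_quiver D S)) (loc_rel D S)"

definition localization :: "('o, 'm) cat \<Rightarrow> ('o \<Rightarrow> 'o \<Rightarrow> 'm set) \<Rightarrow>
    ('o, ('o, 'm zigzag) word set) cat" where
  "localization D S = quotient_cat (free_cat (zigzag_quiver D S)) (loc_cong D S)"

definition loc_func :: "('o, 'm) cat \<Rightarrow> ('o \<Rightarrow> 'o \<Rightarrow> 'm set) \<Rightarrow>
    ('o, 'm, 'o, ('o, 'm zigzag) word set) func" where
  "loc_func D S = \<lparr>fobj = \<lambda>x. x, farr = \<lambda>x y f. loc_cong D S x y `` {[(x, y, Fwd f)]}\<rparr>"

text \<open>\<open>frac D S x z y s f\<close> is the fraction \<open>s\<^sup>-\<^sup>1 f : x \<rightarrow> y\<close> for \<open>f : x \<rightarrow> z\<close> and \<open>s : y \<rightarrow> z\<close> in \<open>S\<close>.\<close>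

definition frac :: "('o, 'm) cat \<Rightarrow> ('o \<Rightarrow> 'o \<Rightarrow> 'm set) \<Rightarrow> 'o \<Rightarrow> 'o \<Rightarrow> 'o \<Rightarrow> 'm \<Rightarrow> 'm \<Rightarrow>
    ('o, 'm zigzag) word set" where
  "frac D S x z y s f = cmp (localization D S) x z y
     (loc_cong D S z y `` {[(z, y, Bwd s)]}) (loc_cong D S x z `` {[(x, z, Fwd f)]})"

definition free_zigzag :: "('o, 'm, 'k) lincat \<Rightarrow> ('o \<Rightarrow> 'o \<Rightarrow> 'm set) \<Rightarrow>
    ('o, ('o, 'm zigzag) word \<Rightarrow>\<^sub>0 'k :: {comm_ring, comm_monoid_mult}, 'k) lincat" where
  "free_zigzag D S = linearization (free_cat (zigzag_quiver D S))"

abbreviation fwd :: "'o \<Rightarrow> 'o \<Rightarrow> 'm \<Rightarrow>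
    (('o, 'm zigzag) word \<Rightarrow>\<^sub>0 'k :: {comm_ring, comm_monoid_mult})" where
  "fwd x y f \<equiv> Poly_Mapping.single [(x, y, Fwd f)] 1"

abbreviation bwd :: "'o \<Rightarrow> 'o \<Rightarrow> 'm \<Rightarrow>
    (('o, 'm zigzag) word \<Rightarrow>\<^sub>0 'k :: {comm_ring, comm_monoid_mult})" where
  "bwd x y s \<equiv> Poly_Mapping.single [(x, y, Bwd s)] 1"

definition lin_loc_rel :: "('o, 'm, 'k) lincat \<Rightarrow> ('o \<Rightarrow> 'o \<Rightarrow> 'm set) \<Rightarrow> 'o \<Rightarrow> 'o \<Rightarrow>
    (('o, 'm zigzag) word \<Rightarrow>\<^sub>0 'k :: {comm_ring, comm_monoid_mult}) set" where
  "lin_loc_rel D S x y =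
     {Poly_Mapping.single v 1 - Poly_Mapping.single w 1 | v w. (v, w) \<in> loc_rel D S x y} \<union>
     {fwd x y (hadd D x y f g) - (fwd x y f + fwd x y g) | f g. f \<in> Hom D x y \<and> g \<in> Hom D x y} \<union>
     {fwd x y (hscale D x y a f) - pm_scale a (fwd x y f) | a f. f \<in> Hom D x y}"

definition lin_loc_ideal :: "('o, 'm, 'k) lincat \<Rightarrow> ('o \<Rightarrow> 'o \<Rightarrow> 'm set) \<Rightarrow> 'o \<Rightarrow> 'o \<Rightarrow>
    (('o, 'm zigzag) word \<Rightarrow>\<^sub>0 'k :: {comm_ring, comm_monoid_mult}) set" where
  "lin_loc_ideal D S = ideal_gen (free_zigzag D S) (lin_loc_rel D S)"

definition lin_localization :: "('o, 'm, 'k) lincat \<Rightarrow> ('o \<Rightarrow> 'o \<Rightarrow> 'm set) \<Rightarrow>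
    ('o, (('o, 'm zigzag) word \<Rightarrow>\<^sub>0 'k) set, 'k :: {comm_ring, comm_monoid_mult}) lincat" where
  "lin_localization D S = lin_quotient (free_zigzag D S) (lin_loc_ideal D S)"

definition lin_loc_func :: "('o, 'm, 'k) lincat \<Rightarrow> ('o \<Rightarrow> 'o \<Rightarrow> 'm set) \<Rightarrow>
    ('o, 'm, 'o, (('o, 'm zigzag) word \<Rightarrow>\<^sub>0 'k :: {comm_ring, comm_monoid_mult}) set) func" where
  "lin_loc_func D S = \<lparr>fobj = \<lambda>x. x,
     farr = \<lambda>x y f. coset (free_zigzag D S) (lin_loc_ideal D S) x y (fwd x y f)\<rparr>"

definition lin_frac :: "('o, 'm, 'k) lincat \<Rightarrow> ('o \<Rightarrow> 'o \<Rightarrow> 'm set) \<Rightarrow> 'o \<Rightarrow> 'o \<Rightarrow> 'o \<Rightarrow> 'm \<Rightarrow> 'm \<Rightarrow>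
    (('o, 'm zigzag) word \<Rightarrow>\<^sub>0 'k :: {comm_ring, comm_monoid_mult}) set" where
  "lin_frac D S x z y s f = cmp (lin_localization D S) x z y
     (coset (free_zigzag D S) (lin_loc_ideal D S) z y (bwd z y s))
     (coset (free_zigzag D S) (lin_loc_ideal D S) x z (fwd x z f))"

section \<open>Triples and screens\<close>

text \<open>A path is a function on \<open>[0,1]\<close>, extended to the real line by \<open>undefined\<close>.\<close>

type_synonym 'x pth = "real \<Rightarrow> 'x"

definition paths_in :: "'x set \<Rightarrow> 'x pth set" where
  "paths_in X = {0..1} \<rightarrow>\<^sub>E X"

definition im :: "'x pth \<Rightarrow> 'x set" where
  "im \<gamma> = \<gamma> ` {0..1}"

definition const_path :: "'x \<Rightarrow> 'x pth" where
  "const_path x = (\<lambda>t\<in>{0..1}. x)"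

definition path_concat :: "'x pth \<Rightarrow> 'x pth \<Rightarrow> 'x pth"  (infixl "\<cdot>" 70) where
  "\<gamma> \<cdot> \<delta> = (\<lambda>t\<in>{0..1}. if t \<le> 1/2 then \<gamma> (2 * t) else \<delta> (2 * t - 1))"

definition reparam :: "(real \<Rightarrow> real) \<Rightarrow> bool" where
  "reparam \<phi> \<longleftrightarrow> \<phi> \<in> {0..1} \<rightarrow> {0..1} \<and> mono_on {0..1} \<phi> \<and>
     (\<forall>J\<subseteq>{0..1}. is_interval J \<longrightarrow> is_interval (\<phi> ` J))"

locale path_triple =
  fixes X :: "'x set" and \<Gamma> :: "'x pth set" and R :: "'x pth rel"
  assumes nonempty: "X \<noteq> {}"
    and paths: "\<Gamma> \<subseteq> paths_in X"
    and equiv: "equiv \<Gamma> R"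
    and endpoints: "(\<gamma>, \<gamma>') \<in> R \<Longrightarrow> \<gamma> 0 = \<gamma>' 0 \<and> \<gamma> 1 = \<gamma>' 1"
    and concat_closed: "\<lbrakk>\<gamma> \<in> \<Gamma>; \<gamma>' \<in> \<Gamma>; \<gamma> 1 = \<gamma>' 0\<rbrakk> \<Longrightarrow> \<gamma> \<cdot> \<gamma>' \<in> \<Gamma>"
    and reparam_closed: "\<lbrakk>\<gamma> \<in> \<Gamma>; reparam \<phi>\<rbrakk> \<Longrightarrow> compose {0..1} \<gamma> \<phi> \<in> \<Gamma>"
    and const_closed: "x \<in> X \<Longrightarrow> const_path x \<in> \<Gamma>"
    and const_equiv: "(\<gamma>, const_path x) \<in> R \<Longrightarrow> \<exists>y\<in>X. \<gamma> = const_path y"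
    and reparam_equiv: "\<lbrakk>\<gamma> \<in> \<Gamma>; reparam \<phi>; \<phi> 0 = 0; \<phi> 1 = 1\<rbrakk>
      \<Longrightarrow> (\<gamma>, compose {0..1} \<gamma> \<phi>) \<in> R"
    and concat_equiv_iff: "\<lbrakk>\<gamma> \<in> \<Gamma>; \<gamma>' \<in> \<Gamma>; \<rho> \<in> \<Gamma>; \<rho>' \<in> \<Gamma>;
        \<rho> 1 = \<gamma> 0; \<gamma> 1 = \<rho>' 0; \<rho> 1 = \<gamma>' 0; \<gamma>' 1 = \<rho>' 0\<rbrakk>
      \<Longrightarrow> (\<gamma>, \<gamma>') \<in> R \<longleftrightarrow> (\<rho> \<cdot> \<gamma> \<cdot> \<rho>', \<rho> \<cdot> \<gamma>' \<cdot> \<rho>') \<in> R"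

definition in_pixel :: "'x set set \<Rightarrow> 'x pth \<Rightarrow> bool" where
  "in_pixel P \<rho> \<longleftrightarrow> (\<exists>Y\<in>P. im \<rho> \<subseteq> Y)"

definition pixel_partition :: "'x set set \<Rightarrow> 'x pth \<Rightarrow> real set list \<Rightarrow> 'x set list \<Rightarrow> bool" where
  "pixel_partition P \<gamma> Is Ys \<longleftrightarrow>
     length Is = length Ys \<and> set Ys \<subseteq> P \<and>
     (\<forall>J\<in>set Is. J \<noteq> {} \<and> is_interval J) \<and> \<Union> (set Is) = {0..1} \<and>
     (\<forall>i j. i < j \<and> j < length Is \<longrightarrow> (\<forall>s\<in>Is ! i. \<forall>t\<in>Is ! j. s < t)) \<and>
     (\<forall>i<length Is. \<gamma> ` (Is ! i) \<subseteq> Ys ! i) \<and>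
     (\<forall>i j. i < length Ys \<and> j < length Ys \<and> i \<noteq> j \<and> Ys ! i = Ys ! j \<longrightarrow>
        \<bar>int i - int j\<bar> > 1)"

text \<open>
  In the second axiom the odd-numbered paths are run backwards: consecutive ones share their end
  at an even position and their start at an odd one.
\<close>

locale screen =
  fixes X :: "'x set" and \<Gamma> :: "'x pth set" and R :: "'x pth rel" and P :: "'x set set"
  assumes partition: "partition_on X P"
    and S1: "\<lbrakk>\<gamma> \<in> \<Gamma>; \<gamma>' \<in> \<Gamma>; \<gamma> 0 = \<gamma>' 0; \<gamma> 1 = \<gamma>' 1; Y \<in> P; im \<gamma> \<subseteq> Y\<rbrakk>
      \<Longrightarrow> (\<gamma>, \<gamma>') \<in> R \<longleftrightarrow> im \<gamma>' \<subseteq> Y"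
    and S2: "\<lbrakk>Y \<in> P; x \<in> Y; y \<in> Y\<rbrakk> \<Longrightarrow> \<exists>n (\<gamma> :: nat \<Rightarrow> 'x pth).
        (\<forall>i\<le>2*n. \<gamma> i \<in> \<Gamma> \<and> im (\<gamma> i) \<subseteq> Y) \<and> \<gamma> 0 0 = x \<and> \<gamma> (2*n) 1 = y \<and>
        (\<forall>i<n. \<gamma> (2*i) 1 = \<gamma> (2*i + 1) 1 \<and> \<gamma> (2*i + 1) 0 = \<gamma> (2*i + 2) 0)"
    and S3: "\<lbrakk>\<rho> \<in> \<Gamma>; \<gamma> \<in> \<Gamma>; \<rho> 0 = \<gamma> 0; in_pixel P \<rho>\<rbrakk> \<Longrightarrow>
        \<exists>\<rho>'\<in>\<Gamma>. \<exists>\<gamma>'\<in>\<Gamma>. in_pixel P \<rho>' \<and> \<gamma> 1 = \<rho>' 0 \<and> \<rho> 1 = \<gamma>' 0 \<and> (\<gamma> \<cdot> \<rho>', \<rho> \<cdot> \<gamma>') \<in> R"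
    and S3_dual: "\<lbrakk>\<rho>' \<in> \<Gamma>; \<gamma>' \<in> \<Gamma>; \<rho>' 1 = \<gamma>' 1; in_pixel P \<rho>'\<rbrakk> \<Longrightarrow>
        \<exists>\<rho>\<in>\<Gamma>. \<exists>\<gamma>\<in>\<Gamma>. in_pixel P \<rho> \<and> \<gamma> 1 = \<rho>' 0 \<and> \<rho> 1 = \<gamma>' 0 \<and> (\<gamma> \<cdot> \<rho>', \<rho> \<cdot> \<gamma>') \<in> R"
    and S4: "\<gamma> \<in> \<Gamma> \<Longrightarrow> \<exists>Is Ys. pixel_partition P \<gamma> Is Ys"
    and S5: "\<lbrakk>\<gamma> \<in> \<Gamma>; \<gamma>' \<in> \<Gamma>; \<gamma> 0 = \<gamma>' 0; \<gamma> 1 = \<gamma>' 1;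
        pixel_partition P \<gamma> Is Ys; pixel_partition P \<gamma>' Is Ys\<rbrakk> \<Longrightarrow> (\<gamma>, \<gamma>') \<in> R"

section \<open>Path categories and pixelations\<close>

abbreviation path_class :: "'x pth rel \<Rightarrow> 'x pth \<Rightarrow> 'x pth set" where
  "path_class R \<gamma> \<equiv> R `` {\<gamma>}"

definition path_cat :: "'x set \<Rightarrow> 'x pth set \<Rightarrow> 'x pth rel \<Rightarrow> ('x, 'x pth set) cat" where
  "path_cat X \<Gamma> R = \<lparr>
     obj = X,
     Hom = \<lambda>x y. {path_class R \<gamma> | \<gamma>. \<gamma> \<in> \<Gamma> \<and> \<gamma> 0 = x \<and> \<gamma> 1 = y},
     idm = \<lambda>x. path_class R (const_path x),
     cmp = \<lambda>x y z g f. R `` {\<gamma> \<cdot> \<gamma>' | \<gamma> \<gamma>'. \<gamma> \<in> f \<and> \<gamma>' \<in> g}\<rparr>"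

definition lin_path_cat :: "'x set \<Rightarrow> 'x pth set \<Rightarrow> 'x pth rel \<Rightarrow>
    ('x option, 'x pth set \<Rightarrow>\<^sub>0 'k, 'k :: {comm_ring, comm_monoid_mult}) lincat" where
  "lin_path_cat X \<Gamma> R = adjoin_zero (linearization (path_cat X \<Gamma> R))"

type_synonym ('x, 'k) path_ideal = "'x option \<Rightarrow> 'x option \<Rightarrow> ('x pth set \<Rightarrow>\<^sub>0 'k) set"

abbreviation smon :: "'x pth rel \<Rightarrow> 'k \<Rightarrow> 'x pth \<Rightarrow>
    ('x pth set \<Rightarrow>\<^sub>0 'k :: {comm_ring, comm_monoid_mult})" where
  "smon R c \<gamma> \<equiv> Poly_Mapping.single (path_class R \<gamma>) c"

definition path_based :: "'x set \<Rightarrow> 'x pth set \<Rightarrow> 'x pth rel \<Rightarrow>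
    ('x, 'k :: {comm_ring, comm_monoid_mult}) path_ideal \<Rightarrow> bool" where
  "path_based X \<Gamma> R I \<longleftrightarrow> (\<exists>S.
     (\<forall>x y. \<forall>f\<in>S x y. \<exists>a b. x = Some a \<and> y = Some b \<and>
        (\<exists>(n :: nat) c \<gamma>. f = (\<Sum>i<n. smon R (c i) (\<gamma> i)) \<and>
           (\<forall>i<n. \<gamma> i \<in> \<Gamma> \<and> \<gamma> i 0 = a \<and> \<gamma> i 1 = b \<and> (\<forall>d. c i * d = 0 \<longrightarrow> d = 0)))) \<and>
     (\<forall>x\<in>insert None (Some ` X). \<forall>y\<in>insert None (Some ` X).
        I x y = ideal_gen (lin_path_cat X \<Gamma> R) S x y))"

abbreviation alg_cat :: "'x set \<Rightarrow> 'x pth set \<Rightarrow> 'x pth rel \<Rightarrow>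
    ('x, 'k :: {comm_ring, comm_monoid_mult}) path_ideal \<Rightarrow>
    ('x option, ('x pth set \<Rightarrow>\<^sub>0 'k) set, 'k) lincat" where
  "alg_cat X \<Gamma> R I \<equiv> lin_quotient (lin_path_cat X \<Gamma> R) I"

definition quot_path :: "'x set \<Rightarrow> 'x pth set \<Rightarrow> 'x pth rel \<Rightarrow>
    ('x, 'k :: {comm_ring, comm_monoid_mult}) path_ideal \<Rightarrow> 'k \<Rightarrow> 'x pth \<Rightarrow>
    ('x pth set \<Rightarrow>\<^sub>0 'k) set" where
  \<comment> \<open>the morphism \<open>c[\<gamma>]\<close> of the quotient by \<open>I\<close>\<close>
  "quot_path X \<Gamma> R I c \<gamma> = coset (lin_path_cat X \<Gamma> R) I (Some (\<gamma> 0)) (Some (\<gamma> 1)) (smon R c \<gamma>)"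

subsection \<open>The pixelation of \<open>C\<close>\<close>

definition Sigma_C :: "'x pth set \<Rightarrow> 'x pth rel \<Rightarrow> 'x set set \<Rightarrow> 'x \<Rightarrow> 'x \<Rightarrow> 'x pth set set" where
  "Sigma_C \<Gamma> R P x y = {path_class R \<rho> | \<rho>. \<rho> \<in> \<Gamma> \<and> in_pixel P \<rho> \<and> \<rho> 0 = x \<and> \<rho> 1 = y}"

abbreviation pixelation_C where
  "pixelation_C X \<Gamma> R P \<equiv> localization (path_cat X \<Gamma> R) (Sigma_C \<Gamma> R P)"

abbreviation p_func where
  "p_func X \<Gamma> R P \<equiv> loc_func (path_cat X \<Gamma> R) (Sigma_C \<Gamma> R P)"

abbreviation frac_C where
  "frac_C X \<Gamma> R P \<equiv> frac (path_cat X \<Gamma> R) (Sigma_C \<Gamma> R P)"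

definition pixelates_C :: "'x pth set \<Rightarrow> 'x pth rel \<Rightarrow> 'x set set \<Rightarrow> ('o, 'm, 'z) cat_scheme \<Rightarrow>
    ('x, 'x pth set, 'o, 'm) func \<Rightarrow> bool" where
  "pixelates_C \<Gamma> R P K M \<longleftrightarrow> (\<forall>x y. \<forall>\<sigma>\<in>Sigma_C \<Gamma> R P x y.
     is_iso K (fobj M x) (fobj M y) (farr M x y \<sigma>))"

subsection \<open>The pixelation of \<open>A\<close>\<close>

definition path_pixel_equiv ::
  "'x pth set \<Rightarrow> 'x pth rel \<Rightarrow> 'x set set \<Rightarrow> 'x pth \<Rightarrow> 'x pth \<Rightarrow> bool" where
  "path_pixel_equiv \<Gamma> R P \<gamma> \<gamma>' \<longleftrightarrow> \<gamma> \<in> \<Gamma> \<and> \<gamma>' \<in> \<Gamma> \<and>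
     (\<exists>\<rho>1\<in>\<Gamma>. \<exists>\<rho>2\<in>\<Gamma>. \<exists>\<rho>3\<in>\<Gamma>. \<exists>\<rho>4\<in>\<Gamma>.
        (\<exists>Y\<in>P. im \<rho>1 \<union> im \<rho>2 \<subseteq> Y) \<and> (\<exists>Y\<in>P. im \<rho>3 \<union> im \<rho>4 \<subseteq> Y) \<and>
        \<rho>1 1 = \<gamma> 0 \<and> \<gamma> 1 = \<rho>3 0 \<and> \<rho>2 1 = \<gamma>' 0 \<and> \<gamma>' 1 = \<rho>4 0 \<and>
        (\<rho>1 \<cdot> \<gamma> \<cdot> \<rho>3, \<rho>2 \<cdot> \<gamma>' \<cdot> \<rho>4) \<in> R)"

text \<open>
  Two morphisms are equivalent if they have presentations as linear combinations that, after a
  permutation of the summands, match termwise; here the summands are already listed accordingly.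
\<close>

definition pixel_equiv :: "'x pth set \<Rightarrow> 'x pth rel \<Rightarrow> 'x set set \<Rightarrow> 'x \<Rightarrow> 'x \<Rightarrow> 'x \<Rightarrow> 'x \<Rightarrow>
    ('x pth set \<Rightarrow>\<^sub>0 'k :: {comm_ring, comm_monoid_mult}) \<Rightarrow> ('x pth set \<Rightarrow>\<^sub>0 'k) \<Rightarrow> bool" where
  "pixel_equiv \<Gamma> R P x y x' y' f g \<longleftrightarrow> (\<exists>(n :: nat) c \<gamma> \<gamma>'.
     f = (\<Sum>i<n. smon R (c i) (\<gamma> i)) \<and> g = (\<Sum>i<n. smon R (c i) (\<gamma>' i)) \<and>
     (\<forall>i<n. \<gamma> i 0 = x \<and> \<gamma> i 1 = y \<and> \<gamma>' i 0 = x' \<and> \<gamma>' i 1 = y' \<and>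
        path_pixel_equiv \<Gamma> R P (\<gamma> i) (\<gamma>' i)))"

definition pixel_ideal :: "'x set \<Rightarrow> 'x pth set \<Rightarrow> 'x pth rel \<Rightarrow> 'x set set \<Rightarrow>
    ('x, 'k :: {comm_ring, comm_monoid_mult}) path_ideal \<Rightarrow> ('x, 'k) path_ideal" where
  "pixel_ideal X \<Gamma> R P I = ideal_gen (lin_path_cat X \<Gamma> R)
     (\<lambda>x y. {f. \<exists>a\<in>X. \<exists>b\<in>X. \<exists>a'\<in>X. \<exists>b'\<in>X. x = Some a \<and> y = Some b \<and>
        (\<exists>g\<in>I (Some a') (Some b'). pixel_equiv \<Gamma> R P a b a' b' f g)})"

abbreviation alg_bar where
  "alg_bar X \<Gamma> R P I \<equiv> alg_cat X \<Gamma> R (pixel_ideal X \<Gamma> R P I)"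

definition pre_dead :: "'x set \<Rightarrow> 'x pth set \<Rightarrow> 'x pth rel \<Rightarrow>
    ('x, 'k :: {comm_ring, comm_monoid_mult}) path_ideal \<Rightarrow> 'x set \<Rightarrow> bool" where
  "pre_dead X \<Gamma> R I Y \<longleftrightarrow> (\<exists>\<rho>\<in>\<Gamma>. im \<rho> \<subseteq> Y \<and>
     quot_path X \<Gamma> R I 1 \<rho> = hzero (alg_cat X \<Gamma> R I) (Some (\<rho> 0)) (Some (\<rho> 1)))"

text \<open>The classes \<open>[\<rho>] \<noteq> 0\<close> of the quotient category with \<open>im \<rho>\<close> in a pixel.\<close>

definition live_Sigma :: "'x set \<Rightarrow> 'x pth set \<Rightarrow> 'x pth rel \<Rightarrow> 'x set set \<Rightarrow>
    ('x, 'k :: {comm_ring, comm_monoid_mult}) path_ideal \<Rightarrow> 'x option \<Rightarrow> 'x option \<Rightarrow>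
    ('x pth set \<Rightarrow>\<^sub>0 'k) set set" where
  "live_Sigma X \<Gamma> R P I x y = {quot_path X \<Gamma> R (pixel_ideal X \<Gamma> R P I) 1 \<rho> | \<rho>.
     \<rho> \<in> \<Gamma> \<and> in_pixel P \<rho> \<and> x = Some (\<rho> 0) \<and> y = Some (\<rho> 1) \<and>
     quot_path X \<Gamma> R (pixel_ideal X \<Gamma> R P I) 1 \<rho> \<noteq> hzero (alg_bar X \<Gamma> R P I) x y}"

definition Sigma_A :: "'x set \<Rightarrow> 'x pth set \<Rightarrow> 'x pth rel \<Rightarrow> 'x set set \<Rightarrow>
    ('x, 'k :: {comm_ring, comm_monoid_mult}) path_ideal \<Rightarrow> 'x option \<Rightarrow> 'x option \<Rightarrow>
    ('x pth set \<Rightarrow>\<^sub>0 'k) set set" where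
  "Sigma_A X \<Gamma> R P I x y = live_Sigma X \<Gamma> R P I x y \<union>
     {f. f = hzero (alg_bar X \<Gamma> R P I) x y \<and>
         (\<exists>Y\<in>P. pre_dead X \<Gamma> R I Y \<and> (\<exists>a\<in>Y. \<exists>b\<in>Y. x = Some a \<and> y = Some b))}"

abbreviation pixelation_A where
  "pixelation_A X \<Gamma> R P I \<equiv> lin_localization (alg_bar X \<Gamma> R P I) (Sigma_A X \<Gamma> R P I)"

abbreviation frac_A where
  "frac_A X \<Gamma> R P I \<equiv> lin_frac (alg_bar X \<Gamma> R P I) (Sigma_A X \<Gamma> R P I)"

definition pi_func where
  "pi_func X \<Gamma> R P I = lin_loc_func (alg_bar X \<Gamma> R P I) (Sigma_A X \<Gamma> R P I)
     \<circ>\<^sub>F quotient_func (lin_path_cat X \<Gamma> R) (pixel_ideal X \<Gamma> R P I)"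

definition dead :: "'x set \<Rightarrow> 'x pth set \<Rightarrow> 'x pth rel \<Rightarrow> 'x set set \<Rightarrow>
    ('x, 'k :: {comm_ring, comm_monoid_mult}) path_ideal \<Rightarrow> 'x set \<Rightarrow> bool" where
  "dead X \<Gamma> R P I Y \<longleftrightarrow> (\<exists>x\<in>Y. isomorphic (pixelation_A X \<Gamma> R P I) (Some x) None)"

definition pixelates_A :: "'x set \<Rightarrow> 'x pth set \<Rightarrow> 'x pth rel \<Rightarrow> 'x set set \<Rightarrow>
    ('x, 'k :: {comm_ring, comm_monoid_mult}) path_ideal \<Rightarrow> ('o, 'm, 'k, 'z) lincat_scheme \<Rightarrow>
    ('x option, ('x pth set \<Rightarrow>\<^sub>0 'k) set, 'o, 'm) func \<Rightarrow> bool" where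
  "pixelates_A X \<Gamma> R P I K M \<longleftrightarrow>
     (\<forall>\<rho>\<in>\<Gamma>. in_pixel P \<rho> \<and>
        quot_path X \<Gamma> R (pixel_ideal X \<Gamma> R P I) 1 \<rho> \<noteq>
          hzero (alg_bar X \<Gamma> R P I) (Some (\<rho> 0)) (Some (\<rho> 1)) \<longrightarrow>
        is_iso K (fobj M (Some (\<rho> 0))) (fobj M (Some (\<rho> 1)))
          (farr M (Some (\<rho> 0)) (Some (\<rho> 1)) (quot_path X \<Gamma> R I 1 \<rho>))) \<and>
     (\<forall>Y\<in>P. pre_dead X \<Gamma> R I Y \<longrightarrow> (\<forall>x\<in>Y. \<forall>y\<in>Y.
        is_iso K (fobj M (Some x)) (fobj M (Some y))
          (farr M (Some x) (Some y) (hzero (alg_cat X \<Gamma> R I) (Some x) (Some y)))))"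

section \<open>Categories from quivers\<close>

text \<open>Throughout, \<open>s\<close> chooses a point in each pixel.\<close>

definition crosses_once :: "'x set set \<Rightarrow> 'x pth \<Rightarrow> bool" where
  "crosses_once P \<gamma> \<longleftrightarrow> (\<exists>Is Ys. pixel_partition P \<gamma> Is Ys \<and> length Is = 2)"

subsection \<open>From \<open>C\<close>\<close>

definition pseudo_arrows_C :: "'x set \<Rightarrow> 'x pth set \<Rightarrow> 'x pth rel \<Rightarrow> 'x set set \<Rightarrow> 'x \<Rightarrow> 'x \<Rightarrow>
    ('x, 'x pth set zigzag) word set set" where
  "pseudo_arrows_C X \<Gamma> R P x y =
     {frac_C X \<Gamma> R P x (\<gamma> 1) y (path_class R \<rho>) (path_class R \<gamma>) | \<rho> \<gamma>.
        \<rho> \<in> \<Gamma> \<and> in_pixel P \<rho> \<and> \<gamma> \<in> \<Gamma> \<and> crosses_once P \<gamma> \<and>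
        \<gamma> 0 = x \<and> \<rho> 0 = y \<and> \<rho> 1 = \<gamma> 1}"

definition quiver_C where
  "quiver_C X \<Gamma> R P s =
     \<lparr>Verts = P, Arrows = \<lambda>U V. pseudo_arrows_C X \<Gamma> R P (s U) (s V)\<rparr>"

abbreviation Psi where
  "Psi X \<Gamma> R P s \<equiv> word_ext (pixelation_C X \<Gamma> R P) s (\<lambda>U V a. a)"

definition Psi_ker where
  "Psi_ker X \<Gamma> R P s U V = {(v, w).
     v \<in> Hom (free_cat (quiver_C X \<Gamma> R P s)) U V \<and> w \<in> Hom (free_cat (quiver_C X \<Gamma> R P s)) U V \<and>
     Psi X \<Gamma> R P s U V v = Psi X \<Gamma> R P s U V w}"

definition Qbar_C where
  "Qbar_C X \<Gamma> R P s = quotient_cat (free_cat (quiver_C X \<Gamma> R P s)) (Psi_ker X \<Gamma> R P s)"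

text \<open>
  Pseudo arrows \<open>x \<rightarrow> y\<close> between arbitrary points are related to those between chosen points by
  composition with fractions \<open>\<sigma>\<^sup>-\<^sup>1\<sigma>'\<close>, on which the functor is already prescribed.
\<close>

definition canonical_H where
  "canonical_H X \<Gamma> R P s H \<longleftrightarrow>
     is_equivalence (pixelation_C X \<Gamma> R P) (Qbar_C X \<Gamma> R P s) H \<and>
     (\<forall>U\<in>P. \<forall>x\<in>U. fobj H x = U) \<and>
     (\<forall>U\<in>P. \<forall>x\<in>U. \<forall>y\<in>U. \<forall>z\<in>X. \<forall>\<sigma>'\<in>Sigma_C \<Gamma> R P x z. \<forall>\<sigma>\<in>Sigma_C \<Gamma> R P y z.
        farr H x y (frac_C X \<Gamma> R P x z y \<sigma> \<sigma>') = idm (Qbar_C X \<Gamma> R P s) U) \<and>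
     (\<forall>U\<in>P. \<forall>V\<in>P. \<forall>a\<in>pseudo_arrows_C X \<Gamma> R P (s U) (s V).
        farr H (s U) (s V) a = Psi_ker X \<Gamma> R P s U V `` {[(U, V, a)]})"

subsection \<open>From \<open>A\<close>\<close>

definition pseudo_arrows_A :: "'x set \<Rightarrow> 'x pth set \<Rightarrow> 'x pth rel \<Rightarrow> 'x set set \<Rightarrow>
    ('x, 'k :: {comm_ring, comm_monoid_mult}) path_ideal \<Rightarrow> 'x \<Rightarrow> 'x \<Rightarrow>
    (('x option, ('x pth set \<Rightarrow>\<^sub>0 'k) set zigzag) word \<Rightarrow>\<^sub>0 'k) set set" where
  "pseudo_arrows_A X \<Gamma> R P I x y =
     {a. a \<noteq> hzero (pixelation_A X \<Gamma> R P I) (Some x) (Some y) \<and>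
        (\<exists>\<gamma>\<in>\<Gamma>. \<exists>\<sigma>\<in>Sigma_A X \<Gamma> R P I (Some y) (Some (\<gamma> 1)). \<exists>c. \<gamma> 0 = x \<and> crosses_once P \<gamma> \<and>
           a = frac_A X \<Gamma> R P I (Some x) (Some (\<gamma> 1)) (Some y) \<sigma>
                 (quot_path X \<Gamma> R (pixel_ideal X \<Gamma> R P I) c \<gamma>))}"

text \<open>The pseudo arrows of the form \<open>[\<rho>]\<^sup>-\<^sup>1[\<gamma>]\<close>.\<close>

definition unit_pseudo_arrows_A :: "'x set \<Rightarrow> 'x pth set \<Rightarrow> 'x pth rel \<Rightarrow> 'x set set \<Rightarrow>
    ('x, 'k :: {comm_ring, comm_monoid_mult}) path_ideal \<Rightarrow> 'x \<Rightarrow> 'x \<Rightarrow>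
    (('x option, ('x pth set \<Rightarrow>\<^sub>0 'k) set zigzag) word \<Rightarrow>\<^sub>0 'k) set set" where
  "unit_pseudo_arrows_A X \<Gamma> R P I x y =
     {a. a \<noteq> hzero (pixelation_A X \<Gamma> R P I) (Some x) (Some y) \<and>
        (\<exists>\<gamma>\<in>\<Gamma>. \<exists>\<sigma>\<in>live_Sigma X \<Gamma> R P I (Some y) (Some (\<gamma> 1)). \<gamma> 0 = x \<and> crosses_once P \<gamma> \<and>
           a = frac_A X \<Gamma> R P I (Some x) (Some (\<gamma> 1)) (Some y) \<sigma>
                 (quot_path X \<Gamma> R (pixel_ideal X \<Gamma> R P I) 1 \<gamma>))}"

text \<open>
  Over a general ring, being a nonzero multiple is not symmetric; the classes modulo nonzero
  scalars are those of the equivalence relation it generates.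
\<close>

definition scalar_equiv where
  "scalar_equiv X \<Gamma> R P I x y =
     (let r = {(a, b). a \<in> pseudo_arrows_A X \<Gamma> R P I x y \<and> b \<in> pseudo_arrows_A X \<Gamma> R P I x y \<and>
                 (\<exists>c. c \<noteq> 0 \<and> b = hscale (pixelation_A X \<Gamma> R P I) (Some x) (Some y) c a)}
      in (r \<union> r\<inverse>)\<^sup>*)"

definition quiver_A where
  "quiver_A X \<Gamma> R P I s =
     \<lparr>Verts = {U \<in> P. \<not> dead X \<Gamma> R P I U},
      Arrows = \<lambda>U V. pseudo_arrows_A X \<Gamma> R P I (s U) (s V) // scalar_equiv X \<Gamma> R P I (s U) (s V)\<rparr>"

definition Q_A where
  "Q_A X \<Gamma> R P I s = adjoin_zero (linearization (free_cat (quiver_A X \<Gamma> R P I s)))"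

definition Phi where
  "Phi X \<Gamma> R P I s =
     (let L = pixelation_A X \<Gamma> R P I; \<phi> = map_option s in
      \<lparr>fobj = \<phi>,
       farr = \<lambda>u v f. case (u, v) of
           (Some U, Some V) \<Rightarrow> lin_word_ext L (\<lambda>W. Some (s W))
             (\<lambda>W W' b. SOME a. a \<in> b \<and> a \<in> unit_pseudo_arrows_A X \<Gamma> R P I (s W) (s W')) U V f
         | _ \<Rightarrow> hzero L (\<phi> u) (\<phi> v)\<rparr>)"

definition Phi_ker where
  "Phi_ker X \<Gamma> R P I s u v = {f \<in> Hom (Q_A X \<Gamma> R P I s) u v.
     farr (Phi X \<Gamma> R P I s) u v f =
       hzero (pixelation_A X \<Gamma> R P I) (fobj (Phi X \<Gamma> R P I s) u) (fobj (Phi X \<Gamma> R P I s) v)}"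

definition Qbar_A where
  "Qbar_A X \<Gamma> R P I s = lin_quotient (Q_A X \<Gamma> R P I s) (Phi_ker X \<Gamma> R P I s)"

definition canonical_G where
  "canonical_G X \<Gamma> R P I s G \<longleftrightarrow>
     linear_functor (pixelation_A X \<Gamma> R P I) (Qbar_A X \<Gamma> R P I s) G \<and>
     is_equivalence (pixelation_A X \<Gamma> R P I) (Qbar_A X \<Gamma> R P I s) G \<and>
     (\<forall>U\<in>P. \<forall>x\<in>U. fobj G (Some x) = (if dead X \<Gamma> R P I U then None else Some U)) \<and>
     (\<forall>U\<in>P. \<not> dead X \<Gamma> R P I U \<longrightarrow> (\<forall>x\<in>U. \<forall>y\<in>U. \<forall>z\<in>X.
        \<forall>\<sigma>'\<in>Sigma_A X \<Gamma> R P I (Some x) (Some z). \<forall>\<sigma>\<in>Sigma_A X \<Gamma> R P I (Some y) (Some z).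
          farr G (Some x) (Some y) (frac_A X \<Gamma> R P I (Some x) (Some z) (Some y) \<sigma> \<sigma>') =
          idm (Qbar_A X \<Gamma> R P I s) (Some U))) \<and>
     (\<forall>U\<in>P. \<forall>V\<in>P. \<not> dead X \<Gamma> R P I U \<longrightarrow> \<not> dead X \<Gamma> R P I V \<longrightarrow>
        (\<forall>a\<in>pseudo_arrows_A X \<Gamma> R P I (s U) (s V). \<exists>c.
          farr G (Some (s U)) (Some (s V)) a =
          hscale (Qbar_A X \<Gamma> R P I s) (Some U) (Some V) c
            (coset (Q_A X \<Gamma> R P I s) (Phi_ker X \<Gamma> R P I s) (Some U) (Some V)
               (Poly_Mapping.single
                  [(U, V, scalar_equiv X \<Gamma> R P I (s U) (s V) `` {a})] 1))))"

end

theory Submission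
  imports Defs
begin

text \<open>
  A representation that inverts the morphisms in pixels extends along the localization to a functor
  on the pixelation, and composing this extension with a quasi-inverse of the canonical equivalence
  gives \<open>Mbar\<close>; a quasi-inverse of a linear equivalence is again linear.

  In the linear case one first has to see that \<open>M\<close> annihilates the ideal of the pixelation.  By the
  Ore conditions, every element \<open>f\<close> of that ideal is moved into \<open>I\<close>
    by composing it on both sides with
  paths in pixels.  Applied to a path in a pixel, this shows that a pixel containing a path that
  vanishes in the pixelation is pre-dead, so that \<open>M\<close> is zero on it; otherwise the two paths act on
  \<open>M\<close> as isomorphisms, and \<open>M f = 0\<close>.
\<close>

section \<open>Functors, equivalences and localizations\<close>

text \<open>The obstacle is that \<open>M\<close> lives on the quotient by \<open>I\<close>, while
  the pixelation starts from the larger ideal \<open>pixel_ideal X \<Gamma> R P I\<close>, which is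
  known only through generators. It is controlled by an explicit upper bound
  \<open>absorbed\<close>: all morphisms that one single pair of pixel paths moves into
  \<open>I\<close>. Closure of this set under sums and composition is where the screen axioms enter:
  (S3) pushes a pixel path past an arbitrary path, and (S1) makes parallel pixel paths equivalent,
  so that different witnesses have interchangeable common extensions. Localizations are words modulo
  relations, and a functor inverting the pixel paths is evaluated letter by letter on words. These
  extensions restrict strictly to \<open>M\<close>; the isomorphism in the theorem comes only from
  the quasi-inverse. Linearity of the quasi-inverse presupposes that the quotient of the quiver
  category is linear, that is, that \<open>Phi\<close> is a linear functor. Since \<open>Phi\<close>
  selects a pseudo arrow by Hilbert choice, each class of pseudo arrows has to be shown to contain
  one of the form \<open>[\<rho>]\<^sup>-\<^sup>1[\<gamma>]\<close>.\<close>

lemma is_functorI: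
  assumes "\<And>x. x \<in> obj D \<Longrightarrow> fobj F x \<in> obj E"
    and "\<And>x y f. \<lbrakk>x \<in> obj D; y \<in> obj D; f \<in> Hom D x y\<rbrakk>
      \<Longrightarrow> farr F x y f \<in> Hom E (fobj F x) (fobj F y)"
    and "\<And>x. x \<in> obj D \<Longrightarrow> farr F x x (idm D x) = idm E (fobj F x)"
    and "\<And>x y z f g. \<lbrakk>x \<in> obj D; y \<in> obj D; z \<in> obj D; f \<in> Hom D x y; g \<in> Hom D y z\<rbrakk>
      \<Longrightarrow> farr F x z (cmp D x y z g f) =
          cmp E (fobj F x) (fobj F y) (fobj F z) (farr F y z g) (farr F x y f)"
  shows "is_functor D E F"
  using assms unfolding is_functor_def by blast

lemma is_functorD:
  assumes "is_functor D E F"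
  shows functor_obj: "x \<in> obj D \<Longrightarrow> fobj F x \<in> obj E"
    and functor_arr: "\<lbrakk>x \<in> obj D; y \<in> obj D; f \<in> Hom D x y\<rbrakk>
      \<Longrightarrow> farr F x y f \<in> Hom E (fobj F x) (fobj F y)"
    and functor_idm: "x \<in> obj D \<Longrightarrow> farr F x x (idm D x) = idm E (fobj F x)"
    and functor_cmp: "\<lbrakk>x \<in> obj D; y \<in> obj D; z \<in> obj D; f \<in> Hom D x y; g \<in> Hom D y z\<rbrakk>
      \<Longrightarrow> farr F x z (cmp D x y z g f) =
          cmp E (fobj F x) (fobj F y) (fobj F z) (farr F y z g) (farr F x y f)"
  using assms unfolding is_functor_def by blast+

lemma functor_comp_functor:
  assumes F: "is_functor D E F" and G: "is_functor E K G"
  shows "is_functor D K (G \<circ>\<^sub>F F)"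
  by (rule is_functorI)
    (simp_all add: func_comp_def is_functorD[OF F] is_functorD[OF G])

lemma is_isoI:
  "\<lbrakk>f \<in> Hom D x y; g \<in> Hom D y x; cmp D x y x g f = idm D x; cmp D y x y f g = idm D y\<rbrakk>
    \<Longrightarrow> is_iso D x y f"
  by (auto simp: is_iso_def)

lemma is_isoE:
  assumes "is_iso D x y f"
  obtains g where "f \<in> Hom D x y" "g \<in> Hom D y x"
    "cmp D x y x g f = idm D x" "cmp D y x y f g = idm D y"
  using assms by (auto simp: is_iso_def)

lemma functor_iso:
  assumes F: "is_functor D E F" and "x \<in> obj D" "y \<in> obj D" and iso: "is_iso D x y f"
  shows "is_iso E (fobj F x) (fobj F y) (farr F x y f)"
proof -
  from iso obtain g where g: "f \<in> Hom D x y" "g \<in> Hom D y x"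
    "cmp D x y x g f = idm D x" "cmp D y x y f g = idm D y" by (rule is_isoE)
  show ?thesis
  proof (rule is_isoI)
    show "farr F x y f \<in> Hom E (fobj F x) (fobj F y)" "farr F y x g \<in> Hom E (fobj F y) (fobj F x)"
      using assms g by (simp_all add: is_functorD[OF F])
    show "cmp E (fobj F x) (fobj F y) (fobj F x) (farr F y x g) (farr F x y f) = idm E (fobj F x)"
      "cmp E (fobj F y) (fobj F x) (fobj F y) (farr F x y f) (farr F y x g) = idm E (fobj F y)"
      using assms(2,3) g functor_cmp[OF F, of x y x f g] functor_cmp[OF F, of y x y g f]
      by (simp_all add: functor_idm[OF F])
  qed
qed

context category
begin

lemma iso_cancel_left:
  assumes "x \<in> obj D" "y \<in> obj D" "z \<in> obj D" and iso: "is_iso D y z s"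
    and "f \<in> Hom D x y" "g \<in> Hom D x y" and eq: "cmp D x y z s f = cmp D x y z s g"
  shows "f = g"
proof -
  from iso obtain t where t: "s \<in> Hom D y z" "t \<in> Hom D z y" "cmp D y z y t s = idm D y"
    by (rule is_isoE)
  have "cmp D x z y t (cmp D x y z s f) = cmp D x z y t (cmp D x y z s g)"
    by (simp only: eq)
  then show ?thesis
    using assms(1-3,5,6) t by (simp add: cmp_assoc cmp_idm_left)
qed

lemma iso_cancel_right:
  assumes "x \<in> obj D" "y \<in> obj D" "z \<in> obj D" and iso: "is_iso D x y s"
    and "f \<in> Hom D y z" "g \<in> Hom D y z" and eq: "cmp D x y z f s = cmp D x y z g s"
  shows "f = g"
proof -
  from iso obtain t where t: "s \<in> Hom D x y" "t \<in> Hom D y x" "cmp D y x y s t = idm D y"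
    by (rule is_isoE)
  have "cmp D y x z (cmp D x y z f s) t = cmp D y x z (cmp D x y z g s) t"
    by (simp only: eq)
  then show ?thesis
    using assms(1-3,5,6) t by (simp add: cmp_assoc[symmetric] cmp_idm_right)
qed

end

text \<open>Whiskering the isomorphism of \<open>F' \<circ>\<^sub>F F\<close> with the identity by
  \<open>N\<close> on one side and \<open>p\<close> on the other gives an isomorphism from the long
  composite to \<open>N \<circ>\<^sub>F p\<close>, which agrees with \<open>M\<close> on the nose.
  Naturality involves \<open>p\<close> only through objects and single arrows, hence the pointwise
  assumptions on it.\<close>

lemma nat_isomorphic_extension:
  assumes N: "is_functor L K N" and nat: "nat_isomorphic L L (F' \<circ>\<^sub>F F) id_func"
    and F'F: "is_functor L L (F' \<circ>\<^sub>F F)"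
    and p_obj: "\<And>x. x \<in> obj D \<Longrightarrow> fobj p x \<in> obj L"
    and p_arr: "\<And>x y f. \<lbrakk>x \<in> obj D; y \<in> obj D; f \<in> Hom D x y\<rbrakk>
      \<Longrightarrow> farr p x y f \<in> Hom L (fobj p x) (fobj p y)"
    and Np_obj: "\<And>x. x \<in> obj D \<Longrightarrow> fobj N (fobj p x) = fobj M x"
    and Np_arr: "\<And>x y f. \<lbrakk>x \<in> obj D; y \<in> obj D; f \<in> Hom D x y\<rbrakk>
      \<Longrightarrow> farr N (fobj p x) (fobj p y) (farr p x y f) = farr M x y f"
  shows "nat_isomorphic D K (N \<circ>\<^sub>F F' \<circ>\<^sub>F F \<circ>\<^sub>F p) M"
proof -
  define T where "T = F' \<circ>\<^sub>F F"
  have NT: "N \<circ>\<^sub>F F' \<circ>\<^sub>F F \<circ>\<^sub>F p = N \<circ>\<^sub>F T \<circ>\<^sub>F p"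
    by (simp add: func_comp_def T_def)
  have "nat_isomorphic L L T id_func"
    using nat by (simp add: T_def)
  then obtain \<theta> where iso: "\<forall>x\<in>obj L. is_iso L (fobj T x) x (\<theta> x)"
    and sq: "\<forall>x\<in>obj L. \<forall>y\<in>obj L. \<forall>f\<in>Hom L x y.
        cmp L (fobj T x) (fobj T y) y (\<theta> y) (farr T x y f) =
        cmp L (fobj T x) x y f (\<theta> x)"
    by (simp add: nat_isomorphic_def id_func_def) blast
  have T: "is_functor L L T"
    using F'F by (simp add: T_def)
  \<comment> \<open>The whiskered family: \<open>N\<close> applied to the component of
    \<open>\<theta>\<close> at \<open>p x\<close>.\<close>
  define \<eta> where "\<eta> x = farr N (fobj T (fobj p x)) (fobj p x) (\<theta> (fobj p x))" for x
  have "is_iso K (fobj (N \<circ>\<^sub>F T \<circ>\<^sub>F p) x) (fobj M x) (\<eta> x)" if "x \<in> obj D" for x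
    using functor_iso[OF N _ _ bspec[OF iso p_obj[OF that]]] p_obj[OF that] functor_obj[OF T]
    by (simp add: func_comp_def \<eta>_def Np_obj[OF that])
  moreover
  have "cmp K (fobj (N \<circ>\<^sub>F T \<circ>\<^sub>F p) x) (fobj (N \<circ>\<^sub>F T \<circ>\<^sub>F p) y) (fobj M y) (\<eta> y)
          (farr (N \<circ>\<^sub>F T \<circ>\<^sub>F p) x y f) =
        cmp K (fobj (N \<circ>\<^sub>F T \<circ>\<^sub>F p) x) (fobj M x) (fobj M y) (farr M x y f) (\<eta> x)"
    if x: "x \<in> obj D" and y: "y \<in> obj D" and f: "f \<in> Hom D x y" for x y f
  proof -
    let ?x = "fobj p x" and ?y = "fobj p y" and ?f = "farr p x y f"
    note L = p_obj[OF x] p_obj[OF y] p_arr[OF x y f]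
    have \<theta>: "\<theta> ?x \<in> Hom L (fobj T ?x) ?x" "\<theta> ?y \<in> Hom L (fobj T ?y) ?y"
      using iso L by (auto simp: is_iso_def)
    have "farr N (fobj T ?x) ?y (cmp L (fobj T ?x) (fobj T ?y) ?y (\<theta> ?y) (farr T ?x ?y ?f)) =
        farr N (fobj T ?x) ?y (cmp L (fobj T ?x) ?x ?y ?f (\<theta> ?x))"
      using sq L by simp
    then show ?thesis
      using L \<theta> by (simp add: is_functorD[OF N] is_functorD[OF T] func_comp_def \<eta>_def
          flip: Np_obj[OF x] Np_obj[OF y] Np_arr[OF x y f])
  qed
  ultimately show ?thesis
    unfolding NT nat_isomorphic_def by blast
qed

section \<open>Words in a quiver and functors on free categories\<close>

lemma is_word_Verts: "is_word Q u v w \<Longrightarrow> u \<in> Verts Q \<and> v \<in> Verts Q"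
  by (induction Q u v w rule: is_word.induct) auto

lemma is_word_append: "is_word Q u v p \<Longrightarrow> is_word Q v w q \<Longrightarrow> is_word Q u w (p @ q)"
  by (induction Q u v p rule: is_word.induct) auto

lemma free_cat_simps [simp]:
  "obj (free_cat Q) = Verts Q" "Hom (free_cat Q) u v = {w. is_word Q u v w}"
  "idm (free_cat Q) u = []" "cmp (free_cat Q) u v w q p = p @ q"
  by (simp_all add: free_cat_def)

lemma category_free_cat: "category (free_cat Q)"
  by unfold_locales (auto simp: is_word_append)

context category
begin

lemma word_ext_closed:
  assumes \<phi>: "\<And>v. v \<in> Verts Q \<Longrightarrow> \<phi> v \<in> obj D"
    and \<alpha>: "\<And>u v a. \<lbrakk>u \<in> Verts Q; v \<in> Verts Q; a \<in> Arrows Q u v\<rbrakk> \<Longrightarrow> \<alpha> u v a \<in> Hom D (\<phi> u) (\<phi> v)"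
  shows "is_word Q u v w \<Longrightarrow> word_ext D \<phi> \<alpha> u v w \<in> Hom D (\<phi> u) (\<phi> v)"
proof (induction w arbitrary: u)
  case (Cons t w)
  obtain a b e where [simp]: "t = (a, b, e)"
    by (cases t)
  show ?case
    using Cons assms is_word_Verts[of Q b v w] by (auto intro!: cmp_closed)
qed (use assms in \<open>auto simp: idm_closed\<close>)

lemma word_ext_append:
  assumes \<phi>: "\<And>v. v \<in> Verts Q \<Longrightarrow> \<phi> v \<in> obj D"
    and \<alpha>: "\<And>u v a. \<lbrakk>u \<in> Verts Q; v \<in> Verts Q; a \<in> Arrows Q u v\<rbrakk> \<Longrightarrow> \<alpha> u v a \<in> Hom D (\<phi> u) (\<phi> v)"
  shows "is_word Q u v p \<Longrightarrow> is_word Q v z q \<Longrightarrow>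
    word_ext D \<phi> \<alpha> u z (p @ q) =
    cmp D (\<phi> u) (\<phi> v) (\<phi> z) (word_ext D \<phi> \<alpha> v z q) (word_ext D \<phi> \<alpha> u v p)"
proof (induction p arbitrary: u)
  case Nil
  then show ?case
    using assms is_word_Verts[of Q v z q] word_ext_closed[of Q \<phi> \<alpha> v z q]
    by (simp add: cmp_idm_right)
next
  case (Cons t w)
  obtain a b e where [simp]: "t = (a, b, e)"
    by (cases t)
  show ?case
    using Cons assms is_word_Verts[of Q v z q] is_word_Verts[of Q b v w]
      word_ext_closed[of Q \<phi> \<alpha> v z q] word_ext_closed[of Q \<phi> \<alpha> b v w]
      cmp_assoc[of "\<phi> u" "\<phi> b" "\<phi> v" "\<phi> z" "\<alpha> u b e"]
    by auto
qed

lemma word_ext_functor: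
  assumes "\<And>v. v \<in> Verts Q \<Longrightarrow> \<phi> v \<in> obj D"
    and "\<And>u v a. \<lbrakk>u \<in> Verts Q; v \<in> Verts Q; a \<in> Arrows Q u v\<rbrakk> \<Longrightarrow> \<alpha> u v a \<in> Hom D (\<phi> u) (\<phi> v)"
  shows "is_functor (free_cat Q) D \<lparr>fobj = \<phi>, farr = word_ext D \<phi> \<alpha>\<rparr>"
  using assms
  by (intro is_functorI) (auto simp: word_ext_closed[of Q] word_ext_append[of Q])

end

section \<open>Quotients by congruences and the universal property of localization\<close>

lemma congruence_gen_subset:
  assumes "congruence D E" "\<And>u v. \<lbrakk>u \<in> obj D; v \<in> obj D\<rbrakk> \<Longrightarrow> r u v \<subseteq> E u v"
  shows "congruence_gen D r x y \<subseteq> E x y"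
  using assms unfolding congruence_gen_def by (intro Inter_lower) blast

lemma congruence_gen_refl:
  "\<lbrakk>x \<in> obj D; y \<in> obj D; f \<in> Hom D x y\<rbrakk> \<Longrightarrow> (f, f) \<in> congruence_gen D r x y"
  by (auto simp: congruence_gen_def congruence_def dest: equiv_class_self)

text \<open>Bounds a generated congruence from above: as soon as a functor respects the generating
  relations, its kernel is among the congruences being intersected.\<close>

lemma congruence_kernel:
  assumes "category D" "is_functor D K F"
  shows "congruence D (\<lambda>x y. {(f, g). f \<in> Hom D x y \<and> g \<in> Hom D x y \<and> farr F x y f = farr F x y g})"
  unfolding congruence_def
  by (auto simp: is_functorD[OF assms(2)] category.cmp_closed[OF assms(1)]
      intro!: equivI refl_onI symI transI)

text \<open>The induced functor evaluates \<open>F\<close> at a chosen representative. Reflexivity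
  of \<open>E\<close> makes the classes nonempty, so that the choice is meaningful, and containment
  in the kernel of \<open>F\<close> makes its outcome irrelevant. These two properties are all that
  is asked of \<open>E\<close>, and both are immediate for a generated congruence.\<close>

lemma functor_quotient_cat:
  assumes F: "is_functor D K F"
    and E_refl: "\<And>x y f. \<lbrakk>x \<in> obj D; y \<in> obj D; f \<in> Hom D x y\<rbrakk> \<Longrightarrow> (f, f) \<in> E x y"
    and E: "\<And>x y f g. \<lbrakk>x \<in> obj D; y \<in> obj D; (f, g) \<in> E x y\<rbrakk>
      \<Longrightarrow> f \<in> Hom D x y \<and> g \<in> Hom D x y \<and> farr F x y f = farr F x y g"
    and D: "category D"
  defines "N \<equiv> \<lparr>fobj = fobj F, farr = \<lambda>x y c. farr F x y (SOME f. f \<in> c)\<rparr>"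
  shows "is_functor (quotient_cat D E) K N"
    and "\<And>x y f. \<lbrakk>x \<in> obj D; y \<in> obj D; f \<in> Hom D x y\<rbrakk> \<Longrightarrow>
      farr N x y (E x y `` {f}) = farr F x y f"
proof -
  have N: "farr N x y c = farr F x y f"
    if "x \<in> obj D" "y \<in> obj D" "g \<in> Hom D x y" "c = E x y `` {g}" "f \<in> c" for x y f g c
  proof -
    have "(SOME f. f \<in> c) \<in> c"
      using that by (auto intro: someI)
    then have "(g, SOME f. f \<in> c) \<in> E x y" "(g, f) \<in> E x y"
      using that by auto
    then have "farr F x y (SOME f. f \<in> c) = farr F x y f"
      using E[of x y] that by metis
    then show ?thesis
      by (simp add: N_def)
  qed
  show eq: "farr N x y (E x y `` {f}) = farr F x y f"
    if "x \<in> obj D" "y \<in> obj D" "f \<in> Hom D x y" for x y f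
    using that by (intro N[OF that refl]) (simp add: E_refl)
  show "is_functor (quotient_cat D E) K N"
  proof (rule is_functorI)
    show "fobj N x \<in> obj K" if "x \<in> obj (quotient_cat D E)" for x
      using that functor_obj[OF F] by (simp add: N_def quotient_cat_def)
    show "farr N x y c \<in> Hom K (fobj N x) (fobj N y)"
      if "x \<in> obj (quotient_cat D E)" "y \<in> obj (quotient_cat D E)"
        "c \<in> Hom (quotient_cat D E) x y" for x y c
    proof -
      from that obtain f where "x \<in> obj D" "y \<in> obj D" "f \<in> Hom D x y" "c = E x y `` {f}"
        by (auto simp: quotient_cat_def elim: quotientE)
      then show ?thesis
        using functor_arr[OF F, of x y f] eq by (simp add: N_def)
    qed
    show "farr N x x (idm (quotient_cat D E) x) = idm K (fobj N x)"
      if "x \<in> obj (quotient_cat D E)" for x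
      using that eq[of x x "idm D x"] functor_idm[OF F, of x] category.idm_closed[OF D, of x]
      by (simp add: quotient_cat_def N_def)
    fix x y z c d
    assume "x \<in> obj (quotient_cat D E)" "y \<in> obj (quotient_cat D E)" "z \<in> obj (quotient_cat D E)"
      "c \<in> Hom (quotient_cat D E) x y" "d \<in> Hom (quotient_cat D E) y z"
    then obtain f g where *: "x \<in> obj D" "y \<in> obj D" "z \<in> obj D"
      "f \<in> Hom D x y" "c = E x y `` {f}" "g \<in> Hom D y z" "d = E y z `` {g}"
      by (auto simp: quotient_cat_def elim!: quotientE)
    let ?A = "{cmp D x y z b a |a b. a \<in> c \<and> b \<in> d}"
    have A: "a \<in> Hom D x z \<and> farr F x z a =
        cmp K (fobj N x) (fobj N y) (fobj N z) (farr N y z d) (farr N x y c)" if "a \<in> ?A" for a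
    proof -
      from that obtain f' g' where f': "a = cmp D x y z g' f'" "f' \<in> c" "g' \<in> d"
        by auto
      then have "f' \<in> Hom D x y" "g' \<in> Hom D y z" "farr F x y f' = farr N x y c"
        "farr F y z g' = farr N y z d"
        using * E[of x y f f'] E[of y z g g'] N by auto
      then show ?thesis
        using f' * functor_cmp[OF F, of x y z f' g'] category.cmp_closed[OF D]
        by (auto simp: N_def)
    qed
    \<comment> \<open>A composite in the quotient is the \<open>E\<close>-image of a set of
      composites of representatives. The chosen element is therefore only \<open>E\<close>-related
      to such a composite, which suffices since \<open>E\<close> lies in the kernel.\<close>
    have "cmp D x y z g f \<in> ?A"
      using * E_refl by blast
    then have "cmp D x y z g f \<in> E x z `` ?A"
      using A[of "cmp D x y z g f"] E_refl[of x z "cmp D x y z g f"] *(1,3) by (auto intro: ImageI)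
    then have "(SOME h. h \<in> E x z `` ?A) \<in> E x z `` ?A"
      by (rule someI)
    then obtain a where "a \<in> ?A" and a: "(a, SOME h. h \<in> E x z `` ?A) \<in> E x z"
      by blast
    have "farr F x z (SOME h. h \<in> E x z `` ?A) = farr F x z a"
      using E[OF *(1,3) a] by simp
    then show "farr N x z (cmp (quotient_cat D E) x y z d c) =
        cmp K (fobj N x) (fobj N y) (fobj N z) (farr N y z d) (farr N x y c)"
      using A[OF \<open>a \<in> ?A\<close>] by (simp add: N_def quotient_cat_def)
  qed
qed

definition zigzag_arr ::
  "('p, 'n, 'y) cat_scheme \<Rightarrow> ('o, 'm, 'p, 'n) func \<Rightarrow> 'o \<Rightarrow> 'o \<Rightarrow> 'm zigzag \<Rightarrow> 'n" where
  "zigzag_arr K M x y a = (case a of Fwd f \<Rightarrow> farr M x y f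
     | Bwd s \<Rightarrow> (SOME g. g \<in> Hom K (fobj M x) (fobj M y) \<and>
         cmp K (fobj M y) (fobj M x) (fobj M y) g (farr M y x s) = idm K (fobj M y) \<and>
         cmp K (fobj M x) (fobj M y) (fobj M x) (farr M y x s) g = idm K (fobj M x)))"

text \<open>\<open>S\<close> is an arbitrary family of sets, possibly with elements that are no
  morphisms; the premise \<open>s \<in> Hom D x y\<close> mirrors the intersection in
  \<open>zigzag_quiver\<close>.\<close>

locale inverting_functor = category K + D: category D
  for D :: "('o, 'm, 'z) cat_scheme" and K :: "('p, 'n, 'y) cat_scheme" +
  fixes S :: "'o \<Rightarrow> 'o \<Rightarrow> 'm set" and M :: "('o, 'm, 'p, 'n) func"
  assumes M: "is_functor D K M"
    and inverts: "\<lbrakk>x \<in> obj D; y \<in> obj D; s \<in> S x y; s \<in> Hom D x y\<rbrakk>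
      \<Longrightarrow> is_iso K (fobj M x) (fobj M y) (farr M x y s)"
begin

abbreviation "zz \<equiv> word_ext K (fobj M) (zigzag_arr K M)"

lemma zigzag_arr_Bwd:
  assumes "x \<in> obj D" "y \<in> obj D" "s \<in> S y x" "s \<in> Hom D y x"
  shows "zigzag_arr K M x y (Bwd s) \<in> Hom K (fobj M x) (fobj M y)"
    and "cmp K (fobj M y) (fobj M x) (fobj M y) (zigzag_arr K M x y (Bwd s)) (farr M y x s) =
      idm K (fobj M y)"
    and "cmp K (fobj M x) (fobj M y) (fobj M x) (farr M y x s) (zigzag_arr K M x y (Bwd s)) =
      idm K (fobj M x)"
proof -
  obtain g where "g \<in> Hom K (fobj M x) (fobj M y) \<and>
      cmp K (fobj M y) (fobj M x) (fobj M y) g (farr M y x s) = idm K (fobj M y) \<and>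
      cmp K (fobj M x) (fobj M y) (fobj M x) (farr M y x s) g = idm K (fobj M x)"
    using inverts[of y x s] assms by (auto simp: is_iso_def)
  from someI[of "\<lambda>g. g \<in> Hom K (fobj M x) (fobj M y) \<and>
      cmp K (fobj M y) (fobj M x) (fobj M y) g (farr M y x s) = idm K (fobj M y) \<and>
      cmp K (fobj M x) (fobj M y) (fobj M x) (farr M y x s) g = idm K (fobj M x)", OF this]
  show "zigzag_arr K M x y (Bwd s) \<in> Hom K (fobj M x) (fobj M y)"
    "cmp K (fobj M y) (fobj M x) (fobj M y) (zigzag_arr K M x y (Bwd s)) (farr M y x s) =
      idm K (fobj M y)"
    "cmp K (fobj M x) (fobj M y) (fobj M x) (farr M y x s) (zigzag_arr K M x y (Bwd s)) =
      idm K (fobj M x)"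
    by (simp_all add: zigzag_arr_def)
qed

lemma zz_functor:
  "is_functor (free_cat (zigzag_quiver D S)) K \<lparr>fobj = fobj M, farr = zz\<rparr>"
  by (rule word_ext_functor)
    (auto simp: zigzag_quiver_def is_functorD[OF M] zigzag_arr_Bwd, simp add: zigzag_arr_def
      is_functorD[OF M])

lemma zz_Fwd: "\<lbrakk>x \<in> obj D; y \<in> obj D; f \<in> Hom D x y\<rbrakk> \<Longrightarrow> zz x y [(x, y, Fwd f)] = farr M x y f"
  by (simp add: zigzag_arr_def is_functorD[OF M] cmp_idm_left)

text \<open>Each relation becomes an equation in \<open>K\<close>: functoriality of \<open>M\<close>
  for composites and identities, and the two equations of the chosen inverse for a letter next to
  its formal inverse.\<close>

lemma loc_rel_words:
  assumes "(v, w) \<in> loc_rel D S x y" "x \<in> obj D" "y \<in> obj D"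
  shows "is_word (zigzag_quiver D S) x y v" "is_word (zigzag_quiver D S) x y w"
    "zz x y v = zz x y w"
proof -
  have "is_word (zigzag_quiver D S) x y v \<and> is_word (zigzag_quiver D S) x y w \<and> zz x y v = zz x y w"
    using assms
  proof cases
    case (loc_cmp z f g)
    then show ?thesis
      by (auto simp: zigzag_quiver_def zigzag_arr_def is_functorD[OF M] cmp_idm_left D.cmp_closed
        cmp_closed)
  next
    case loc_id
    then show ?thesis
      by (auto simp: zigzag_quiver_def zigzag_arr_def is_functorD[OF M] cmp_idm_left D.idm_closed
        idm_closed)
  next
    case (loc_inv_left z s)
    then show ?thesis
      using zigzag_arr_Bwd[of z x s]
      by (simp add: zigzag_quiver_def is_functorD[OF M] cmp_idm_left idm_closed)
        (simp add: zigzag_arr_def)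
  next
    case (loc_inv_right z s)
    then show ?thesis
      using zigzag_arr_Bwd[of x z s]
      by (simp add: zigzag_quiver_def is_functorD[OF M] cmp_idm_left idm_closed)
        (simp add: zigzag_arr_def is_functorD[OF M] cmp_idm_left)
  qed
  then show "is_word (zigzag_quiver D S) x y v" "is_word (zigzag_quiver D S) x y w"
    "zz x y v = zz x y w" by auto
qed

end

text \<open>The existence half of the universal property. The word functor \<open>zz\<close>
  respects the generating relations, hence the congruence they generate, and so factors through the
  quotient. The factorization is strict on objects and arrows.\<close>

lemma localization_universal:
  assumes "inverting_functor D K S M"
  obtains N where "is_functor (localization D S) K N" "fobj N = fobj M"
    "\<And>x y f. \<lbrakk>x \<in> obj D; y \<in> obj D; f \<in> Hom D x y\<rbrakk> \<Longrightarrow>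
      farr N x y (farr (loc_func D S) x y f) = farr M x y f"
proof -
  interpret inverting_functor D K S M by fact
  let ?Q = "zigzag_quiver D S" and ?W = "\<lparr>fobj = fobj M, farr = zz\<rparr>"
  have E: "f \<in> Hom (free_cat ?Q) x y \<and> g \<in> Hom (free_cat ?Q) x y \<and> farr ?W x y f = farr ?W x y g"
    if "(f, g) \<in> loc_cong D S x y" for x y f g
  proof -
    have "loc_cong D S x y \<subseteq> {(f, g). f \<in> Hom (free_cat ?Q) x y \<and> g \<in> Hom (free_cat ?Q) x y \<and>
        farr ?W x y f = farr ?W x y g}"
      unfolding loc_cong_def
      by (rule congruence_gen_subset[OF congruence_kernel[OF category_free_cat zz_functor]])
        (auto simp: loc_rel_words zigzag_quiver_def[THEN arg_cong[of _ _ Verts]])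
    then show ?thesis
      using that by blast
  qed
  note N = functor_quotient_cat[where E = "loc_cong D S" and D = "free_cat ?Q", OF zz_functor _ E
    category_free_cat]
  show thesis
  proof (rule that)
    show "is_functor (localization D S) K
        \<lparr>fobj = fobj ?W, farr = \<lambda>x y c. farr ?W x y (SOME f. f \<in> c)\<rparr>"
      unfolding localization_def
      by (rule N) (auto simp: loc_cong_def congruence_gen_refl)
    show "farr \<lparr>fobj = fobj ?W, farr = \<lambda>x y c. farr ?W x y (SOME f. f \<in> c)\<rparr> x y
        (farr (loc_func D S) x y f) = farr M x y f"
      if "x \<in> obj D" "y \<in> obj D" "f \<in> Hom D x y" for x y f
    proof -
      have "farr \<lparr>fobj = fobj ?W, farr = \<lambda>x y c. farr ?W x y (SOME f. f \<in> c)\<rparr> x y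
          (loc_cong D S x y `` {[(x, y, Fwd f)]}) = farr ?W x y [(x, y, Fwd f)]"
        by (rule N) (use that in \<open>auto simp: loc_cong_def congruence_gen_refl zigzag_quiver_def\<close>)
      then show ?thesis
        using zz_Fwd[OF that] by (simp add: loc_func_def)
    qed
  qed simp
qed

section \<open>Linear categories\<close>

context linear_category
begin

lemma hadd_group:
  assumes "x \<in> obj D" "y \<in> obj D"
  shows hadd_closed: "\<lbrakk>f \<in> Hom D x y; g \<in> Hom D x y\<rbrakk> \<Longrightarrow> hadd D x y f g \<in> Hom D x y"
    and hzero_closed: "hzero D x y \<in> Hom D x y"
    and hadd_assoc: "\<lbrakk>f \<in> Hom D x y; g \<in> Hom D x y; h \<in> Hom D x y\<rbrakk>
      \<Longrightarrow> hadd D x y (hadd D x y f g) h = hadd D x y f (hadd D x y g h)"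
    and hadd_comm: "\<lbrakk>f \<in> Hom D x y; g \<in> Hom D x y\<rbrakk> \<Longrightarrow> hadd D x y f g = hadd D x y g f"
    and hadd_left_comm: "\<lbrakk>f \<in> Hom D x y; g \<in> Hom D x y; h \<in> Hom D x y\<rbrakk>
      \<Longrightarrow> hadd D x y f (hadd D x y g h) = hadd D x y g (hadd D x y f h)"
    and hadd_hzero_left: "f \<in> Hom D x y \<Longrightarrow> hadd D x y (hzero D x y) f = f"
    and hadd_hzero_right: "f \<in> Hom D x y \<Longrightarrow> hadd D x y f (hzero D x y) = f"
    and hadd_cancel: "\<lbrakk>f \<in> Hom D x y; g \<in> Hom D x y; h \<in> Hom D x y\<rbrakk>
      \<Longrightarrow> hadd D x y f g = hadd D x y f h \<longleftrightarrow> g = h"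
proof -
  interpret G: comm_group "hom_group D x y"
    by (rule hom_comm_group[OF assms])
  show "\<lbrakk>f \<in> Hom D x y; g \<in> Hom D x y\<rbrakk> \<Longrightarrow> hadd D x y f g \<in> Hom D x y"
    "hzero D x y \<in> Hom D x y"
    "\<lbrakk>f \<in> Hom D x y; g \<in> Hom D x y; h \<in> Hom D x y\<rbrakk>
      \<Longrightarrow> hadd D x y (hadd D x y f g) h = hadd D x y f (hadd D x y g h)"
    "\<lbrakk>f \<in> Hom D x y; g \<in> Hom D x y\<rbrakk> \<Longrightarrow> hadd D x y f g = hadd D x y g f"
    "\<lbrakk>f \<in> Hom D x y; g \<in> Hom D x y; h \<in> Hom D x y\<rbrakk>
      \<Longrightarrow> hadd D x y f (hadd D x y g h) = hadd D x y g (hadd D x y f h)"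
    "f \<in> Hom D x y \<Longrightarrow> hadd D x y (hzero D x y) f = f"
    "f \<in> Hom D x y \<Longrightarrow> hadd D x y f (hzero D x y) = f"
    "\<lbrakk>f \<in> Hom D x y; g \<in> Hom D x y; h \<in> Hom D x y\<rbrakk>
      \<Longrightarrow> hadd D x y f g = hadd D x y f h \<longleftrightarrow> g = h"
    using G.m_closed[of f g] G.one_closed G.m_assoc[of f g h] G.m_comm[of f g] G.m_lcomm[of f g h]
      G.l_one[of f] G.r_one[of f] G.Units_l_cancel[of f g h] G.Units_eq
    by (simp_all add: hom_group_def)
qed

lemma hscale_0:
  assumes "x \<in> obj D" "y \<in> obj D" "f \<in> Hom D x y"
  shows "hscale D x y 0 f = hzero D x y"
proof -
  have "hadd D x y (hscale D x y 0 f) (hscale D x y 0 f) =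
      hadd D x y (hscale D x y 0 f) (hzero D x y)"
    using assms hscale_add_left[of x y f 0 0] hscale_closed[of x y f 0]
    by (simp add: hadd_hzero_right)
  then show ?thesis
    using assms by (simp add: hadd_cancel hscale_closed hzero_closed)
qed

lemma hscale_hzero:
  assumes "x \<in> obj D" "y \<in> obj D"
  shows "hscale D x y a (hzero D x y) = hzero D x y"
  using assms hscale_mult[of x y "hzero D x y" a 0] by (simp add: hscale_0 hzero_closed)

lemma hscale_commute:
  "\<lbrakk>x \<in> obj D; y \<in> obj D; f \<in> Hom D x y\<rbrakk> \<Longrightarrow>
    hscale D x y a (hscale D x y b f) = hscale D x y b (hscale D x y a f)"
  by (simp add: mult.commute flip: hscale_mult)

lemma hadd_neg:
  assumes "x \<in> obj D" "y \<in> obj D" "f \<in> Hom D x y"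
  shows "hadd D x y f (hscale D x y (-1) f) = hzero D x y"
    and "hadd D x y (hscale D x y (-1) f) f = hzero D x y"
  using assms hscale_add_left[of x y f 1 "-1"] hscale_add_left[of x y f "-1" 1]
  by (simp_all add: hscale_0 hscale_one)

lemma cmp_hzero_right:
  assumes "x \<in> obj D" "y \<in> obj D" "z \<in> obj D" "g \<in> Hom D y z"
  shows "cmp D x y z g (hzero D x y) = hzero D x z"
  using assms cmp_scale_right[of x y z "hzero D x y" g 0]
  by (simp add: hscale_0 hzero_closed cmp_closed)

lemma cmp_hzero_left:
  assumes "x \<in> obj D" "y \<in> obj D" "z \<in> obj D" "f \<in> Hom D x y"
  shows "cmp D x y z (hzero D y z) f = hzero D x z"
  using assms cmp_scale_left[of x y z f "hzero D y z" 0]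
  by (simp add: hscale_0 hzero_closed cmp_closed)

text \<open>Composing \<open>f\<close> with an identity that is zero makes \<open>f\<close> zero.
  Objects of dead pixels and the adjoined zero object are treated through this criterion
  \<open>idm = hzero\<close>.\<close>

lemma Hom_trivial:
  assumes "x \<in> obj D" "y \<in> obj D" "f \<in> Hom D x y"
    and "idm D x = hzero D x x \<or> idm D y = hzero D y y"
  shows "f = hzero D x y"
  using assms cmp_idm_right[of x y f] cmp_idm_left[of x y f] cmp_hzero_right[of x x y f]
    cmp_hzero_left[of x y y f]
  by auto

text \<open>Both identities are composites of the zero morphism with its inverse. This is how
  inverting the zero morphisms of a pre-dead pixel makes its points zero objects.\<close>

lemma iso_hzero:
  assumes "x \<in> obj D" "y \<in> obj D" "is_iso D x y (hzero D x y)"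
  shows "idm D x = hzero D x x" and "idm D y = hzero D y y"
  using assms by (auto elim!: is_isoE simp: cmp_hzero_left cmp_hzero_right)

end

text \<open>Additive inverses are supplied by multiplication with \<open>-1\<close>, which turns the
  group axiom into an equation that can be checked like the others.\<close>

lemma linear_categoryI:
  fixes D :: "('o, 'm, 'k :: {comm_ring, comm_monoid_mult}, 'z) lincat_scheme"
  assumes "category D"
    and "\<And>x y f g. \<lbrakk>x \<in> obj D; y \<in> obj D; f \<in> Hom D x y; g \<in> Hom D x y\<rbrakk>
      \<Longrightarrow> hadd D x y f g \<in> Hom D x y"
    and "\<And>x y. \<lbrakk>x \<in> obj D; y \<in> obj D\<rbrakk> \<Longrightarrow> hzero D x y \<in> Hom D x y"
    and "\<And>x y f g h. \<lbrakk>x \<in> obj D; y \<in> obj D; f \<in> Hom D x y; g \<in> Hom D x y; h \<in> Hom D x y\<rbrakk>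
      \<Longrightarrow> hadd D x y (hadd D x y f g) h = hadd D x y f (hadd D x y g h)"
    and "\<And>x y f g. \<lbrakk>x \<in> obj D; y \<in> obj D; f \<in> Hom D x y; g \<in> Hom D x y\<rbrakk>
      \<Longrightarrow> hadd D x y f g = hadd D x y g f"
    and "\<And>x y f. \<lbrakk>x \<in> obj D; y \<in> obj D; f \<in> Hom D x y\<rbrakk> \<Longrightarrow> hadd D x y (hzero D x y) f = f"
    and hscale_closed: "\<And>x y f a. \<lbrakk>x \<in> obj D; y \<in> obj D; f \<in> Hom D x y\<rbrakk>
      \<Longrightarrow> hscale D x y a f \<in> Hom D x y"
    and neg: "\<And>x y f. \<lbrakk>x \<in> obj D; y \<in> obj D; f \<in> Hom D x y\<rbrakk>
      \<Longrightarrow> hadd D x y (hscale D x y (-1) f) f = hzero D x y"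
    and "\<And>x y f. \<lbrakk>x \<in> obj D; y \<in> obj D; f \<in> Hom D x y\<rbrakk> \<Longrightarrow> hscale D x y 1 f = f"
    and "\<And>x y f a b. \<lbrakk>x \<in> obj D; y \<in> obj D; f \<in> Hom D x y\<rbrakk>
      \<Longrightarrow> hscale D x y (a * b) f = hscale D x y a (hscale D x y b f)"
    and "\<And>x y f a b. \<lbrakk>x \<in> obj D; y \<in> obj D; f \<in> Hom D x y\<rbrakk>
      \<Longrightarrow> hscale D x y (a + b) f = hadd D x y (hscale D x y a f) (hscale D x y b f)"
    and "\<And>x y f g a. \<lbrakk>x \<in> obj D; y \<in> obj D; f \<in> Hom D x y; g \<in> Hom D x y\<rbrakk>
      \<Longrightarrow> hscale D x y a (hadd D x y f g) = hadd D x y (hscale D x y a f) (hscale D x y a g)"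
    and "\<And>x y z f f' g. \<lbrakk>x \<in> obj D; y \<in> obj D; z \<in> obj D;
        f \<in> Hom D x y; f' \<in> Hom D x y; g \<in> Hom D y z\<rbrakk>
      \<Longrightarrow> cmp D x y z g (hadd D x y f f') = hadd D x z (cmp D x y z g f) (cmp D x y z g f')"
    and "\<And>x y z f g g'. \<lbrakk>x \<in> obj D; y \<in> obj D; z \<in> obj D;
        f \<in> Hom D x y; g \<in> Hom D y z; g' \<in> Hom D y z\<rbrakk>
      \<Longrightarrow> cmp D x y z (hadd D y z g g') f = hadd D x z (cmp D x y z g f) (cmp D x y z g' f)"
    and "\<And>x y z f g a. \<lbrakk>x \<in> obj D; y \<in> obj D; z \<in> obj D; f \<in> Hom D x y; g \<in> Hom D y z\<rbrakk>
      \<Longrightarrow> cmp D x y z g (hscale D x y a f) = hscale D x z a (cmp D x y z g f)"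
    and "\<And>x y z f g a. \<lbrakk>x \<in> obj D; y \<in> obj D; z \<in> obj D; f \<in> Hom D x y; g \<in> Hom D y z\<rbrakk>
      \<Longrightarrow> cmp D x y z (hscale D y z a g) f = hscale D x z a (cmp D x y z g f)"
  shows "linear_category D"
proof -
  have "comm_group (hom_group D x y)" if "x \<in> obj D" "y \<in> obj D" for x y
  proof (rule comm_groupI)
    show "\<exists>g\<in>carrier (hom_group D x y). g \<otimes>\<^bsub>hom_group D x y\<^esub> f = \<one>\<^bsub>hom_group D x y\<^esub>"
      if "f \<in> carrier (hom_group D x y)" for f
      using that neg[of x y f] hscale_closed[of x y f] \<open>x \<in> obj D\<close> \<open>y \<in> obj D\<close>
      by (auto simp: hom_group_def)
  qed (use that assms in \<open>auto simp: hom_group_def\<close>)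
  with assms show ?thesis
    by (simp add: linear_category_def linear_category_axioms_def)
qed

lemma linear_functorI:
  assumes "is_functor D E F"
    and "\<And>x y f g. \<lbrakk>x \<in> obj D; y \<in> obj D; f \<in> Hom D x y; g \<in> Hom D x y\<rbrakk> \<Longrightarrow>
      farr F x y (hadd D x y f g) = hadd E (fobj F x) (fobj F y) (farr F x y f) (farr F x y g)"
    and "\<And>x y f a. \<lbrakk>x \<in> obj D; y \<in> obj D; f \<in> Hom D x y\<rbrakk> \<Longrightarrow>
      farr F x y (hscale D x y a f) = hscale E (fobj F x) (fobj F y) a (farr F x y f)"
  shows "linear_functor D E F"
  using assms by (auto simp: linear_functor_def)

lemma linear_functorD:
  assumes "linear_functor D E F"
  shows linear_functor_functor: "is_functor D E F"
    and functor_hadd: "\<lbrakk>x \<in> obj D; y \<in> obj D; f \<in> Hom D x y; g \<in> Hom D x y\<rbrakk> \<Longrightarrow>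
      farr F x y (hadd D x y f g) = hadd E (fobj F x) (fobj F y) (farr F x y f) (farr F x y g)"
    and functor_hscale: "\<lbrakk>x \<in> obj D; y \<in> obj D; f \<in> Hom D x y\<rbrakk> \<Longrightarrow>
      farr F x y (hscale D x y a f) = hscale E (fobj F x) (fobj F y) a (farr F x y f)"
  using assms by (auto simp: linear_functor_def)

lemma functor_hzero:
  assumes "linear_category D" "linear_category E" and F: "linear_functor D E F"
    and "x \<in> obj D" "y \<in> obj D"
  shows "farr F x y (hzero D x y) = hzero E (fobj F x) (fobj F y)"
proof -
  interpret D: linear_category D by fact
  interpret E: linear_category E by fact
  note F' = is_functorD[OF linear_functor_functor[OF F]]
  have "farr F x y (hzero D x y) = farr F x y (hscale D x y 0 (hzero D x y))"
    using assms by (simp add: D.hscale_0 D.hzero_closed)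
  also have "\<dots> = hzero E (fobj F x) (fobj F y)"
    using assms by (simp add: functor_hscale[OF F] E.hscale_0 D.hzero_closed F')
  finally show ?thesis .
qed

lemma linear_functor_comp:
  assumes F: "linear_functor D E F" and G: "linear_functor E K G"
  shows "linear_functor D K (G \<circ>\<^sub>F F)"
proof -
  note F' = is_functorD[OF linear_functor_functor[OF F]]
  note G' = linear_functor_functor[OF G]
  show ?thesis
    by (rule linear_functorI)
      (use functor_comp_functor[OF linear_functor_functor[OF F] G'] in
        \<open>auto simp: func_comp_def F' functor_hadd[OF F] functor_hscale[OF F]
          functor_hadd[OF G] functor_hscale[OF G]\<close>)
qed

text \<open>The value \<open>F f\<close> is the unique \<open>h\<close> whose image under
  \<open>G\<close> makes the naturality square of \<open>\<eta>\<close> commute. That square is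
  linear in the pair of \<open>f\<close> and \<open>h\<close>, so sums and multiples of solutions
  are again solutions.\<close>

lemma quasi_inverse_linear:
  assumes "linear_category D" "linear_category E" and G: "linear_functor D E G"
    and F: "is_functor E D F"
    and FG: "nat_isomorphic D D (F \<circ>\<^sub>F G) id_func" and GF: "nat_isomorphic E E (G \<circ>\<^sub>F F) id_func"
  shows "linear_functor E D F"
proof -
  interpret D: linear_category D by fact
  interpret E: linear_category E by fact
  note F' = is_functorD[OF F]
  note G' = is_functorD[OF linear_functor_functor[OF G]]
  obtain \<theta> where \<theta>: "\<forall>x\<in>obj D. is_iso D (fobj F (fobj G x)) x (\<theta> x)"
    "\<forall>x\<in>obj D. \<forall>y\<in>obj D. \<forall>f\<in>Hom D x y.
        cmp D (fobj F (fobj G x)) (fobj F (fobj G y)) y (\<theta> y) (farr F (fobj G x) (fobj G y) (farr G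
          x y f)) =
        cmp D (fobj F (fobj G x)) x y f (\<theta> x)"
    using FG by (simp add: nat_isomorphic_def id_func_def func_comp_def) blast
  obtain \<eta> where \<eta>: "\<forall>x\<in>obj E. is_iso E (fobj G (fobj F x)) x (\<eta> x)"
    "\<forall>x\<in>obj E. \<forall>y\<in>obj E. \<forall>f\<in>Hom E x y.
        cmp E (fobj G (fobj F x)) (fobj G (fobj F y)) y (\<eta> y) (farr G (fobj F x) (fobj F y) (farr F
          x y f)) =
        cmp E (fobj G (fobj F x)) x y f (\<eta> x)"
    using GF by (simp add: nat_isomorphic_def id_func_def func_comp_def) blast
  have \<eta>_Hom: "\<eta> x \<in> Hom E (fobj G (fobj F x)) x" if "x \<in> obj E" for x
    using \<eta>(1) that by (auto simp: is_iso_def)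
  \<comment> \<open>Naturality of \<open>\<theta>\<close> expresses
    \<open>f \<circ> \<theta> x\<close> through \<open>G f\<close>; the isomorphism
    \<open>\<theta> x\<close> is then cancelled.\<close>
  have faithful: "f = g"
    if "x \<in> obj D" "y \<in> obj D" "f \<in> Hom D x y" "g \<in> Hom D x y" "farr G x y f = farr G x y g"
    for x y f g
  proof (rule D.iso_cancel_right[where x = "fobj F (fobj G x)" and y = x and z = y])
    show "is_iso D (fobj F (fobj G x)) x (\<theta> x)"
      using \<theta>(1) that by auto
    show "cmp D (fobj F (fobj G x)) x y f (\<theta> x) = cmp D (fobj F (fobj G x)) x y g (\<theta> x)"
      using \<theta>(2)[rule_format, of x y f] \<theta>(2)[rule_format, of x y g] that by simp
  qed (use that F' G' in auto)
  \<comment> \<open>Cancelling \<open>\<eta> y\<close> shows that \<open>h\<close> and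
    \<open>F f\<close> have the same image under \<open>G\<close>, and \<open>G\<close> is
    faithful.\<close>
  have recover: "farr F x y f = h"
    if "x \<in> obj E" "y \<in> obj E" "f \<in> Hom E x y" "h \<in> Hom D (fobj F x) (fobj F y)"
      "cmp E (fobj G (fobj F x)) (fobj G (fobj F y)) y (\<eta> y) (farr G (fobj F x) (fobj F y) h) =
       cmp E (fobj G (fobj F x)) x y f (\<eta> x)" for x y f h
  proof (rule faithful[of "fobj F x" "fobj F y"])
    show "farr G (fobj F x) (fobj F y) (farr F x y f) = farr G (fobj F x) (fobj F y) h"
    proof (rule E.iso_cancel_left[where x = "fobj G (fobj F x)" and y = "fobj G (fobj F y)" and z =
      y])
      show "is_iso E (fobj G (fobj F y)) y (\<eta> y)"
        using \<eta>(1) that by auto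
    qed (use that F' G' \<eta>(2)[rule_format, of x y f] in auto)
  qed (use that F' in auto)
  show ?thesis
  proof (rule linear_functorI[OF F])
    fix x y f g
    assume *: "x \<in> obj E" "y \<in> obj E" "f \<in> Hom E x y" "g \<in> Hom E x y"
    show "farr F x y (hadd E x y f g) =
        hadd D (fobj F x) (fobj F y) (farr F x y f) (farr F x y g)"
      by (rule recover)
        (use * F' G' \<eta>(2)[rule_format, of x y f] \<eta>(2)[rule_format, of x y g] \<eta>_Hom in
          \<open>auto simp: E.hadd_closed D.hadd_closed functor_hadd[OF G] E.cmp_add_left
            E.cmp_add_right\<close>)
  next
    fix x y f a
    assume *: "x \<in> obj E" "y \<in> obj E" "f \<in> Hom E x y"
    show "farr F x y (hscale E x y a f) = hscale D (fobj F x) (fobj F y) a (farr F x y f)"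
      by (rule recover)
        (use * F' G' \<eta>(2)[rule_format, of x y f] \<eta>_Hom in
          \<open>auto simp: E.hscale_closed D.hscale_closed functor_hscale[OF G] E.cmp_scale_left
            E.cmp_scale_right\<close>)
  qed
qed

subsection \<open>Free linear categories\<close>

lemma lookup_pm_scale: "Poly_Mapping.lookup (pm_scale a f) k = a * Poly_Mapping.lookup f k"
  by (simp add: pm_scale_def Poly_Mapping.map.rep_eq when_def)

lemma keys_pm_scale: "Poly_Mapping.keys (pm_scale a f) \<subseteq> Poly_Mapping.keys f"
  by (auto simp: in_keys_iff lookup_pm_scale)

lemma pm_scale_simps [simp]:
  "pm_scale a 0 = 0" "pm_scale a (Poly_Mapping.single k c) = Poly_Mapping.single k (a * c)"
  "pm_scale a (f + g) = pm_scale a f + pm_scale a g"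
  by (auto intro!: poly_mapping_eqI simp: lookup_pm_scale lookup_single when_def lookup_add
    algebra_simps)

lemma keys_add_subset:
  "\<lbrakk>Poly_Mapping.keys f \<subseteq> A; Poly_Mapping.keys g \<subseteq> A\<rbrakk> \<Longrightarrow> Poly_Mapping.keys (f + g) \<subseteq> A"
  using Poly_Mapping.keys_add[of f g] by blast

lemma poly_mapping_sum_single:
  "f = (\<Sum>a\<in>Poly_Mapping.keys f. Poly_Mapping.single a (Poly_Mapping.lookup f a))"
  by (rule poly_mapping_eqI) (auto simp: lookup_sum lookup_single when_def in_keys_iff sum.delta)

text \<open>The supports of both summands stay inside \<open>A\<close> in the induction step, so
  that membership in a Hom-set remains available there.\<close>

lemma pm_induct [consumes 1, case_names zero single add]:
  fixes f :: "'a \<Rightarrow>\<^sub>0 'b :: comm_monoid_add"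
  assumes "Poly_Mapping.keys f \<subseteq> A" and "P 0"
    and single: "\<And>a c. a \<in> A \<Longrightarrow> P (Poly_Mapping.single a c)"
    and add: "\<And>f g. \<lbrakk>Poly_Mapping.keys f \<subseteq> A; Poly_Mapping.keys g \<subseteq> A; P f; P g\<rbrakk> \<Longrightarrow> P (f + g)"
  shows "P f"
proof -
  have "P (\<Sum>a\<in>B. Poly_Mapping.single a (c a)) \<and>
      Poly_Mapping.keys (\<Sum>a\<in>B. Poly_Mapping.single a (c a)) \<subseteq> A"
    if "finite B" "B \<subseteq> A" for B and c :: "'a \<Rightarrow> 'b"
    using that
  proof (induction B rule: finite_induct)
    case (insert a B)
    have "Poly_Mapping.keys (Poly_Mapping.single a (c a)) \<subseteq> A"
      using insert by simp
    then show ?case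
      using insert single[of a "c a"] by (simp add: add keys_add_subset del: keys_single)
  qed (simp add: \<open>P 0\<close>)
  then show ?thesis
    using assms(1) finite_keys poly_mapping_sum_single[of f] by metis
qed

lemma linearization_simps [simp]:
  "obj (linearization D) = obj D"
  "Hom (linearization D) x y = {f. Poly_Mapping.keys f \<subseteq> Hom D x y}"
  "idm (linearization D) x = Poly_Mapping.single (idm D x) 1"
  "hadd (linearization D) x y = (+)" "hzero (linearization D) x y = 0"
  "hscale (linearization D) x y = pm_scale"
  by (simp_all add: linearization_def)

text \<open>Enlarging the index sets only adds zero terms. It provides a common range of summation
  for \<open>f\<close>, \<open>f'\<close> and \<open>f + f'\<close>, after which additivity is a
  termwise matter.\<close>

lemma cmp_linearization:
  assumes "finite A" "finite B" "Poly_Mapping.keys f \<subseteq> A" "Poly_Mapping.keys g \<subseteq> B"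
  shows "cmp (linearization D) x y z g f = (\<Sum>a\<in>A. \<Sum>b\<in>B.
    Poly_Mapping.single (cmp D x y z b a) (Poly_Mapping.lookup g b * Poly_Mapping.lookup f a))"
proof -
  let ?s = "\<lambda>a b. Poly_Mapping.single (cmp D x y z b a) (Poly_Mapping.lookup g b *
    Poly_Mapping.lookup f a)"
  have "cmp (linearization D) x y z g f = (\<Sum>a\<in>Poly_Mapping.keys f. \<Sum>b\<in>Poly_Mapping.keys g. ?s a b)"
    by (simp add: linearization_def)
  also have "\<dots> = (\<Sum>a\<in>Poly_Mapping.keys f. \<Sum>b\<in>B. ?s a b)"
    using assms by (intro sum.cong refl sum.mono_neutral_left) (auto simp: in_keys_iff)
  also have "\<dots> = (\<Sum>a\<in>A. \<Sum>b\<in>B. ?s a b)"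
    using assms by (intro sum.mono_neutral_left) (auto simp: in_keys_iff)
  finally show ?thesis .
qed

lemma cmp_linearization_0 [simp]:
  "cmp (linearization D) x y z g 0 = 0" "cmp (linearization D) x y z 0 f = 0"
  by (simp_all add: linearization_def)

lemma cmp_linearization_single [simp]:
  "cmp (linearization D) x y z (Poly_Mapping.single b d) (Poly_Mapping.single a c) =
    Poly_Mapping.single (cmp D x y z b a) (d * c)"
  by (subst cmp_linearization[of "{a}" "{b}"]) auto

lemma cmp_linearization_add:
  "cmp (linearization D) x y z g (f + f') =
    cmp (linearization D) x y z g f + cmp (linearization D) x y z g f'" (is ?right)
  "cmp (linearization D) x y z (g + g') f =
    cmp (linearization D) x y z g f + cmp (linearization D) x y z g' f" (is ?left)
proof -
  let ?A = "Poly_Mapping.keys f \<union> Poly_Mapping.keys f'" and ?B = "Poly_Mapping.keys g"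
  have "cmp (linearization D) x y z g h = (\<Sum>a\<in>?A. \<Sum>b\<in>?B.
      Poly_Mapping.single (cmp D x y z b a) (Poly_Mapping.lookup g b * Poly_Mapping.lookup h a))"
    if "h \<in> {f, f', f + f'}" for h
    using that Poly_Mapping.keys_add[of f f'] by (intro cmp_linearization) auto
  then show ?right
    by (simp add: lookup_add distrib_left single_add sum.distrib)
  let ?A = "Poly_Mapping.keys f" and ?B = "Poly_Mapping.keys g \<union> Poly_Mapping.keys g'"
  have "cmp (linearization D) x y z h f = (\<Sum>a\<in>?A. \<Sum>b\<in>?B.
      Poly_Mapping.single (cmp D x y z b a) (Poly_Mapping.lookup h b * Poly_Mapping.lookup f a))"
    if "h \<in> {g, g', g + g'}" for h
    using that Poly_Mapping.keys_add[of g g'] by (intro cmp_linearization) auto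
  then show ?left
    by (simp add: lookup_add distrib_right single_add sum.distrib)
qed

lemma cmp_linearization_scale:
  "cmp (linearization D) x y z g (pm_scale a f) = pm_scale a (cmp (linearization D) x y z g f)"
    (is ?right)
  "cmp (linearization D) x y z (pm_scale a g) f = pm_scale a (cmp (linearization D) x y z g f)"
    (is ?left)
proof -
  show ?right
  proof (induction f rule: pm_induct[where A = UNIV, OF subset_UNIV])
    case (2 b c)
    show ?case
      by (induction g rule: pm_induct[where A = UNIV, OF subset_UNIV])
        (simp_all add: cmp_linearization_add ac_simps)
  qed (simp_all add: cmp_linearization_add)
  show ?left
  proof (induction f rule: pm_induct[where A = UNIV, OF subset_UNIV])
    case (2 b c)
    show ?case
      by (induction g rule: pm_induct[where A = UNIV, OF subset_UNIV])
        (simp_all add: cmp_linearization_add ac_simps)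
  qed (simp_all add: cmp_linearization_add)
qed

text \<open>Composition is bilinear without side conditions, so each axiom reduces to basis elements
  by \<open>pm_induct\<close> in one variable after the other.\<close>

lemma linear_category_linearization:
  fixes D :: "('o, 'm) cat"
  assumes "category D"
  shows "linear_category (linearization D ::
    ('o, 'm \<Rightarrow>\<^sub>0 'k, 'k :: {comm_ring, comm_monoid_mult}) lincat)" (is "linear_category ?L")
proof -
  interpret D: category D by fact
  have closed: "cmp ?L x y z g f \<in> Hom ?L x z"
    if "x \<in> obj ?L" "y \<in> obj ?L" "z \<in> obj ?L" "f \<in> Hom ?L x y" "g \<in> Hom ?L y z" for x y z f g
  proof -
    have "Poly_Mapping.keys f \<subseteq> Hom D x y" and g: "Poly_Mapping.keys g \<subseteq> Hom D y z"
      using that by auto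
    then show ?thesis
    proof (induction f rule: pm_induct)
      case (single a c)
      show ?case
        using g
      proof (induction g rule: pm_induct)
        case (add g g')
        then show ?case
          by (simp add: cmp_linearization_add keys_add_subset)
      qed (use that single in \<open>auto simp: D.cmp_closed\<close>)
    next
      case (add f f')
      then show ?case
        by (simp add: cmp_linearization_add keys_add_subset)
    qed simp
  qed
  have id_right: "cmp ?L x x y f (idm ?L x) = f" if "x \<in> obj ?L" "y \<in> obj ?L" "f \<in> Hom ?L x y"
    for x y f
  proof -
    have "Poly_Mapping.keys f \<subseteq> Hom D x y"
      using that by simp
    then show ?thesis
      using that(1,2) by (induction f rule: pm_induct)
        (auto simp: cmp_linearization_add D.cmp_idm_right)
  qed
  have id_left: "cmp ?L x y y (idm ?L y) f = f" if "x \<in> obj ?L" "y \<in> obj ?L" "f \<in> Hom ?L x y"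
    for x y f
  proof -
    have "Poly_Mapping.keys f \<subseteq> Hom D x y"
      using that by simp
    then show ?thesis
      using that(1,2) by (induction f rule: pm_induct)
        (auto simp: cmp_linearization_add D.cmp_idm_left)
  qed
  have assoc: "cmp ?L w y z h (cmp ?L w x y g f) = cmp ?L w x z (cmp ?L x y z h g) f"
    if o: "w \<in> obj ?L" "x \<in> obj ?L" "y \<in> obj ?L" "z \<in> obj ?L"
      and "f \<in> Hom ?L w x" "g \<in> Hom ?L x y" "h \<in> Hom ?L y z" for w x y z f g h
  proof -
    have "Poly_Mapping.keys f \<subseteq> Hom D w x" and g: "Poly_Mapping.keys g \<subseteq> Hom D x y"
      and h: "Poly_Mapping.keys h \<subseteq> Hom D y z"
      using that by auto
    then show ?thesis
    proof (induction f rule: pm_induct)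
      case (single a c)
      show ?case
        using g
      proof (induction g rule: pm_induct)
        case (single a' c')
        show ?case
          using h
          by (induction h rule: pm_induct)
            (use o single \<open>a \<in> _\<close> in \<open>auto simp: cmp_linearization_add D.cmp_assoc mult.assoc\<close>)
      qed (auto simp: cmp_linearization_add)
    qed (auto simp: cmp_linearization_add)
  qed
  show ?thesis
  proof (rule linear_categoryI)
    show "category ?L"
      by (rule category.intro; (rule closed id_right id_left assoc)?) (simp_all add: D.idm_closed)
  next
    fix x y f g
    assume "f \<in> Hom ?L x y" "g \<in> Hom ?L x y"
    then show "hadd ?L x y f g \<in> Hom ?L x y"
      using Poly_Mapping.keys_add[of f g] by auto
  next
    fix x y f a
    assume "f \<in> Hom ?L x y"
    then show "hscale ?L x y a f \<in> Hom ?L x y"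
      using keys_pm_scale[of a f] by auto
  qed (auto simp: cmp_linearization_add cmp_linearization_scale ac_simps
      intro!: poly_mapping_eqI simp: lookup_pm_scale lookup_add algebra_simps)
qed

text \<open>The formula copies \<open>lin_word_ext\<close> with an arbitrary functor in place of
  \<open>word_ext\<close>, so that it serves both the localization and \<open>Phi\<close>.\<close>

definition lin_ext where
  "lin_ext K F = \<lparr>fobj = fobj F, farr = \<lambda>x y f.
     finprod (hom_group K (fobj F x) (fobj F y))
       (\<lambda>w. hscale K (fobj F x) (fobj F y) (Poly_Mapping.lookup f w) (farr F x y w))
       (Poly_Mapping.keys f)\<rparr>"

lemma
  assumes "category D" "linear_category K" and F: "is_functor D K F"
  shows lin_ext_linear: "linear_functor (linearization D) K (lin_ext K F)"
    and lin_ext_single: "\<And>x y w c. \<lbrakk>x \<in> obj D; y \<in> obj D; w \<in> Hom D x y\<rbrakk> \<Longrightarrow>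
      farr (lin_ext K F) x y (Poly_Mapping.single w c)
        = hscale K (fobj F x) (fobj F y) c (farr F x y w)"
proof -
  interpret D: category D by fact
  interpret K: linear_category K by fact
  interpret L: linear_category "linearization D :: ('a, 'b \<Rightarrow>\<^sub>0 'e, 'e) lincat"
    by (rule linear_category_linearization) fact
  note F' = is_functorD[OF F]
  let ?T = "\<lambda>x y. farr (lin_ext K F) x y" and ?F = "fobj F"
  let ?G = "\<lambda>x y. hom_group K (fobj F x) (fobj F y)"
  let ?s = "\<lambda>x y f w. hscale K (?F x) (?F y) (Poly_Mapping.lookup f w) (farr F x y w)"
  \<comment> \<open>The product may run over any finite set containing the support; additivity then
    compares three products over one index set.\<close>
  have T: "?T x y f = finprod (?G x y) (?s x y f) A"
    if "x \<in> obj D" "y \<in> obj D" "finite A" "Poly_Mapping.keys f \<subseteq> A" "A \<subseteq> Hom D x y" for x y f A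
  proof -
    interpret G: comm_group "?G x y"
      using that by (simp add: K.hom_comm_group F')
    show ?thesis
      unfolding lin_ext_def func.simps
      by (rule G.finprod_mono_neutral_cong_left)
        (use that in \<open>auto simp: hom_group_def F' K.hscale_closed K.hscale_0 subset_iff
          in_keys_iff\<close>)
  qed
  have T0: "?T x y 0 = hzero K (?F x) (?F y)" if "x \<in> obj D" "y \<in> obj D" for x y
  proof -
    interpret G: comm_group "?G x y"
      using that by (simp add: K.hom_comm_group F')
    show ?thesis
      by (simp add: lin_ext_def G.finprod_empty) (simp add: hom_group_def)
  qed
  show T1: "?T x y (Poly_Mapping.single w c) = hscale K (?F x) (?F y) c (farr F x y w)"
    if "x \<in> obj D" "y \<in> obj D" "w \<in> Hom D x y" for x y w c
  proof -
    interpret G: comm_group "?G x y"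
      using that by (simp add: K.hom_comm_group F')
    have "?T x y (Poly_Mapping.single w c) = finprod (?G x y) (?s x y (Poly_Mapping.single w c))
      {w}"
      using that by (intro T) auto
    also have "\<dots> = ?s x y (Poly_Mapping.single w c) w"
      using that by (subst G.finprod_insert)
        (simp_all, simp_all add: hom_group_def F' K.hscale_closed K.hadd_hzero_right)
    also have "\<dots> = hscale K (?F x) (?F y) c (farr F x y w)"
      by simp
    finally show ?thesis .
  qed
  have closed: "?T x y f \<in> Hom K (?F x) (?F y)"
    if "x \<in> obj D" "y \<in> obj D" "Poly_Mapping.keys f \<subseteq> Hom D x y" for x y f
  proof -
    interpret G: comm_group "?G x y"
      using that by (simp add: K.hom_comm_group F')
    have "?T x y f \<in> carrier (?G x y)"
      unfolding lin_ext_def func.simps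
      by (rule G.finprod_closed) (use that in \<open>auto simp: hom_group_def F' K.hscale_closed
        subset_iff\<close>)
    then show ?thesis
      by (simp add: hom_group_def)
  qed
  have T_add: "?T x y (f + g) = hadd K (?F x) (?F y) (?T x y f) (?T x y g)"
    if "x \<in> obj D" "y \<in> obj D" "Poly_Mapping.keys f \<subseteq> Hom D x y" "Poly_Mapping.keys g \<subseteq> Hom D x y"
    for x y f g
  proof -
    interpret G: comm_group "?G x y"
      using that by (simp add: K.hom_comm_group F')
    let ?A = "Poly_Mapping.keys f \<union> Poly_Mapping.keys g"
    have s: "?s x y h \<in> ?A \<rightarrow> carrier (?G x y)" for h
      using that by (auto simp: hom_group_def F' K.hscale_closed subset_iff)
    have TA: "?T x y h = finprod (?G x y) (?s x y h) ?A" if "h \<in> {f, g, f + g}" for h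
      using that \<open>x \<in> obj D\<close> \<open>y \<in> obj D\<close> \<open>Poly_Mapping.keys f \<subseteq> Hom D x y\<close>
        \<open>Poly_Mapping.keys g \<subseteq> Hom D x y\<close> Poly_Mapping.keys_add[of f g] by (intro T) auto
    have "?T x y (f + g) = finprod (?G x y) (?s x y (f + g)) ?A"
      by (rule TA) simp
    also have "\<dots> = finprod (?G x y) (\<lambda>w. ?s x y f w \<otimes>\<^bsub>?G x y\<^esub> ?s x y g w) ?A"
      by (rule G.finprod_cong') (use s that in \<open>auto simp: lookup_add hom_group_def F'
        K.hscale_add_left
          K.hscale_closed K.hadd_closed subset_iff\<close>)
    also have "\<dots> = ?T x y f \<otimes>\<^bsub>?G x y\<^esub> ?T x y g"
      by (subst G.finprod_multf) (use s in \<open>auto simp: TA\<close>)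
    finally show ?thesis
      by (simp add: hom_group_def)
  qed
  have scale: "?T x y (pm_scale a f) = hscale K (?F x) (?F y) a (?T x y f)"
    if "x \<in> obj D" "y \<in> obj D" "Poly_Mapping.keys f \<subseteq> Hom D x y" for x y f a
    using that(3)
  proof (induction f rule: pm_induct)
    case (add f g)
    then show ?case
      using that keys_pm_scale[of a f] keys_pm_scale[of a g]
      by (simp add: T_add closed K.hscale_add_right F' subset_trans)
  qed (use that in \<open>auto simp: T0 T1 F' K.hscale_mult K.hscale_hzero\<close>)
  \<comment> \<open>Both sides are additive in \<open>f\<close> and in \<open>g\<close>; on basis
    elements the two scalars have to be interchanged, which uses commutativity of the ring.\<close>
  have comp: "?T x z (cmp (linearization D) x y z g f) =
      cmp K (?F x) (?F y) (?F z) (?T y z g) (?T x y f)"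
    if o: "x \<in> obj D" "y \<in> obj D" "z \<in> obj D"
      and f: "Poly_Mapping.keys f \<subseteq> Hom D x y" and g: "Poly_Mapping.keys g \<subseteq> Hom D y z"
        for x y z f g
    using f
  proof (induction f rule: pm_induct)
    case (single a c)
    then have a: "Poly_Mapping.keys (Poly_Mapping.single a c) \<subseteq> Hom D x y"
      by simp
    show ?case
      using g
    proof (induction g rule: pm_induct)
      case (add g g')
      then show ?case
        using o a \<open>a \<in> _\<close> L.cmp_closed[of x y z "Poly_Mapping.single a c" g]
          L.cmp_closed[of x y z "Poly_Mapping.single a c" g']
        by (simp add: cmp_linearization_add T_add
            closed K.cmp_add_left F')
    qed (use o single in \<open>auto intro: K.hscale_commute simp: T0 T1 F' D.cmp_closed K.cmp_hzero_left
      K.cmp_scale_left K.hscale_mult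
        K.cmp_scale_right K.cmp_closed K.hscale_closed\<close>)
  next
    case (add f f')
    then show ?case
      using o g L.cmp_closed[of x y z f g] L.cmp_closed[of x y z f' g]
      by (simp add: cmp_linearization_add T_add
          closed K.cmp_add_right F')
  qed (use o g in \<open>auto simp: T0 closed F' K.cmp_hzero_right\<close>)
  have [simp]: "fobj (lin_ext K F) = fobj F"
    by (simp add: lin_ext_def)
  show "linear_functor (linearization D) K (lin_ext K F)"
  proof (intro linear_functorI is_functorI)
    show "?T x x (idm (linearization D) x) = idm K (fobj (lin_ext K F) x)"
      if "x \<in> obj (linearization D)" for x
      using that by (simp add: T1 D.idm_closed F' K.hscale_one K.idm_closed)
  qed (use closed T_add scale comp F' in auto)
qed

subsection \<open>Ideals and quotients\<close>

text \<open>The operations of \<open>lin_quotient\<close> are unions over all representatives. Once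
  the result is independent of the representatives, the union collapses to a single coset.\<close>

lemma UN_eq_const: "\<lbrakk>a \<in> A; \<And>b. b \<in> A \<Longrightarrow> f b = B\<rbrakk> \<Longrightarrow> (\<Union>b\<in>A. f b) = B"
  by blast

lemma is_idealI:
  assumes "\<And>x y f. \<lbrakk>x \<in> obj D; y \<in> obj D; f \<in> I x y\<rbrakk> \<Longrightarrow> f \<in> Hom D x y"
    and "\<And>x y. \<lbrakk>x \<in> obj D; y \<in> obj D\<rbrakk> \<Longrightarrow> hzero D x y \<in> I x y"
    and "\<And>x y f g. \<lbrakk>x \<in> obj D; y \<in> obj D; f \<in> I x y; g \<in> I x y\<rbrakk> \<Longrightarrow> hadd D x y f g \<in> I x y"
    and "\<And>x y f a. \<lbrakk>x \<in> obj D; y \<in> obj D; f \<in> I x y\<rbrakk> \<Longrightarrow> hscale D x y a f \<in> I x y"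
    and "\<And>x y z f g. \<lbrakk>x \<in> obj D; y \<in> obj D; z \<in> obj D; f \<in> I x y; g \<in> Hom D y z\<rbrakk>
      \<Longrightarrow> cmp D x y z g f \<in> I x z"
    and "\<And>x y z f g. \<lbrakk>x \<in> obj D; y \<in> obj D; z \<in> obj D; f \<in> Hom D x y; g \<in> I y z\<rbrakk>
      \<Longrightarrow> cmp D x y z g f \<in> I x z"
  shows "is_ideal D I"
  unfolding is_ideal_def by (intro conjI ballI allI subsetI) (simp_all add: assms)

lemma is_idealD:
  assumes "is_ideal D I"
  shows ideal_Hom: "\<lbrakk>x \<in> obj D; y \<in> obj D; f \<in> I x y\<rbrakk> \<Longrightarrow> f \<in> Hom D x y"
    and ideal_hzero: "\<lbrakk>x \<in> obj D; y \<in> obj D\<rbrakk> \<Longrightarrow> hzero D x y \<in> I x y"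
    and ideal_hadd: "\<lbrakk>x \<in> obj D; y \<in> obj D; f \<in> I x y; g \<in> I x y\<rbrakk> \<Longrightarrow> hadd D x y f g \<in> I x y"
    and ideal_hscale: "\<lbrakk>x \<in> obj D; y \<in> obj D; f \<in> I x y\<rbrakk> \<Longrightarrow> hscale D x y a f \<in> I x y"
    and ideal_cmp_left: "\<lbrakk>x \<in> obj D; y \<in> obj D; z \<in> obj D; f \<in> I x y; g \<in> Hom D y z\<rbrakk>
      \<Longrightarrow> cmp D x y z g f \<in> I x z"
    and ideal_cmp_right: "\<lbrakk>x \<in> obj D; y \<in> obj D; z \<in> obj D; f \<in> Hom D x y; g \<in> I y z\<rbrakk>
      \<Longrightarrow> cmp D x y z g f \<in> I x z"
  using assms unfolding is_ideal_def by blast+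

lemma ideal_gen_least:
  assumes "is_ideal D I" "\<And>u v. \<lbrakk>u \<in> obj D; v \<in> obj D\<rbrakk> \<Longrightarrow> S u v \<subseteq> I u v"
  shows "ideal_gen D S x y \<subseteq> I x y"
  using assms unfolding ideal_gen_def by (intro Inter_lower) blast

lemma ideal_gen_incl:
  assumes "x \<in> obj D" "y \<in> obj D"
  shows "S x y \<subseteq> ideal_gen D S x y"
  using assms unfolding ideal_gen_def by blast

lemma ideal_gen_ideal:
  assumes "linear_category D" "\<And>u v. \<lbrakk>u \<in> obj D; v \<in> obj D\<rbrakk> \<Longrightarrow> S u v \<subseteq> Hom D u v"
  shows "is_ideal D (ideal_gen D S)"
proof -
  interpret linear_category D by fact
  \<comment> \<open>The intersection defining \<open>ideal_gen\<close> needs at least one member to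
    lie inside the Hom-sets; the family of all morphisms provides it.\<close>
  have H: "is_ideal D (Hom D)"
    by (rule is_idealI) (simp_all add: hzero_closed hadd_closed hscale_closed cmp_closed)
  have gen: "f \<in> ideal_gen D S x y"
    if "\<And>I. \<lbrakk>is_ideal D I; \<And>u v. \<lbrakk>u \<in> obj D; v \<in> obj D\<rbrakk> \<Longrightarrow> S u v \<subseteq> I u v\<rbrakk> \<Longrightarrow> f \<in> I x y" for x y f
    using that unfolding ideal_gen_def by blast
  note least = subsetD[OF ideal_gen_least]
  show ?thesis
  proof (rule is_idealI)
    show "f \<in> Hom D x y" if "f \<in> ideal_gen D S x y" for x y f
      using least[OF H assms(2) that] .
    show "hzero D x y \<in> ideal_gen D S x y" if "x \<in> obj D" "y \<in> obj D" for x y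
      by (rule gen) (simp add: ideal_hzero that)
    show "hadd D x y f g \<in> ideal_gen D S x y"
      if *: "x \<in> obj D" "y \<in> obj D" "f \<in> ideal_gen D S x y" "g \<in> ideal_gen D S x y" for x y f g
      by (rule gen) (rule ideal_hadd[OF _ *(1,2) least[OF _ _ *(3)] least[OF _ _ *(4)]])
    show "hscale D x y a f \<in> ideal_gen D S x y"
      if *: "x \<in> obj D" "y \<in> obj D" "f \<in> ideal_gen D S x y" for x y f a
      by (rule gen) (rule ideal_hscale[OF _ *(1,2) least[OF _ _ *(3)]])
    show "cmp D x y z g f \<in> ideal_gen D S x z"
      if *: "x \<in> obj D" "y \<in> obj D" "z \<in> obj D" "f \<in> ideal_gen D S x y" "g \<in> Hom D y z"
        for x y z f g
      by (rule gen) (rule ideal_cmp_left[OF _ *(1-3) least[OF _ _ *(4)] *(5)])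
    show "cmp D x y z g f \<in> ideal_gen D S x z"
      if *: "x \<in> obj D" "y \<in> obj D" "z \<in> obj D" "f \<in> Hom D x y" "g \<in> ideal_gen D S y z"
        for x y z f g
      by (rule gen) (rule ideal_cmp_right[OF _ *(1-4) least[OF _ _ *(5)]])
  qed
qed

lemma kernel_ideal:
  assumes "linear_category D" "linear_category E" and F: "linear_functor D E F"
  shows "is_ideal D (\<lambda>x y. {f \<in> Hom D x y. farr F x y f = hzero E (fobj F x) (fobj F y)})"
proof -
  interpret D: linear_category D by fact
  interpret E: linear_category E by fact
  note F' = is_functorD[OF linear_functor_functor[OF F]]
  show ?thesis
    by (rule is_idealI)
      (auto simp: F' functor_hadd[OF F] functor_hscale[OF F] functor_hzero[OF assms(1,2) F]
        D.hzero_closed D.hadd_closed D.hscale_closed D.cmp_closed E.hadd_hzero_left E.hscale_hzero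
        E.hzero_closed E.cmp_hzero_left E.cmp_hzero_right)
qed

locale ideal_quotient = linear_category D
  for D :: "('o, 'm, 'k :: {comm_ring, comm_monoid_mult}) lincat" +
  fixes J :: "'o \<Rightarrow> 'o \<Rightarrow> 'm set"
  assumes ideal: "is_ideal D J"
begin

abbreviation "q x y \<equiv> coset D J x y"

lemma coset_self:
  assumes "x \<in> obj D" "y \<in> obj D" "f \<in> Hom D x y"
  shows "f \<in> q x y f"
proof -
  have "hadd D x y f (hzero D x y) \<in> q x y f"
    using assms ideal_hzero[OF ideal] unfolding coset_def by blast
  then show ?thesis
    using assms by (simp add: hadd_hzero_right)
qed

lemma coset_add:
  assumes o: "x \<in> obj D" "y \<in> obj D" and f: "f \<in> Hom D x y" and i: "i \<in> J x y"
  shows "q x y (hadd D x y f i) = q x y f"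
proof -
  note J = ideal_Hom[OF ideal o]
  have "hadd D x y (hadd D x y f i) j \<in> q x y f" if "j \<in> J x y" for j
    using that o f i J ideal_hadd[OF ideal o i that] by (auto simp: coset_def hadd_assoc)
  moreover have "hadd D x y f j \<in> q x y (hadd D x y f i)" if "j \<in> J x y" for j
  proof -
    \<comment> \<open>The solution of \<open>f + j = (f + i) + k\<close>, with the negative written
      as a multiple by \<open>-1\<close>.\<close>
    let ?k = "hadd D x y (hscale D x y (-1) i) j"
    have "?k \<in> J x y"
      using o i that by (simp add: ideal_hadd[OF ideal] ideal_hscale[OF ideal])
    moreover have "hadd D x y f j = hadd D x y (hadd D x y f i) ?k"
    proof -
      have "hadd D x y i ?k = hadd D x y (hadd D x y i (hscale D x y (-1) i)) j"
        using o i J that by (simp add: hadd_assoc hscale_closed)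
      also have "\<dots> = j"
        using o i J that by (simp add: hadd_neg hadd_hzero_left)
      finally show ?thesis
        using o i f J that by (simp add: hadd_assoc hscale_closed hadd_closed)
    qed
    ultimately show ?thesis
      by (simp add: coset_def)
  qed
  ultimately show ?thesis
    by (auto simp: coset_def)
qed

lemma coset_eqI:
  assumes "x \<in> obj D" "y \<in> obj D" "f \<in> Hom D x y" "g \<in> q x y f"
  shows "q x y g = q x y f"
proof -
  from assms(4) obtain i where "i \<in> J x y" "g = hadd D x y f i"
    by (auto simp: coset_def)
  then show ?thesis
    using assms by (simp add: coset_add)
qed

lemma coset_eq_hzero_iff:
  assumes "x \<in> obj D" "y \<in> obj D" "f \<in> Hom D x y"
  shows "q x y f = q x y (hzero D x y) \<longleftrightarrow> f \<in> J x y"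
proof
  assume "q x y f = q x y (hzero D x y)"
  then have "f \<in> q x y (hzero D x y)"
    using coset_self[OF assms] by simp
  then show "f \<in> J x y"
    using assms ideal_Hom[OF ideal] by (auto simp: coset_def hadd_hzero_left)
next
  assume f: "f \<in> J x y"
  then have "hadd D x y (hzero D x y) f \<in> q x y (hzero D x y)"
    by (simp add: coset_def)
  then show "q x y f = q x y (hzero D x y)"
    using assms by (intro coset_eqI) (simp_all add: hzero_closed hadd_hzero_left)
qed

lemma quotient_ops:
  assumes o: "x \<in> obj D" "y \<in> obj D" and f: "f \<in> Hom D x y"
  shows quotient_hscale: "hscale (lin_quotient D J) x y a (q x y f) = q x y (hscale D x y a f)"
    and quotient_hadd: "g \<in> Hom D x y \<Longrightarrow>
      hadd (lin_quotient D J) x y (q x y f) (q x y g) = q x y (hadd D x y f g)"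
    and quotient_cmp: "\<lbrakk>z \<in> obj D; h \<in> Hom D y z\<rbrakk> \<Longrightarrow>
      cmp (lin_quotient D J) x y z (q y z h) (q x y f) = q x z (cmp D x y z h f)"
proof -
  note J = ideal_Hom[OF ideal]
  have "q x y (hscale D x y a f') = q x y (hscale D x y a f)" if f': "f' \<in> q x y f" for f'
  proof -
    obtain i where "i \<in> J x y" "f' = hadd D x y f i"
      using f' by (auto simp: coset_def)
    then show ?thesis
      using o f J by (simp add: hscale_add_right coset_add ideal_hscale[OF ideal] hscale_closed)
  qed
  then show "hscale (lin_quotient D J) x y a (q x y f) = q x y (hscale D x y a f)"
    using UN_eq_const[OF coset_self[OF o f], of "\<lambda>f'. q x y (hscale D x y a f')"] by
      (simp add: lin_quotient_def)
next
  note J = ideal_Hom[OF ideal]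
  assume g: "g \<in> Hom D x y"
  have "q x y (hadd D x y f' g') = q x y (hadd D x y f g)"
    if f': "f' \<in> q x y f" and g': "g' \<in> q x y g" for f' g'
  proof -
    obtain i j where i: "i \<in> J x y" "f' = hadd D x y f i" and j: "j \<in> J x y" "g' = hadd D x y g j"
      using f' g' by (auto simp: coset_def)
    have "hadd D x y f' g' = hadd D x y (hadd D x y f g) (hadd D x y i j)"
      using o f g i j J by (simp add: hadd_assoc hadd_closed hadd_left_comm)
    then show ?thesis
      using o f g i(1) j(1) by (simp add: coset_add hadd_closed ideal_hadd[OF ideal])
  qed
  then have "(\<Union>b\<in>q x y g. q x y (hadd D x y a b)) = q x y (hadd D x y f g)" if "a \<in> q x y f" for a
    using that by (intro UN_eq_const[OF coset_self[OF o g]]) blast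
  then show "hadd (lin_quotient D J) x y (q x y f) (q x y g) = q x y (hadd D x y f g)"
    by (simp only: lin_quotient_def cat.simps lincat.simps UN_eq_const[OF coset_self[OF o f]])
next
  note J = ideal_Hom[OF ideal]
  assume z: "z \<in> obj D" and h: "h \<in> Hom D y z"
  have "q x z (cmp D x y z h' f') = q x z (cmp D x y z h f)"
    if f': "f' \<in> q x y f" and h': "h' \<in> q y z h" for f' h'
  proof -
    obtain i j where i: "i \<in> J x y" "f' = hadd D x y f i" and j: "j \<in> J y z" "h' = hadd D y z h j"
      using f' h' by (auto simp: coset_def)
    have h'_Hom: "h' \<in> Hom D y z"
      using o z h j J by (simp add: hadd_closed)
    have "cmp D x y z h' f' = hadd D x z (cmp D x y z h' f) (cmp D x y z h' i)"
      unfolding i(2) using o z f h'_Hom i(1) J by (intro cmp_add_right) auto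
    moreover have "cmp D x y z h' f = hadd D x z (cmp D x y z h f) (cmp D x y z j f)"
      unfolding j(2) using o z f h j(1) J by (intro cmp_add_left) auto
    moreover have "cmp D x y z j f \<in> J x z" "cmp D x y z h' i \<in> J x z"
      using o z f h'_Hom i(1) j(1) J by (simp_all add: ideal_cmp_left[OF ideal] ideal_cmp_right[OF
        ideal])
    ultimately show ?thesis
      using o z f h J by (simp add: coset_add cmp_closed hadd_closed)
  qed
  then have "(\<Union>b\<in>q y z h. q x z (cmp D x y z b a)) = q x z (cmp D x y z h f)" if "a \<in> q x y f" for a
    using that by (intro UN_eq_const[OF coset_self[OF o(2) z h]]) blast
  then show "cmp (lin_quotient D J) x y z (q y z h) (q x y f) = q x z (cmp D x y z h f)"
    by (simp only: lin_quotient_def cat.simps lincat.simps UN_eq_const[OF coset_self[OF o f]])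
qed

lemma quotient_simps [simp]:
  "obj (lin_quotient D J) = obj D" "Hom (lin_quotient D J) x y = q x y ` Hom D x y"
  "idm (lin_quotient D J) x = q x x (idm D x)"
  "hzero (lin_quotient D J) x y = q x y (hzero D x y)"
  by (simp_all add: lin_quotient_def)

lemma linear_category_quotient: "linear_category (lin_quotient D J)"
proof (rule linear_categoryI)
  show "category (lin_quotient D J)"
    by unfold_locales (simp only: quotient_simps; (elim imageE)?;
        simp add: idm_closed quotient_cmp cmp_closed cmp_idm_left cmp_idm_right cmp_assoc)+
qed (simp only: quotient_simps; (elim imageE)?; simp add: quotient_ops hadd_closed hscale_closed
    hzero_closed hadd_assoc hadd_comm hadd_left_comm hadd_hzero_left hadd_hzero_right hadd_neg
    hscale_one hscale_mult hscale_add_left hscale_add_right cmp_closed cmp_add_left cmp_add_right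
    cmp_scale_left cmp_scale_right)+

definition coset_func where
  "coset_func = \<lparr>fobj = \<lambda>x. x, farr = q\<rparr>"

lemma linear_functor_coset: "linear_functor D (lin_quotient D J) coset_func"
  by (intro linear_functorI is_functorI) (auto simp: coset_func_def quotient_ops)

text \<open>A chosen representative of the coset of \<open>f\<close> is \<open>f + i\<close> with
  \<open>i\<close> in the ideal, and \<open>F\<close> does not see \<open>i\<close>.\<close>

lemma quotient_universal:
  assumes F: "linear_functor D K F"
    and kernel: "\<And>x y f. \<lbrakk>x \<in> obj D; y \<in> obj D; f \<in> J x y\<rbrakk>
      \<Longrightarrow> farr F x y f = hzero K (fobj F x) (fobj F y)"
    and K: "linear_category K"
  obtains N where "linear_functor (lin_quotient D J) K N" "fobj N = fobj F"
    "\<And>x y f. \<lbrakk>x \<in> obj D; y \<in> obj D; f \<in> Hom D x y\<rbrakk> \<Longrightarrow> farr N x y (q x y f) = farr F x y f"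
proof -
  interpret K: linear_category K by fact
  note F' = is_functorD[OF linear_functor_functor[OF F]]
  define N where "N = \<lparr>fobj = fobj F, farr = \<lambda>x y c. farr F x y (SOME f. f \<in> c)\<rparr>"
  have N: "farr N x y (q x y f) = farr F x y f" if o: "x \<in> obj D" "y \<in> obj D" "f \<in> Hom D x y"
    for x y f
  proof -
    have "(SOME g. g \<in> q x y f) \<in> q x y f"
      by (rule someI) (rule coset_self[OF o])
    then obtain i where "i \<in> J x y" "(SOME g. g \<in> q x y f) = hadd D x y f i"
      by (auto simp: coset_def)
    then show ?thesis
      using o ideal_Hom[OF ideal o(1,2)]
      by (simp add: N_def functor_hadd[OF F] kernel K.hadd_hzero_right F')
  qed
  have obj: "fobj N = fobj F"
    by (simp add: N_def)
  have "linear_functor (lin_quotient D J) K N"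
    by (intro linear_functorI is_functorI)
      (auto simp: quotient_ops N obj F' functor_hadd[OF F] functor_hscale[OF F]
        cmp_closed hadd_closed hscale_closed idm_closed)
  then show thesis
    using that obj N by blast
qed

end

subsection \<open>Adjoining a zero object\<close>

lemma adjoin_zero_simps [simp]:
  "obj (adjoin_zero D) = insert None (Some ` obj D)"
  "Hom (adjoin_zero D) (Some x) (Some y) = Hom D x y"
  "Hom (adjoin_zero D) None y' = {0}" "Hom (adjoin_zero D) x' None = {0}"
  "idm (adjoin_zero D) (Some x) = idm D x" "idm (adjoin_zero D) None = 0"
  "cmp (adjoin_zero D) (Some x) (Some y) (Some z) = cmp D x y z"
  "cmp (adjoin_zero D) (Some x) None (Some z) g f = hzero D x z"
  "cmp (adjoin_zero D) None y' z' g f = 0" "cmp (adjoin_zero D) x' y' None g f = 0"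
  "hadd (adjoin_zero D) (Some x) (Some y) = hadd D x y"
  "hadd (adjoin_zero D) None y' f g = 0" "hadd (adjoin_zero D) x' None f g = 0"
  "hzero (adjoin_zero D) (Some x) (Some y) = hzero D x y"
  "hzero (adjoin_zero D) None y' = 0" "hzero (adjoin_zero D) x' None = 0"
  "hscale (adjoin_zero D) (Some x) (Some y) = hscale D x y"
  "hscale (adjoin_zero D) None y' a f = 0" "hscale (adjoin_zero D) x' None a f = 0"
  by (auto simp: adjoin_zero_def split: option.splits)

lemma linear_category_adjoin_zero:
  assumes "linear_category D"
  shows "linear_category (adjoin_zero D)"
proof -
  interpret linear_category D by fact
  show ?thesis
  proof (rule linear_categoryI)
    show "category (adjoin_zero D)"
      by unfold_locales
        (auto simp: idm_closed cmp_closed cmp_idm_left cmp_idm_right cmp_assoc hzero_closed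
          cmp_hzero_left cmp_hzero_right)
  qed (auto simp: hadd_closed hscale_closed hzero_closed hadd_assoc hadd_comm
    hadd_left_comm hadd_hzero_left hadd_hzero_right hadd_neg hscale_one hscale_mult hscale_add_left
      hscale_add_right hscale_hzero
    cmp_closed cmp_add_left cmp_add_right cmp_scale_left cmp_scale_right)
qed

text \<open>Since \<open>z\<close> has zero identity, every morphism into or out of it is zero,
  which settles all cases involving \<open>None\<close>. The lemma characterizes \<open>T\<close> by
  equations because it is applied to the given functor \<open>Phi\<close>.\<close>

lemma linear_functor_adjoin_zero:
  assumes "linear_category D" "linear_category E" and F: "linear_functor D E F"
    and z: "z \<in> obj E" "idm E z = hzero E z z"
    and T_obj: "fobj T None = z" "\<And>x. x \<in> obj D \<Longrightarrow> fobj T (Some x) = fobj F x"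
    and T_arr: "\<And>x y f. \<lbrakk>x \<in> obj D; y \<in> obj D\<rbrakk> \<Longrightarrow> farr T (Some x) (Some y) f = farr F x y f"
      "\<And>x y f. x = None \<or> y = None \<Longrightarrow> farr T x y f = hzero E (fobj T x) (fobj T y)"
  shows "linear_functor (adjoin_zero D) E T"
proof -
  interpret D: linear_category D by fact
  interpret E: linear_category E by fact
  note F' = is_functorD[OF linear_functor_functor[OF F]]
  have zero: "f = hzero E x y" if "x \<in> obj E" "y \<in> obj E" "f \<in> Hom E x y" "x = z \<or> y = z" for x y f
    using E.Hom_trivial[of x y f] that z(2) by auto
  show ?thesis
    by (intro linear_functorI is_functorI)
      (auto simp: T_obj T_arr F' z functor_hadd[OF F] functor_hscale[OF F]
        functor_hzero[OF assms(1,2) F] E.hzero_closed E.hscale_hzero E.hadd_hzero_left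
        E.cmp_hzero_left E.cmp_hzero_right)
qed

subsection \<open>Linear localizations\<close>

lemma (in category) loc_rel_Hom:
  assumes "(v, w) \<in> loc_rel D S x y" "x \<in> obj D" "y \<in> obj D"
  shows "is_word (zigzag_quiver D S) x y v \<and> is_word (zigzag_quiver D S) x y w"
  using assms by cases (auto simp: zigzag_quiver_def cmp_closed idm_closed)

locale linear_loc = linear_category D
  for D :: "('o, 'm, 'k :: {comm_ring, comm_monoid_mult}) lincat" +
  fixes S :: "'o \<Rightarrow> 'o \<Rightarrow> 'm set"
begin

abbreviation "Z \<equiv> (free_zigzag D S :: ('o, ('o, 'm zigzag) word \<Rightarrow>\<^sub>0 'k, 'k) lincat)"

abbreviation "L \<equiv> (lin_localization D S :: ('o, (('o, 'm zigzag) word \<Rightarrow>\<^sub>0 'k) set, 'k) lincat)"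

lemma Z_simps [simp]:
  "obj Z = obj D" "Hom Z x y = {f. Poly_Mapping.keys f \<subseteq> {w. is_word (zigzag_quiver D S) x y w}}"
  "idm Z x = Poly_Mapping.single [] 1"
  "hadd Z x y = (+)" "hzero Z x y = 0" "hscale Z x y = pm_scale"
  by (simp_all add: free_zigzag_def zigzag_quiver_def)

lemma cmp_Z_single:
  "cmp Z x y z (Poly_Mapping.single w d) (Poly_Mapping.single v c)
    = Poly_Mapping.single (v @ w) (d * c)"
  by (simp add: free_zigzag_def)

sublocale Z: ideal_quotient Z "lin_loc_ideal D S"
proof -
  interpret Z: linear_category Z
    unfolding free_zigzag_def by (rule linear_category_linearization[OF category_free_cat])
  have Fwd: "is_word (zigzag_quiver D S) x y [(x, y, Fwd f)]"
    if "x \<in> obj D" "y \<in> obj D" "f \<in> Hom D x y" for x y f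
    using that by (simp add: zigzag_quiver_def)
  have diff: "f - g \<in> Hom Z x y" if "f \<in> Hom Z x y" "g \<in> Hom Z x y" for x y f g
    using that keys_diff[of f g] by auto
  have add: "f + g \<in> Hom Z x y" if "f \<in> Hom Z x y" "g \<in> Hom Z x y" for x y f g
    using that by (auto dest: keys_add_subset)
  have scale: "pm_scale a f \<in> Hom Z x y" if "f \<in> Hom Z x y" for x y a f
    using that keys_pm_scale[of a f] by auto
  \<comment> \<open>\<open>ideal_gen\<close> is an ideal only when its generators are morphisms; for
    the relations this amounts to well-formed words.\<close>
  have rel: "lin_loc_rel D S u v \<subseteq> Hom Z u v" if "u \<in> obj D" "v \<in> obj D" for u v
  proof -
    have 1: "Poly_Mapping.single w c \<in> Hom Z u v" if "is_word (zigzag_quiver D S) u v w" for w c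
      using that by simp
    show ?thesis
      unfolding lin_loc_rel_def
      using that
      by (intro Un_least subsetI; elim CollectE exE conjE)
        (auto simp del: Z_simps intro!: diff 1 add scale Fwd hadd_closed hscale_closed dest:
          loc_rel_Hom)
  qed
  show "ideal_quotient Z (lin_loc_ideal D S)"
    by unfold_locales (auto simp: lin_loc_ideal_def intro!: ideal_gen_ideal
      Z.linear_category_axioms rel[THEN subsetD])
qed

end

context linear_loc
begin

lemma loc_coset_eqI:
  assumes "x \<in> obj D" "y \<in> obj D" "f \<in> Hom Z x y" "g \<in> Hom Z x y" "f - g \<in> lin_loc_rel D S x y"
  shows "Z.q x y f = Z.q x y g"
proof -
  have "f - g \<in> lin_loc_ideal D S x y"
    using ideal_gen_incl[of x Z y "lin_loc_rel D S"] assms by (auto simp: lin_loc_ideal_def)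
  then have "Z.q x y (hadd Z x y g (f - g)) = Z.q x y g"
    using assms by (intro Z.coset_add) auto
  then show ?thesis
    by simp
qed

lemma fwd_Hom: "\<lbrakk>x \<in> obj D; y \<in> obj D; f \<in> Hom D x y\<rbrakk> \<Longrightarrow> fwd x y f \<in> Hom Z x y"
  by (simp add: zigzag_quiver_def)

lemma bwd_Hom: "\<lbrakk>x \<in> obj D; y \<in> obj D; s \<in> S y x; s \<in> Hom D y x\<rbrakk> \<Longrightarrow> bwd x y s \<in> Hom Z x y"
  by (simp add: zigzag_quiver_def)

lemma loc_rel_coset_eq:
  assumes "x \<in> obj D" "y \<in> obj D" "(v, w) \<in> loc_rel D S x y"
  shows "Z.q x y (Poly_Mapping.single v 1) = Z.q x y (Poly_Mapping.single w 1)"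
  using loc_rel_Hom[OF assms(3,1,2)] assms
  by (intro loc_coset_eqI) (auto simp: lin_loc_rel_def)

text \<open>Each property of a linear functor is one family of \<open>lin_loc_rel\<close>:
  \<open>loc_cmp\<close>, \<open>loc_id\<close>, sums and scalar multiples.\<close>

lemma linear_functor_loc: "linear_functor D L (lin_loc_func D S)"
proof -
  have L: "L = lin_quotient Z (lin_loc_ideal D S)"
    by (simp add: lin_localization_def)
  show ?thesis
    unfolding L
  proof (intro linear_functorI is_functorI)
    fix x y z f g
    assume "x \<in> obj D" "y \<in> obj D" "z \<in> obj D" "f \<in> Hom D x y" "g \<in> Hom D y z"
    then show "farr (lin_loc_func D S) x z (cmp D x y z g f) =
        cmp (lin_quotient Z (lin_loc_ideal D S)) (fobj (lin_loc_func D S) x) (fobj (lin_loc_func D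
          S) y)
          (fobj (lin_loc_func D S) z) (farr (lin_loc_func D S) y z g) (farr (lin_loc_func D S) x y
            f)"
      using loc_rel_coset_eq[OF _ _ loc_cmp[of x D y z f g S]] fwd_Hom[of x y f] fwd_Hom[of y z g]
      by (simp add: lin_loc_func_def Z.quotient_cmp cmp_Z_single del: Z_simps(2))
  next
    fix x y f g
    assume *: "x \<in> obj D" "y \<in> obj D" "f \<in> Hom D x y" "g \<in> Hom D x y"
    have "Z.q x y (fwd x y (hadd D x y f g)) = Z.q x y (hadd Z x y (fwd x y f) (fwd x y g))"
      using * by (intro loc_coset_eqI fwd_Hom Z.hadd_closed)
        (auto simp: hadd_closed lin_loc_rel_def)
    then show "farr (lin_loc_func D S) x y (hadd D x y f g)
      = hadd (lin_quotient Z (lin_loc_ideal D S))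
        (fobj (lin_loc_func D S) x) (fobj (lin_loc_func D S) y)
        (farr (lin_loc_func D S) x y f) (farr (lin_loc_func D S) x y g)"
      using * fwd_Hom[of x y f] fwd_Hom[of x y g]
      by (simp add: lin_loc_func_def Z.quotient_hadd del: Z_simps(2))
  next
    fix x y f a
    assume *: "x \<in> obj D" "y \<in> obj D" "f \<in> Hom D x y"
    have "Z.q x y (fwd x y (hscale D x y a f)) = Z.q x y (hscale Z x y a (fwd x y f))"
      using * by (intro loc_coset_eqI fwd_Hom Z.hscale_closed)
        (auto simp: hscale_closed lin_loc_rel_def simp del: pm_scale_simps)
    then show "farr (lin_loc_func D S) x y (hscale D x y a f)
      = hscale (lin_quotient Z (lin_loc_ideal D S))
        (fobj (lin_loc_func D S) x) (fobj (lin_loc_func D S) y) a (farr (lin_loc_func D S) x y f)"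
      using * fwd_Hom[of x y f]
      by (simp add: lin_loc_func_def Z.quotient_hscale del: Z_simps(2))
  next
    fix x assume "x \<in> obj D"
    then show "farr (lin_loc_func D S) x x (idm D x) =
        idm (lin_quotient Z (lin_loc_ideal D S)) (fobj (lin_loc_func D S) x)"
      using loc_rel_coset_eq[OF _ _ loc_id[of x D x S]] by (simp add: lin_loc_func_def)
  qed (auto simp: lin_loc_func_def zigzag_quiver_def split: if_splits)
qed

lemma loc_linear_category: "linear_category L"
  using Z.linear_category_quotient by (simp add: lin_localization_def)

lemma loc_iso:
  assumes "x \<in> obj D" "y \<in> obj D" "s \<in> S x y" "s \<in> Hom D x y"
  shows "is_iso L x y (farr (lin_loc_func D S) x y s)"
proof (rule is_isoI)
  have L: "L = lin_quotient Z (lin_loc_ideal D S)"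
    by (simp add: lin_localization_def)
  show "farr (lin_loc_func D S) x y s \<in> Hom L x y"
    using fwd_Hom[of x y s] assms by (auto simp: L lin_loc_func_def)
  show "Z.q y x (bwd y x s) \<in> Hom L y x"
    using bwd_Hom[of y x s] assms by (auto simp: L)
  show "cmp L x y x (Z.q y x (bwd y x s)) (farr (lin_loc_func D S) x y s) = idm L x"
    using loc_rel_coset_eq[OF _ _ loc_inv_left[of x D y x s S]] fwd_Hom[of x y s] bwd_Hom[of y x s]
      assms
    by (simp add: L lin_loc_func_def Z.quotient_cmp cmp_Z_single del: Z_simps(2))
  show "cmp L y x y (farr (lin_loc_func D S) x y s) (Z.q y x (bwd y x s)) = idm L y"
    using loc_rel_coset_eq[OF _ _ loc_inv_right[of y D x y s S]] fwd_Hom[of x y s] bwd_Hom[of y x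
      s] assms
    by (simp add: L lin_loc_func_def Z.quotient_cmp cmp_Z_single del: Z_simps(2))
qed

text \<open>The word functor \<open>zz\<close> is extended linearly to the free linear category. It
  annihilates all relations, hence the ideal they generate, and factors through the
  quotient.\<close>

lemma loc_universal:
  assumes K: "linear_category K" and lin: "linear_functor D K M"
    and inverts: "\<And>x y s. \<lbrakk>x \<in> obj D; y \<in> obj D; s \<in> S x y; s \<in> Hom D x y\<rbrakk>
      \<Longrightarrow> is_iso K (fobj M x) (fobj M y) (farr M x y s)"
  obtains N where "linear_functor L K N" "fobj N = fobj M"
    "\<And>x y f. \<lbrakk>x \<in> obj D; y \<in> obj D; f \<in> Hom D x y\<rbrakk> \<Longrightarrow>
      farr N x y (farr (lin_loc_func D S) x y f) = farr M x y f"
proof -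
  interpret K: linear_category K by fact
  interpret inverting_functor D K S M
    by unfold_locales (use linear_functor_functor[OF lin] inverts in auto)
  note M' = is_functorD[OF linear_functor_functor[OF lin]]
  let ?W = "\<lparr>fobj = fobj M, farr = zz\<rparr>"
  define T where "T = lin_ext K ?W"
  have T: "linear_functor Z K T"
    unfolding T_def free_zigzag_def by (rule lin_ext_linear[OF category_free_cat K zz_functor])
  have [simp]: "fobj T = fobj M"
    by (simp add: T_def lin_ext_def)
  note T' = is_functorD[OF linear_functor_functor[OF T]]
  have single: "farr T x y (Poly_Mapping.single w c) = hscale K (fobj M x) (fobj M y) c (zz x y w)"
    if "x \<in> obj D" "y \<in> obj D" "is_word (zigzag_quiver D S) x y w" for x y w c
    unfolding T_def
    using lin_ext_single[OF category_free_cat K zz_functor, of x y w c] that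
    by (simp add: zigzag_quiver_def)
  have Fwd: "farr T x y (fwd x y f) = farr M x y f" if "x \<in> obj D" "y \<in> obj D" "f \<in> Hom D x y"
    for x y f
    using that zz_Fwd[OF that] single[of x y "[(x, y, Fwd f)]" 1]
    by (simp add: zigzag_quiver_def K.hscale_one M')
  \<comment> \<open>The relations are differences, but Hom-sets of \<open>K\<close> carry no
    subtraction. Writing \<open>f\<close> as \<open>g + (f - g)\<close> and cancelling gives the
    vanishing on \<open>f - g\<close> from equal values on \<open>f\<close> and
    \<open>g\<close>.\<close>
  have diff: "f - g \<in> Hom Z x y \<and> farr T x y (f - g) = hzero K (fobj M x) (fobj M y)"
    if *: "x \<in> obj D" "y \<in> obj D" "f \<in> Hom Z x y" "g \<in> Hom Z x y" "farr T x y f = farr T x y g"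
      for x y f g
  proof -
    have fg: "f - g \<in> Hom Z x y"
      using that keys_diff[of f g] by auto
    have "f = hadd Z x y g (f - g)"
      by simp
    then have "farr T x y f = hadd K (fobj M x) (fobj M y) (farr T x y g) (farr T x y (f - g))"
      using functor_hadd[OF T, of x y g "f - g"] fg * by (simp del: Z_simps(2))
    then have "hadd K (fobj M x) (fobj M y) (farr T x y g) (farr T x y (f - g)) =
        hadd K (fobj M x) (fobj M y) (farr T x y g) (hzero K (fobj M x) (fobj M y))"
      using * T'(2)[of x y g] by (simp add: K.hadd_hzero_right M')
    then show ?thesis
      using fg * T'(2)[of x y g] T'(2)[of x y "f - g"] by
        (simp add: K.hadd_cancel K.hzero_closed M' del: Z_simps(2))
  qed
  have kernel: "farr T x y f = hzero K (fobj M x) (fobj M y)"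
    if "f \<in> lin_loc_ideal D S x y" "x \<in> obj D" "y \<in> obj D" for x y f
  proof -
    \<comment> \<open>The kernel of \<open>T\<close> is an ideal, so by minimality only the three
      families of generators have to be checked.\<close>
    have "lin_loc_ideal D S x y \<subseteq> {f \<in> Hom Z x y. farr T x y f = hzero K (fobj T x) (fobj T y)}"
      unfolding lin_loc_ideal_def
    proof (rule ideal_gen_least[OF kernel_ideal[OF _ K T]])
      show "linear_category Z"
        by (rule Z.linear_category_axioms)
      fix u v assume uv: "u \<in> obj Z" "v \<in> obj Z"
      show "lin_loc_rel D S u v \<subseteq> {f \<in> Hom Z u v. farr T u v f = hzero K (fobj T u) (fobj T v)}"
        unfolding lin_loc_rel_def
      proof (intro Un_least subsetI; elim CollectE exE conjE; clarsimp simp del: Z_simps(2)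
        pm_scale_simps)
        fix v' w assume vw: "(v', w) \<in> loc_rel D S u v"
        note * = loc_rel_words[OF vw]
        show "Poly_Mapping.single v' 1 - Poly_Mapping.single w 1 \<in> Hom Z u v \<and>
            farr T u v (Poly_Mapping.single v' 1 - Poly_Mapping.single w 1)
              = hzero K (fobj M u) (fobj M v)"
          by (rule diff) (use uv * in \<open>auto simp: single\<close>)
      next
        fix f g assume *: "f \<in> Hom D u v" "g \<in> Hom D u v"
        have "farr T u v (fwd u v f + fwd u v g)
          = hadd K (fobj M u) (fobj M v) (farr M u v f) (farr M u v g)"
          using functor_hadd[OF T, of u v "fwd u v f" "fwd u v g"] uv * fwd_Hom Fwd by
            (simp del: Z_simps(2))
        then show "fwd u v (hadd D u v f g) - (fwd u v f + fwd u v g) \<in> Hom Z u v \<and>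
            farr T u v (fwd u v (hadd D u v f g) - (fwd u v f + fwd u v g))
              = hzero K (fobj M u) (fobj M v)"
          using uv * Z.hadd_closed[of u v "fwd u v f" "fwd u v g"]
          by (intro diff fwd_Hom) (simp_all add: Fwd hadd_closed functor_hadd[OF lin] fwd_Hom del:
            Z_simps(2))
      next
        fix a f assume *: "f \<in> Hom D u v"
        have "farr T u v (pm_scale a (fwd u v f)) = hscale K (fobj M u) (fobj M v) a (farr M u v f)"
          using functor_hscale[OF T, of u v "fwd u v f"] uv * fwd_Hom Fwd
          by (simp del: Z_simps(2) pm_scale_simps)
        then show "fwd u v (hscale D u v a f) - pm_scale a (fwd u v f) \<in> Hom Z u v \<and>
            farr T u v (fwd u v (hscale D u v a f) - pm_scale a (fwd u v f))
              = hzero K (fobj M u) (fobj M v)"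
          using uv * Z.hscale_closed[of u v "fwd u v f" a]
          by (intro diff fwd_Hom)
            (simp_all add: Fwd hscale_closed functor_hscale[OF lin] fwd_Hom del: Z_simps(2)
              pm_scale_simps)
      qed
    qed
    with that show ?thesis
      by auto
  qed
  obtain N where N: "linear_functor (lin_quotient Z (lin_loc_ideal D S)) K N" "fobj N = fobj T"
    "\<And>x y f. \<lbrakk>x \<in> obj Z; y \<in> obj Z; f \<in> Hom Z x y\<rbrakk> \<Longrightarrow> farr N x y (Z.q x y f) = farr T x y f"
    by (rule Z.quotient_universal[OF T _ K]) (use kernel in auto)
  show thesis
  proof (rule that)
    show "linear_functor L K N"
      using N(1) by (simp add: lin_localization_def)
    show "farr N x y (farr (lin_loc_func D S) x y f) = farr M x y f"
      if "x \<in> obj D" "y \<in> obj D" "f \<in> Hom D x y" for x y f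
      using N(3)[of x y "fwd x y f"] Fwd[OF that] that fwd_Hom[OF that] by
        (simp add: lin_loc_func_def)
  qed (simp add: N)
qed

end

section \<open>The path category\<close>

text \<open>On the real line intervals are the connected sets, and continuous images of connected
  sets are connected.\<close>

lemma reparamI:
  assumes "continuous_on {0..1} \<phi>" "mono_on {0..1} \<phi>" "\<And>t. \<lbrakk>0 \<le> t; t \<le> 1\<rbrakk> \<Longrightarrow> 0 \<le> \<phi> t \<and> \<phi> t \<le> 1"
  shows "reparam \<phi>"
proof -
  have "is_interval (\<phi> ` J)" if "J \<subseteq> {0..1}" "is_interval J" for J
    using that connected_continuous_image[OF continuous_on_subset[OF assms(1)]]
    by (simp add: is_interval_connected_1)
  then show ?thesis
    using assms(2,3) by (auto simp: reparam_def)
qed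

lemma path_concat_0 [simp]: "(\<gamma> \<cdot> \<delta>) 0 = \<gamma> 0"
  by (simp add: path_concat_def)

lemma path_concat_1 [simp]: "(\<gamma> \<cdot> \<delta>) 1 = \<delta> 1"
  by (simp add: path_concat_def)

lemma const_path_simps [simp]: "const_path x 0 = x" "const_path x 1 = x" "im (const_path x) = {x}"
  by (force simp: const_path_def im_def)+

lemma im_path_concat:
  assumes "\<gamma> 1 = \<delta> 0"
  shows "im (\<gamma> \<cdot> \<delta>) = im \<gamma> \<union> im \<delta>"
proof (intro subset_antisym subsetI)
  fix p assume "p \<in> im (\<gamma> \<cdot> \<delta>)"
  then obtain t where "0 \<le> t" "t \<le> 1" "p = (\<gamma> \<cdot> \<delta>) t"
    by (auto simp: im_def)
  then show "p \<in> im \<gamma> \<union> im \<delta>"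
    by (cases "t \<le> 1/2") (auto simp: im_def path_concat_def)
next
  fix p assume "p \<in> im \<gamma> \<union> im \<delta>"
  then consider t where "0 \<le> t" "t \<le> 1" "p = \<gamma> t" | t where "0 \<le> t" "t \<le> 1" "p = \<delta> t"
    by (auto simp: im_def)
  then show "p \<in> im (\<gamma> \<cdot> \<delta>)"
  proof cases
    case 1
    then have "p = (\<gamma> \<cdot> \<delta>) (t / 2)"
      by (simp add: path_concat_def)
    with 1 show ?thesis
      unfolding im_def by (intro image_eqI[where x = "t / 2"]) auto
  next
    case 2
    then have "p = (\<gamma> \<cdot> \<delta>) ((t + 1) / 2)"
      using assms by (cases "t = 0") (simp_all add: path_concat_def add_divide_distrib)
    with 2 show ?thesis
      unfolding im_def by (intro image_eqI[where x = "(t + 1) / 2"]) auto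
  qed
qed

lemma im_endpoints: "\<gamma> 0 \<in> im \<gamma>" "\<gamma> 1 \<in> im \<gamma>"
  by (auto simp: im_def)

section \<open>Concatenation up to equivalence, and the category axioms\<close>

context path_triple
begin

lemma path_in: "\<gamma> \<in> \<Gamma> \<Longrightarrow> 0 \<le> t \<Longrightarrow> t \<le> 1 \<Longrightarrow> \<gamma> t \<in> X"
  using paths by (auto simp: paths_in_def PiE_iff subset_iff)

lemma path_ends [simp]: "\<gamma> \<in> \<Gamma> \<Longrightarrow> \<gamma> 0 \<in> X" "\<gamma> \<in> \<Gamma> \<Longrightarrow> \<gamma> 1 \<in> X"
  by (simp_all add: path_in)

lemma R_refl: "\<gamma> \<in> \<Gamma> \<Longrightarrow> (\<gamma>, \<gamma>) \<in> R"
  using equiv by (meson equivE refl_onD)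

lemma R_sym: "(\<gamma>, \<delta>) \<in> R \<Longrightarrow> (\<delta>, \<gamma>) \<in> R"
  using equiv by (meson equivE symD)

lemma R_trans [trans]: "(\<gamma>, \<delta>) \<in> R \<Longrightarrow> (\<delta>, \<epsilon>) \<in> R \<Longrightarrow> (\<gamma>, \<epsilon>) \<in> R"
  using equiv by (meson equivE transD)

lemma R_in: "(\<gamma>, \<delta>) \<in> R \<Longrightarrow> \<gamma> \<in> \<Gamma>" "(\<gamma>, \<delta>) \<in> R \<Longrightarrow> \<delta> \<in> \<Gamma>"
  using equiv_type[OF equiv] by auto

lemma reparam_equivI:
  assumes "\<gamma> \<in> \<Gamma>" "continuous_on {0..1} \<phi>" "mono_on {0..1} \<phi>"
    "\<And>t. \<lbrakk>0 \<le> t; t \<le> 1\<rbrakk> \<Longrightarrow> 0 \<le> \<phi> t \<and> \<phi> t \<le> 1" "\<phi> 0 = 0" "\<phi> 1 = 1"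
    and \<delta>: "\<And>t. \<delta> t = (if 0 \<le> t \<and> t \<le> 1 then \<gamma> (\<phi> t) else undefined)"
  shows "(\<gamma>, \<delta>) \<in> R"
proof -
  have "\<delta> = compose {0..1} \<gamma> \<phi>"
    using \<delta> by (auto simp: compose_def restrict_def)
  then show ?thesis
    using reparam_equiv[OF assms(1) reparamI[OF assms(2-4)]] assms(5,6) by simp
qed

text \<open>The left bracketing traverses its pieces on \<open>[0,1/4]\<close>,
  \<open>[1/4,1/2]\<close>, \<open>[1/2,1]\<close>, the right one on \<open>[0,1/2]\<close>,
  \<open>[1/2,3/4]\<close>, \<open>[3/4,1]\<close>. The piecewise affine map between these
  subdivisions has slopes 2, 1, 1/2; it is concave, hence the minimum of its three affine
  pieces.\<close>

lemma concat_assoc: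
  assumes "\<gamma> \<in> \<Gamma>" "\<delta> \<in> \<Gamma>" "\<epsilon> \<in> \<Gamma>" "\<gamma> 1 = \<delta> 0" "\<delta> 1 = \<epsilon> 0"
  shows "(\<gamma> \<cdot> (\<delta> \<cdot> \<epsilon>), \<gamma> \<cdot> \<delta> \<cdot> \<epsilon>) \<in> R"
proof (rule reparam_equivI[where \<phi> = "\<lambda>t. min (2 * t) (min (t + 1/4) ((t + 1) / 2))"])
  show "\<gamma> \<cdot> (\<delta> \<cdot> \<epsilon>) \<in> \<Gamma>"
    using assms by (intro concat_closed) auto
  show "continuous_on {0..1} (\<lambda>t. min (2 * t) (min (t + 1/4) ((t + 1) / 2)) :: real)"
    by (intro continuous_intros) auto
  show "mono_on {0..1} (\<lambda>t. min (2 * t) (min (t + 1/4) ((t + 1) / 2)) :: real)"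
    by (auto intro!: mono_onI simp: min_def)
  show "(\<gamma> \<cdot> \<delta> \<cdot> \<epsilon>) t = (if 0 \<le> t \<and> t \<le> 1
      then (\<gamma> \<cdot> (\<delta> \<cdot> \<epsilon>)) (min (2 * t) (min (t + 1/4) ((t + 1) / 2))) else undefined)" for t
  proof -
    consider "t < 0 \<or> t > 1" | "0 \<le> t" "t \<le> 1/4" | "1/4 < t" "t \<le> 1/2" | "1/2 < t" "t \<le> 1"
      by linarith
    then show ?thesis
    proof cases
      case 2
      then have "min (2 * t) (min (t + 1/4) ((t + 1) / 2)) = 2 * t"
        by (auto simp: min_def)
      with 2 show ?thesis
        by (simp add: path_concat_def)
    next
      case 3
      then have "min (2 * t) (min (t + 1/4) ((t + 1) / 2)) = t + 1/4"
        by (auto simp: min_def field_simps)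
      with 3 show ?thesis
        by (simp add: path_concat_def algebra_simps)
    next
      case 4
      then have "min (2 * t) (min (t + 1/4) ((t + 1) / 2)) = (t + 1) / 2"
        by (auto simp: min_def field_simps)
      with 4 show ?thesis
        by (simp add: path_concat_def) (rule arg_cong[of _ _ \<epsilon>], simp)
    qed (auto simp: path_concat_def)
  qed
qed (auto simp: min_def)

text \<open>The reparametrization runs through \<open>\<gamma>\<close> on the first half and then
  waits at its end; for a constant path in front it waits at the start instead.\<close>

lemma concat_const_right:
  assumes "\<gamma> \<in> \<Gamma>" "\<gamma> 1 = x"
  shows "(\<gamma>, \<gamma> \<cdot> const_path x) \<in> R"
proof (rule reparam_equivI[where \<phi> = "\<lambda>t. min (2 * t) 1"])
  show "continuous_on {0..1} (\<lambda>t. min (2 * t) 1 :: real)"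
    by (intro continuous_intros)
  show "mono_on {0..1} (\<lambda>t. min (2 * t) 1 :: real)"
    by (auto intro!: mono_onI simp: min_def)
  show "(\<gamma> \<cdot> const_path x) t = (if 0 \<le> t \<and> t \<le> 1 then \<gamma> (min (2 * t) 1) else undefined)" for t
    using assms by (auto simp: path_concat_def const_path_def min_def)
qed (use assms in auto)

lemma concat_const_left:
  assumes "\<gamma> \<in> \<Gamma>" "\<gamma> 0 = x"
  shows "(\<gamma>, const_path x \<cdot> \<gamma>) \<in> R"
proof (rule reparam_equivI[where \<phi> = "\<lambda>t. max (2 * t - 1) 0"])
  show "continuous_on {0..1} (\<lambda>t. max (2 * t - 1) 0 :: real)"
    by (intro continuous_intros)
  show "mono_on {0..1} (\<lambda>t. max (2 * t - 1) 0 :: real)"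
    by (auto intro!: mono_onI simp: max_def)
  show "(const_path x \<cdot> \<gamma>) t = (if 0 \<le> t \<and> t \<le> 1 then \<gamma> (max (2 * t - 1) 0) else undefined)" for t
    using assms by (auto simp: path_concat_def const_path_def max_def)
qed (use assms in auto)

text \<open>The cancellation axiom speaks of extensions on both sides. The missing side is padded
  with a constant path, which is removed afterwards up to equivalence; associativity is needed
  because concatenation brackets to the left.\<close>

lemma concat_cong_left:
  assumes "(\<gamma>, \<gamma>') \<in> R" "\<delta> \<in> \<Gamma>" "\<gamma> 1 = \<delta> 0"
  shows "(\<gamma> \<cdot> \<delta>, \<gamma>' \<cdot> \<delta>) \<in> R"
proof -
  note e = endpoints[OF assms(1)] R_in[OF assms(1)]
  let ?c = "const_path (\<gamma> 0)"
  have c: "?c \<in> \<Gamma>"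
    using e by (simp add: const_closed)
  have *: "(\<epsilon> \<cdot> \<delta>, ?c \<cdot> \<epsilon> \<cdot> \<delta>) \<in> R" if "\<epsilon> \<in> {\<gamma>, \<gamma>'}" for \<epsilon>
  proof -
    have "(\<epsilon> \<cdot> \<delta>, ?c \<cdot> (\<epsilon> \<cdot> \<delta>)) \<in> R"
      using that e assms by (intro concat_const_left concat_closed) auto
    also have "(?c \<cdot> (\<epsilon> \<cdot> \<delta>), ?c \<cdot> \<epsilon> \<cdot> \<delta>) \<in> R"
      using that e assms c by (intro concat_assoc) auto
    finally show ?thesis .
  qed
  have "(\<gamma> \<cdot> \<delta>, ?c \<cdot> \<gamma> \<cdot> \<delta>) \<in> R"
    by (rule *) simp
  also have "(?c \<cdot> \<gamma> \<cdot> \<delta>, ?c \<cdot> \<gamma>' \<cdot> \<delta>) \<in> R"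
    by (rule iffD1[OF concat_equiv_iff assms(1)]) (use e assms c in simp_all)
  also have "(?c \<cdot> \<gamma>' \<cdot> \<delta>, \<gamma>' \<cdot> \<delta>) \<in> R"
    by (rule R_sym[OF *[of \<gamma>']]) simp
  finally show ?thesis .
qed

lemma concat_cong_right:
  assumes "(\<gamma>, \<gamma>') \<in> R" "\<delta> \<in> \<Gamma>" "\<delta> 1 = \<gamma> 0"
  shows "(\<delta> \<cdot> \<gamma>, \<delta> \<cdot> \<gamma>') \<in> R"
proof -
  note e = endpoints[OF assms(1)] R_in[OF assms(1)]
  let ?c = "const_path (\<gamma> 1)"
  have c: "?c \<in> \<Gamma>"
    using e by (simp add: const_closed)
  have *: "(\<delta> \<cdot> \<epsilon>, \<delta> \<cdot> \<epsilon> \<cdot> ?c) \<in> R" if "\<epsilon> \<in> {\<gamma>, \<gamma>'}" for \<epsilon>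
    using that e assms by (intro concat_const_right concat_closed) auto
  have "(\<delta> \<cdot> \<gamma> \<cdot> ?c, \<delta> \<cdot> \<gamma>' \<cdot> ?c) \<in> R"
    by (rule iffD1[OF concat_equiv_iff assms(1)]) (use e assms c in simp_all)
  then show ?thesis
    using R_trans[OF R_trans[OF *[of \<gamma>]] R_sym[OF *[of \<gamma>']]] by simp
qed

lemma concat_cong:
  assumes "(\<gamma>, \<gamma>') \<in> R" "(\<delta>, \<delta>') \<in> R" "\<gamma> 1 = \<delta> 0"
  shows "(\<gamma> \<cdot> \<delta>, \<gamma>' \<cdot> \<delta>') \<in> R"
  using R_trans[OF concat_cong_left[of \<gamma> \<gamma>' \<delta>] concat_cong_right[of \<delta> \<delta>' \<gamma>']] assms
    endpoints[OF assms(1)] R_in[OF assms(1)] R_in[OF assms(2)]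
  by simp

abbreviation "C \<equiv> path_cat X \<Gamma> R"

lemma path_class_eq: "(\<gamma>, \<delta>) \<in> R \<Longrightarrow> path_class R \<gamma> = path_class R \<delta>"
  by (rule equiv_class_eq[OF equiv])

lemma path_cat_simps [simp]:
  "obj C = X" "Hom C x y = {path_class R \<gamma> | \<gamma>. \<gamma> \<in> \<Gamma> \<and> \<gamma> 0 = x \<and> \<gamma> 1 = y}"
  "idm C x = path_class R (const_path x)"
  by (simp_all add: path_cat_def)

lemma cmp_path_class [simp]:
  assumes "\<gamma> \<in> \<Gamma>" "\<delta> \<in> \<Gamma>" "\<gamma> 1 = \<delta> 0"
  shows "cmp C x y z (path_class R \<delta>) (path_class R \<gamma>) = path_class R (\<gamma> \<cdot> \<delta>)"
proof -
  have eq: "path_class R (\<gamma>' \<cdot> \<delta>') = path_class R (\<gamma> \<cdot> \<delta>)"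
    if "\<gamma>' \<in> path_class R \<gamma>" "\<delta>' \<in> path_class R \<delta>" for \<gamma>' \<delta>'
    using that assms concat_cong[of \<gamma> \<gamma>' \<delta> \<delta>'] path_class_eq[of "\<gamma> \<cdot> \<delta>" "\<gamma>' \<cdot> \<delta>'"] by auto
  have mem: "\<gamma> \<in> path_class R \<gamma>" "\<delta> \<in> path_class R \<delta>"
    using assms by (auto intro: R_refl)
  have "cmp C x y z (path_class R \<delta>) (path_class R \<gamma>) =
      (\<Union>\<gamma>'\<in>path_class R \<gamma>. \<Union>\<delta>'\<in>path_class R \<delta>. path_class R (\<gamma>' \<cdot> \<delta>'))"
    by (auto simp: path_cat_def)
  also have "\<dots> = path_class R (\<gamma> \<cdot> \<delta>)"
    by (intro UN_eq_const[OF mem(1)] UN_eq_const[OF mem(2)] eq)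
  finally show ?thesis .
qed

lemma category_path_cat: "category C"
proof
  fix w x y z f g h
  assume "f \<in> Hom C w x" "g \<in> Hom C x y" "h \<in> Hom C y z"
  then obtain \<gamma> \<delta> \<epsilon> where "\<gamma> \<in> \<Gamma>" "\<delta> \<in> \<Gamma>" "\<epsilon> \<in> \<Gamma>" "\<gamma> 1 = \<delta> 0" "\<delta> 1 = \<epsilon> 0"
    and [simp]: "f = path_class R \<gamma>" "g = path_class R \<delta>" "h = path_class R \<epsilon>"
    by auto
  then show "cmp C w y z h (cmp C w x y g f) = cmp C w x z (cmp C x y z h g) f"
    using path_class_eq[OF concat_assoc[of \<gamma> \<delta> \<epsilon>]] by (simp add: concat_closed)
next
  fix x y f assume "f \<in> Hom C x y"
  then obtain \<gamma> where "\<gamma> \<in> \<Gamma>" "\<gamma> 0 = x" "\<gamma> 1 = y" "f = path_class R \<gamma>"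
    by auto
  moreover from this have "x \<in> X" "y \<in> X"
    using path_ends by auto
  ultimately show "cmp C x x y f (idm C x) = f" "cmp C x y y (idm C y) f = f"
    using path_class_eq[OF concat_const_left[of \<gamma> x], symmetric]
      path_class_eq[OF concat_const_right[of \<gamma> y], symmetric]
    by (simp_all add: const_closed path_in)
next
  fix x y z f g
  assume "f \<in> Hom C x y" "g \<in> Hom C y z"
  then obtain \<gamma> \<delta> where "\<gamma> \<in> \<Gamma>" "\<delta> \<in> \<Gamma>" "\<gamma> 0 = x" "\<gamma> 1 = y" "\<delta> 0 = y" "\<delta> 1 = z"
    "f = path_class R \<gamma>" "g = path_class R \<delta>"
    by auto
  then show "cmp C x y z g f \<in> Hom C x z"
    by (auto intro!: exI[of _ "\<gamma> \<cdot> \<delta>"] concat_closed)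
next
  fix x assume "x \<in> obj C"
  then show "idm C x \<in> Hom C x x"
    using const_closed[of x] by (auto intro!: exI[of _ "const_path x"])
qed

end

section \<open>Paths in pixels\<close>

locale screened = path_triple X \<Gamma> R + screen X \<Gamma> R P
  for X :: "'x set" and \<Gamma> :: "'x pth set" and R :: "'x pth rel" and P :: "'x set set"
begin

definition pix :: "'x pth \<Rightarrow> bool" where
  "pix \<rho> \<longleftrightarrow> \<rho> \<in> \<Gamma> \<and> in_pixel P \<rho>"

lemma pix_path: "pix \<rho> \<Longrightarrow> \<rho> \<in> \<Gamma>"
  by (simp add: pix_def)

lemma pixel_unique: "\<lbrakk>Y \<in> P; Y' \<in> P; x \<in> Y; x \<in> Y'\<rbrakk> \<Longrightarrow> Y = Y'"
  using partition by (auto simp: partition_on_def disjoint_def)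

lemma pixel_subset: "Y \<in> P \<Longrightarrow> Y \<subseteq> X"
  using partition by (auto simp: partition_on_def)

lemma ex_pixel: "x \<in> X \<Longrightarrow> \<exists>Y\<in>P. x \<in> Y"
  using partition by (auto simp: partition_on_def)

lemma pix_subset:
  assumes "pix \<rho>" "Y \<in> P" "im \<rho> \<inter> Y \<noteq> {}"
  shows "im \<rho> \<subseteq> Y"
proof -
  obtain Y' where "Y' \<in> P" "im \<rho> \<subseteq> Y'"
    using assms by (auto simp: pix_def in_pixel_def)
  then show ?thesis
    using assms pixel_unique[of Y Y'] by blast
qed

lemma pixI: "\<lbrakk>\<rho> \<in> \<Gamma>; Y \<in> P; im \<rho> \<subseteq> Y\<rbrakk> \<Longrightarrow> pix \<rho>"
  by (auto simp: pix_def in_pixel_def)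

lemma pix_const: "x \<in> X \<Longrightarrow> pix (const_path x)"
  using ex_pixel[of x] const_closed[of x] by (auto intro: pixI)

lemma pix_concat:
  assumes "pix \<rho>" "pix \<sigma>" "\<rho> 1 = \<sigma> 0"
  shows "pix (\<rho> \<cdot> \<sigma>)"
proof -
  obtain Y where Y: "Y \<in> P" "im \<rho> \<subseteq> Y"
    using assms by (auto simp: pix_def in_pixel_def)
  moreover have "im \<sigma> \<subseteq> Y"
    using pix_subset[OF assms(2) Y(1)] Y(2) im_endpoints[of \<rho>] im_endpoints[of \<sigma>] assms(3) by auto
  ultimately show ?thesis
    using assms by (intro pixI[of _ Y] concat_closed) (auto simp: im_path_concat pix_path)
qed

text \<open>The common start puts both images into the same pixel, and then (S1) applies. This is
  what makes witnesses in pixels interchangeable.\<close>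

lemma pix_parallel:
  assumes "pix \<rho>" "pix \<sigma>" "\<rho> 0 = \<sigma> 0" "\<rho> 1 = \<sigma> 1"
  shows "(\<rho>, \<sigma>) \<in> R"
proof -
  obtain Y where Y: "Y \<in> P" "im \<rho> \<subseteq> Y"
    using assms by (auto simp: pix_def in_pixel_def)
  then have "im \<sigma> \<subseteq> Y"
    using pix_subset[OF assms(2) Y(1)] im_endpoints[of \<rho>] im_endpoints[of \<sigma>] assms(3) by auto
  then show ?thesis
    using S1[of \<rho> \<sigma> Y] assms Y by (auto simp: pix_path)
qed

text \<open>The dual of (S3) completes the cospan to a square but places only the leg
  \<open>v\<close> in a pixel. The composite \<open>v \<cdot> \<sigma>\<close> then lies in a pixel,
  and (S1) forces the equivalent path \<open>u \<cdot> \<rho>\<close>, hence also \<open>u\<close>,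
  into that pixel.\<close>

lemma pix_ore_left:
  assumes "pix \<rho>" "pix \<sigma>" "\<rho> 1 = \<sigma> 1"
  obtains u v where "pix u" "pix v" "u 1 = \<rho> 0" "v 1 = \<sigma> 0" "u 0 = v 0"
proof -
  obtain v u where uv: "v \<in> \<Gamma>" "u \<in> \<Gamma>" "in_pixel P v" "u 1 = \<rho> 0" "v 1 = \<sigma> 0"
    and R: "(u \<cdot> \<rho>, v \<cdot> \<sigma>) \<in> R"
    using S3_dual[of \<rho> \<sigma>] assms by (auto simp: pix_def)
  have v: "pix v"
    using uv by (simp add: pix_def)
  obtain Y where Y: "Y \<in> P" "im (v \<cdot> \<sigma>) \<subseteq> Y"
    using pix_concat[OF v assms(2)] uv by (auto simp: pix_def in_pixel_def)
  have "im (u \<cdot> \<rho>) \<subseteq> Y"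
    using S1[of "v \<cdot> \<sigma>" "u \<cdot> \<rho>" Y] Y R_sym[OF R] R_in[OF R] endpoints[OF R] by simp
  then have "pix u"
    using uv Y by (intro pixI[of _ Y]) (auto simp: im_path_concat)
  with v uv endpoints[OF R] show thesis
    by (intro that[of u v]) auto
qed

text \<open>The same argument for spans, with (S3) in place of its dual.\<close>

lemma pix_ore_right:
  assumes "pix \<rho>" "pix \<sigma>" "\<rho> 0 = \<sigma> 0"
  obtains u v where "pix u" "pix v" "\<rho> 1 = u 0" "\<sigma> 1 = v 0" "u 1 = v 1"
proof -
  obtain v u where uv: "v \<in> \<Gamma>" "u \<in> \<Gamma>" "in_pixel P v" "\<sigma> 1 = v 0" "\<rho> 1 = u 0"
    and R: "(\<sigma> \<cdot> v, \<rho> \<cdot> u) \<in> R"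
    using S3[of \<rho> \<sigma>] assms by (auto simp: pix_def)
  have v: "pix v"
    using uv by (simp add: pix_def)
  obtain Y where Y: "Y \<in> P" "im (\<sigma> \<cdot> v) \<subseteq> Y"
    using pix_concat[OF assms(2) v] uv by (auto simp: pix_def in_pixel_def)
  have "im (\<rho> \<cdot> u) \<subseteq> Y"
    using S1[of "\<sigma> \<cdot> v" "\<rho> \<cdot> u" Y] Y R R_in[OF R] endpoints[OF R] by simp
  then have "pix u"
    using uv Y by (intro pixI[of _ Y]) (auto simp: im_path_concat)
  with v uv endpoints[OF R] show thesis
    by (intro that[of u v]) auto
qed

end

section \<open>The ideal of a pixelation\<close>

locale screened_ideal = screened X \<Gamma> R P
  for X :: "'x set" and \<Gamma> :: "'x pth set" and R :: "'x pth rel" and P :: "'x set set" +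
  fixes I :: "('x, 'k :: {comm_ring, comm_monoid_mult}) path_ideal"
  assumes I_ideal: "is_ideal (lin_path_cat X \<Gamma> R) I"
begin

abbreviation "Lin \<equiv> (linearization (path_cat X \<Gamma> R) :: ('x, 'x pth set \<Rightarrow>\<^sub>0 'k, 'k) lincat)"

abbreviation "LC \<equiv> (lin_path_cat X \<Gamma> R :: ('x option, 'x pth set \<Rightarrow>\<^sub>0 'k, 'k) lincat)"

abbreviation mon :: "'x pth \<Rightarrow> ('x pth set \<Rightarrow>\<^sub>0 'k)" where
  "mon \<gamma> \<equiv> smon R 1 \<gamma>"

sublocale Lin: linear_category Lin
  by (rule linear_category_linearization[OF category_path_cat])

sublocale LC: linear_category LC
  unfolding lin_path_cat_def by (rule linear_category_adjoin_zero[OF Lin.linear_category_axioms])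

sublocale QI: ideal_quotient LC I
  by unfold_locales (rule I_ideal)

lemma LC_simps [simp]:
  "obj LC = insert None (Some ` X)"
  "Hom LC (Some x) (Some y) = Hom Lin x y" "Hom LC None y' = {0}" "Hom LC x' None = {0}"
  "cmp LC (Some x) (Some y) (Some z) = cmp Lin x y z"
  "cmp LC (Some x) None (Some z) g f = 0"
  "cmp LC None y' z' g f = 0" "cmp LC x' y' None g f = 0"
  "hadd LC (Some x) (Some y) = (+)" "hadd LC None y' f g = 0" "hadd LC x' None f g = 0"
  "hzero LC x' y' = 0"
  "hscale LC (Some x) (Some y) = pm_scale" "hscale LC None y' a f = 0" "hscale LC x' None a f = 0"
  by (simp_all add: lin_path_cat_def) (simp add: adjoin_zero_def split: option.split)

lemma mon_Hom: "\<lbrakk>\<gamma> \<in> \<Gamma>; \<gamma> 0 = x; \<gamma> 1 = y\<rbrakk> \<Longrightarrow> Poly_Mapping.single (path_class R \<gamma>) c \<in> Hom Lin x y"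
  by auto

lemma cmp_mon:
  "\<lbrakk>\<gamma> \<in> \<Gamma>; \<delta> \<in> \<Gamma>; \<gamma> 1 = \<delta> 0\<rbrakk> \<Longrightarrow> cmp Lin x y z (mon \<delta>) (mon \<gamma>) = mon (\<gamma> \<cdot> \<delta>)"
  by simp

lemma mon_eq: "(\<gamma>, \<delta>) \<in> R \<Longrightarrow> mon \<gamma> = mon \<delta>"
  by (simp add: path_class_eq)

text \<open>The objects are read off from the endpoints of \<open>\<mu>\<close> and
  \<open>\<nu>\<close>; since composition in \<open>linearization\<close> is bilinear for all
  arguments, the map is linear without any condition on \<open>f\<close>.\<close>

definition sandwich :: "'x pth \<Rightarrow> 'x pth \<Rightarrow> ('x pth set \<Rightarrow>\<^sub>0 'k) \<Rightarrow> ('x pth set \<Rightarrow>\<^sub>0 'k)" where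
  "sandwich \<mu> \<nu> f =
     cmp Lin (\<mu> 0) (\<nu> 0) (\<nu> 1) (mon \<nu>) (cmp Lin (\<mu> 0) (\<mu> 1) (\<nu> 0) f (mon \<mu>))"

lemma sandwich_linear [simp]:
  "sandwich \<mu> \<nu> 0 = 0" "sandwich \<mu> \<nu> (f + g) = sandwich \<mu> \<nu> f + sandwich \<mu> \<nu> g"
  "sandwich \<mu> \<nu> (pm_scale a f) = pm_scale a (sandwich \<mu> \<nu> f)"
  by (simp_all add: sandwich_def cmp_linearization_add cmp_linearization_scale)

lemma sandwich_cong:
  "\<lbrakk>(\<mu>, \<mu>') \<in> R; (\<nu>, \<nu>') \<in> R\<rbrakk> \<Longrightarrow> sandwich \<mu> \<nu> f = sandwich \<mu>' \<nu>' f"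
  using endpoints[of \<mu> \<mu>'] endpoints[of \<nu> \<nu>'] mon_eq[of \<mu> \<mu>'] mon_eq[of \<nu> \<nu>']
  by (simp add: sandwich_def)

lemma sandwich_mon:
  assumes "\<mu> \<in> \<Gamma>" "\<gamma> \<in> \<Gamma>" "\<nu> \<in> \<Gamma>" "\<mu> 1 = \<gamma> 0" "\<gamma> 1 = \<nu> 0"
  shows "sandwich \<mu> \<nu> (mon \<gamma>) = mon (\<mu> \<cdot> \<gamma> \<cdot> \<nu>)"
  using assms unfolding sandwich_def by (simp only: cmp_mon concat_closed path_concat_1)

text \<open>Used to prolong witnesses: once \<open>sandwich \<mu> \<nu> f\<close> lies in
  \<open>I\<close>, so does the sandwich of \<open>f\<close> by any longer pair.\<close>

lemma sandwich_concat:
  assumes "u \<in> \<Gamma>" "\<mu> \<in> \<Gamma>" "\<nu> \<in> \<Gamma>" "w \<in> \<Gamma>" "u 1 = \<mu> 0" "\<nu> 1 = w 0" "f \<in> Hom Lin (\<mu> 1) (\<nu> 0)"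
  shows "sandwich (u \<cdot> \<mu>) (\<nu> \<cdot> w) f = sandwich u w (sandwich \<mu> \<nu> f)"
proof -
  note H = mon_Hom[OF assms(1) refl assms(5), of 1] mon_Hom[OF assms(2) refl refl, of 1]
    mon_Hom[OF assms(3) refl assms(6), of 1] mon_Hom[OF assms(4) refl refl, of 1] assms(7)
  have o: "u 0 \<in> obj Lin" "\<mu> 0 \<in> obj Lin" "\<mu> 1 \<in> obj Lin" "\<nu> 0 \<in> obj Lin" "w 0 \<in> obj Lin"
    "w 1 \<in> obj Lin"
    using assms by simp_all
  have 1: "mon (u \<cdot> \<mu>) = cmp Lin (u 0) (\<mu> 0) (\<mu> 1) (mon \<mu>) (mon u)"
    using assms by (simp only: cmp_mon)
  have 2: "mon (\<nu> \<cdot> w) = cmp Lin (\<nu> 0) (w 0) (w 1) (mon w) (mon \<nu>)"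
    using assms by (simp only: cmp_mon)
  show ?thesis
    unfolding sandwich_def path_concat_0 path_concat_1 1 2
    using o H
    by (simp add: Lin.cmp_assoc Lin.cmp_closed assms(5,6) del: linearization_simps
      cmp_linearization_single)
qed

lemma sandwich_ideal:
  assumes "\<mu> \<in> \<Gamma>" "\<nu> \<in> \<Gamma>" "f \<in> I (Some (\<mu> 1)) (Some (\<nu> 0))"
  shows "sandwich \<mu> \<nu> f \<in> I (Some (\<mu> 0)) (Some (\<nu> 1))"
proof -
  have o: "Some (\<mu> 0) \<in> obj LC" "Some (\<mu> 1) \<in> obj LC" "Some (\<nu> 0) \<in> obj LC" "Some (\<nu> 1) \<in> obj LC"
    using assms by simp_all
  have "cmp LC (Some (\<mu> 0)) (Some (\<mu> 1)) (Some (\<nu> 0)) f (mon \<mu>) \<in> I (Some (\<mu> 0)) (Some (\<nu> 0))"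
    by (rule ideal_cmp_right[OF I_ideal]) (use o assms mon_Hom[OF assms(1) refl refl] in auto)
  then have "cmp LC (Some (\<mu> 0)) (Some (\<nu> 0)) (Some (\<nu> 1)) (mon \<nu>)
      (cmp LC (Some (\<mu> 0)) (Some (\<mu> 1)) (Some (\<nu> 0)) f (mon \<mu>)) \<in> I (Some (\<mu> 0)) (Some (\<nu> 1))"
    by (rule ideal_cmp_left[OF I_ideal o(1,3,4)]) (use mon_Hom[OF assms(2) refl refl] in simp)
  then show ?thesis
    by (simp only: sandwich_def LC_simps)
qed

text \<open>An upper bound for the pixel ideal. One pair of pixel paths must serve for all of
  \<open>f\<close>, not one pair per summand: the two paths are later cancelled from the image of
  \<open>f\<close> under a representation.\<close>

definition absorbed :: "'x \<Rightarrow> 'x \<Rightarrow> ('x pth set \<Rightarrow>\<^sub>0 'k) set" where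
  "absorbed a b = {f \<in> Hom Lin a b. \<exists>\<mu> \<nu>. pix \<mu> \<and> pix \<nu> \<and> \<mu> 1 = a \<and> \<nu> 0 = b \<and>
     sandwich \<mu> \<nu> f \<in> I (Some (\<mu> 0)) (Some (\<nu> 1))}"

lemma absorbedI:
  "\<lbrakk>f \<in> Hom Lin a b; pix \<mu>; pix \<nu>; \<mu> 1 = a; \<nu> 0 = b; sandwich \<mu> \<nu> f \<in> I (Some (\<mu> 0)) (Some (\<nu> 1))\<rbrakk>
    \<Longrightarrow> f \<in> absorbed a b"
  unfolding absorbed_def by blast

lemma absorbedE:
  assumes "f \<in> absorbed a b"
  obtains \<mu> \<nu> where "f \<in> Hom Lin a b" "pix \<mu>" "pix \<nu>" "\<mu> 1 = a" "\<nu> 0 = b"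
    "sandwich \<mu> \<nu> f \<in> I (Some (\<mu> 0)) (Some (\<nu> 1))"
  using assms unfolding absorbed_def by blast

lemma absorbed_zero: "a \<in> X \<Longrightarrow> b \<in> X \<Longrightarrow> 0 \<in> absorbed a b"
  using ideal_hzero[OF I_ideal, of "Some a" "Some b"]
  by (intro absorbedI[of _ _ _ "const_path a" "const_path b"]) (auto simp: pix_const)

text \<open>The two pairs of witnesses are prolonged by the Ore conditions until they have equal
  endpoints. The prolonged paths are parallel in a pixel, hence equivalent, so one pair serves both
  summands.\<close>

lemma absorbed_add:
  assumes "f \<in> absorbed a b" "g \<in> absorbed a b"
  shows "f + g \<in> absorbed a b"
proof -
  obtain \<mu>1 \<nu>1 where 1: "f \<in> Hom Lin a b" "pix \<mu>1" "pix \<nu>1" "\<mu>1 1 = a" "\<nu>1 0 = b"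
    "sandwich \<mu>1 \<nu>1 f \<in> I (Some (\<mu>1 0)) (Some (\<nu>1 1))"
    using assms(1) by (rule absorbedE)
  obtain \<mu>2 \<nu>2 where 2: "g \<in> Hom Lin a b" "pix \<mu>2" "pix \<nu>2" "\<mu>2 1 = a" "\<nu>2 0 = b"
    "sandwich \<mu>2 \<nu>2 g \<in> I (Some (\<mu>2 0)) (Some (\<nu>2 1))"
    using assms(2) by (rule absorbedE)
  obtain u v where u: "pix u" "pix v" "u 1 = \<mu>1 0" "v 1 = \<mu>2 0" "u 0 = v 0"
    using pix_ore_left[OF 1(2) 2(2)] 1(4) 2(4) by metis
  obtain w z where w: "pix w" "pix z" "\<nu>1 1 = w 0" "\<nu>2 1 = z 0" "w 1 = z 1"
    using pix_ore_right[OF 1(3) 2(3)] 1(5) 2(5) by metis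
  note paths = 1(2,3)[THEN pix_path] 2(2,3)[THEN pix_path] u(1,2)[THEN pix_path] w(1,2)[THEN
    pix_path]
  have pix: "pix (u \<cdot> \<mu>1)" "pix (\<nu>1 \<cdot> w)" "pix (v \<cdot> \<mu>2)" "pix (\<nu>2 \<cdot> z)"
    using 1 2 u w by (simp_all add: pix_concat)
  have f: "sandwich (u \<cdot> \<mu>1) (\<nu>1 \<cdot> w) f \<in> I (Some (u 0)) (Some (w 1))"
    using 1 u w paths sandwich_ideal[of u w] by (simp add: sandwich_concat del: linearization_simps)
  have "sandwich (v \<cdot> \<mu>2) (\<nu>2 \<cdot> z) g \<in> I (Some (u 0)) (Some (w 1))"
    using 2 u w paths sandwich_ideal[of v z] by (simp add: sandwich_concat del: linearization_simps)
  \<comment> \<open>Here the prolonged second pair is exchanged for the prolonged first one.\<close>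
  also have "sandwich (v \<cdot> \<mu>2) (\<nu>2 \<cdot> z) g = sandwich (u \<cdot> \<mu>1) (\<nu>1 \<cdot> w) g"
    using 1 2 u w pix by (intro sandwich_cong pix_parallel) simp_all
  finally have "sandwich (u \<cdot> \<mu>1) (\<nu>1 \<cdot> w) (f + g) \<in> I (Some (u 0)) (Some (w 1))"
    using f ideal_hadd[OF I_ideal, of "Some (u 0)" "Some (w 1)"] paths by simp
  then show ?thesis
    using 1 2 pix by (intro absorbedI[of _ _ _ "u \<cdot> \<mu>1" "\<nu>1 \<cdot> w"]) (auto dest: keys_add_subset)
qed

lemma absorbed_scale:
  assumes "f \<in> absorbed a b"
  shows "pm_scale c f \<in> absorbed a b"
proof -
  obtain \<mu> \<nu> where *: "f \<in> Hom Lin a b" "pix \<mu>" "pix \<nu>" "\<mu> 1 = a" "\<nu> 0 = b"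
    "sandwich \<mu> \<nu> f \<in> I (Some (\<mu> 0)) (Some (\<nu> 1))"
    using assms by (rule absorbedE)
  then show ?thesis
    using keys_pm_scale[of c f] ideal_hscale[OF I_ideal, of "Some (\<mu> 0)" "Some (\<nu> 1)"]
    by (intro absorbedI[of _ _ _ \<mu> \<nu>]) (auto simp: pix_path)
qed

lemma Lin_cmp_mon_scale:
  "cmp Lin x y z (Poly_Mapping.single (path_class R \<gamma>) c) f = pm_scale c (cmp Lin x y z (mon \<gamma>) f)"
  "cmp Lin x y z f (Poly_Mapping.single (path_class R \<gamma>) c) = pm_scale c (cmp Lin x y z f (mon \<gamma>))"
proof -
  have "Poly_Mapping.single (path_class R \<gamma>) c = pm_scale c (mon \<gamma>)"
    by simp
  then show "cmp Lin x y z (Poly_Mapping.single (path_class R \<gamma>) c) f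
    = pm_scale c (cmp Lin x y z (mon \<gamma>) f)"
    "cmp Lin x y z f (Poly_Mapping.single (path_class R \<gamma>) c)
      = pm_scale c (cmp Lin x y z f (mon \<gamma>))"
    by (simp_all only: cmp_linearization_scale)
qed

text \<open>By linearity \<open>g\<close> may be a single path \<open>\<gamma>\<close>. (S3)
  completes \<open>\<nu>\<close> and \<open>\<gamma>\<close> to a square
  \<open>\<gamma> \<cdot> \<nu>' \<sim> \<nu> \<cdot> \<gamma>'\<close> with \<open>\<nu>'\<close>
  in a pixel. Sandwiching the composite between \<open>\<mu>\<close> and \<open>\<nu>'\<close> then
  equals \<open>\<gamma>'\<close> after \<open>sandwich \<mu> \<nu> f\<close>, which lies in
  \<open>I\<close>.\<close>

lemma absorbed_cmp_left:
  assumes o: "a \<in> X" "b \<in> X" "d \<in> X" and f: "f \<in> absorbed a b" and g: "g \<in> Hom Lin b d"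
  shows "cmp Lin a b d g f \<in> absorbed a d"
proof -
  obtain \<mu> \<nu> where *: "f \<in> Hom Lin a b" "pix \<mu>" "pix \<nu>" "\<mu> 1 = a" "\<nu> 0 = b"
    "sandwich \<mu> \<nu> f \<in> I (Some (\<mu> 0)) (Some (\<nu> 1))"
    using f by (rule absorbedE)
  have mon: "cmp Lin a b d (mon \<gamma>) f \<in> absorbed a d" if \<gamma>: "\<gamma> \<in> \<Gamma>" "\<gamma> 0 = b" "\<gamma> 1 = d" for \<gamma>
  proof -
    obtain \<nu>' \<gamma>' where \<nu>': "\<nu>' \<in> \<Gamma>" "\<gamma>' \<in> \<Gamma>" "in_pixel P \<nu>'" "\<gamma> 1 = \<nu>' 0" "\<nu> 1 = \<gamma>' 0"
      "(\<gamma> \<cdot> \<nu>', \<nu> \<cdot> \<gamma>') \<in> R"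
      using S3[of \<nu> \<gamma>] * \<gamma> by (auto simp: pix_def)
    have ends: "\<nu>' 1 = \<gamma>' 1"
      using endpoints[OF \<nu>'(6)] by simp
    have H: "mon \<gamma> \<in> Hom Lin b d" "mon \<nu>' \<in> Hom Lin d (\<gamma>' 1)" "mon \<nu> \<in> Hom Lin b (\<nu> 1)"
      "mon \<gamma>' \<in> Hom Lin (\<nu> 1) (\<gamma>' 1)" "mon \<mu> \<in> Hom Lin (\<mu> 0) a"
      using \<gamma> \<nu>' * ends by (auto simp: pix_def intro!: mon_Hom simp del: linearization_simps)
    have o': "a \<in> obj Lin" "b \<in> obj Lin" "d \<in> obj Lin" "\<mu> 0 \<in> obj Lin" "\<nu> 1 \<in> obj Lin"
      "\<gamma>' 1 \<in> obj Lin"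
      using o * \<nu>' by (simp_all add: pix_path)
    have sq: "cmp Lin b d (\<gamma>' 1) (mon \<nu>') (mon \<gamma>) = cmp Lin b (\<nu> 1) (\<gamma>' 1) (mon \<gamma>') (mon \<nu>)"
      using \<gamma> \<nu>' * mon_eq[OF \<nu>'(6)] by (simp only: cmp_mon pix_path)
    let ?h = "cmp Lin (\<mu> 0) a b f (mon \<mu>)"
    have h: "?h \<in> Hom Lin (\<mu> 0) b"
      using o' H(5) *(1) by (intro Lin.cmp_closed) auto
    have "sandwich \<mu> \<nu>' (cmp Lin a b d (mon \<gamma>) f) =
        cmp Lin (\<mu> 0) d (\<gamma>' 1) (mon \<nu>') (cmp Lin (\<mu> 0) b d (mon \<gamma>) ?h)"
      using *(1,4) \<nu>'(4) \<gamma>(3) ends Lin.cmp_assoc[OF o'(4,1,2,3) H(5) *(1) H(1)] by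
        (simp add: sandwich_def)
    also have "\<dots> = cmp Lin (\<mu> 0) b (\<gamma>' 1) (cmp Lin b (\<nu> 1) (\<gamma>' 1) (mon \<gamma>') (mon \<nu>)) ?h"
      using Lin.cmp_assoc[OF o'(4,2,3,6) h H(1,2)] sq by (simp only:)
    also have "\<dots> = cmp Lin (\<mu> 0) (\<nu> 1) (\<gamma>' 1) (mon \<gamma>') (sandwich \<mu> \<nu> f)"
      using Lin.cmp_assoc[OF o'(4,2,5,6) h H(3,4)] *(4,5) by (simp only: sandwich_def)
    also have "\<dots> \<in> I (Some (\<mu> 0)) (Some (\<gamma>' 1))"
      using ideal_cmp_left[OF I_ideal, of "Some (\<mu> 0)" "Some (\<nu> 1)" "Some (\<gamma>' 1)" "sandwich \<mu> \<nu> f"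
        "mon \<gamma>'"]
        o' *(6) H(4) by (simp del: linearization_simps(2))
    finally show ?thesis
      using * \<nu>' \<gamma> ends Lin.cmp_closed[OF o'(1-3) *(1) H(1)]
      by (intro absorbedI[of _ _ _ \<mu> \<nu>']) (simp_all add: pix_def del: linearization_simps)
  qed
  have single: "cmp Lin a b d (Poly_Mapping.single e c) f \<in> absorbed a d" if "e \<in> Hom C b d" for e c
    using that mon by (auto simp only: path_cat_simps Lin_cmp_mon_scale(1)[where c = c] intro!:
      absorbed_scale)
  have "Poly_Mapping.keys g \<subseteq> Hom C b d"
    using g by simp
  then show ?thesis
    by (induction g rule: pm_induct)
      (use o in \<open>simp_all add: absorbed_zero cmp_linearization_add absorbed_add single
        del: path_cat_simps\<close>)
qed

text \<open>The mirror image: the dual of (S3) replaces \<open>\<mu>\<close> by a pixel path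
  \<open>\<mu>'\<close> in front of \<open>\<gamma>\<close>, while \<open>\<nu>\<close> is
  kept.\<close>

lemma absorbed_cmp_right:
  assumes o: "a \<in> X" "b \<in> X" "d \<in> X" and f: "f \<in> absorbed b d" and g: "g \<in> Hom Lin a b"
  shows "cmp Lin a b d f g \<in> absorbed a d"
proof -
  obtain \<mu> \<nu> where *: "f \<in> Hom Lin b d" "pix \<mu>" "pix \<nu>" "\<mu> 1 = b" "\<nu> 0 = d"
    "sandwich \<mu> \<nu> f \<in> I (Some (\<mu> 0)) (Some (\<nu> 1))"
    using f by (rule absorbedE)
  have mon: "cmp Lin a b d f (mon \<gamma>) \<in> absorbed a d" if \<gamma>: "\<gamma> \<in> \<Gamma>" "\<gamma> 0 = a" "\<gamma> 1 = b" for \<gamma>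
  proof -
    obtain \<mu>' \<gamma>' where \<mu>': "\<mu>' \<in> \<Gamma>" "\<gamma>' \<in> \<Gamma>" "in_pixel P \<mu>'" "\<gamma>' 1 = \<mu> 0" "\<mu>' 1 = \<gamma> 0"
      "(\<gamma>' \<cdot> \<mu>, \<mu>' \<cdot> \<gamma>) \<in> R"
      using S3_dual[of \<mu> \<gamma>] * \<gamma> by (auto simp: pix_def)
    have ends: "\<mu>' 0 = \<gamma>' 0"
      using endpoints[OF \<mu>'(6)] by simp
    have H: "mon \<gamma> \<in> Hom Lin a b" "mon \<mu>' \<in> Hom Lin (\<gamma>' 0) a" "mon \<mu> \<in> Hom Lin (\<mu> 0) b"
      "mon \<gamma>' \<in> Hom Lin (\<gamma>' 0) (\<mu> 0)" "mon \<nu> \<in> Hom Lin d (\<nu> 1)"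
      using \<gamma> \<mu>' * ends by (auto simp: pix_def intro!: mon_Hom simp del: linearization_simps)
    have o': "a \<in> obj Lin" "b \<in> obj Lin" "d \<in> obj Lin" "\<mu> 0 \<in> obj Lin" "\<nu> 1 \<in> obj Lin"
      "\<gamma>' 0 \<in> obj Lin"
      using o * \<mu>' by (simp_all add: pix_path)
    have sq: "cmp Lin (\<gamma>' 0) a b (mon \<gamma>) (mon \<mu>') = cmp Lin (\<gamma>' 0) (\<mu> 0) b (mon \<mu>) (mon \<gamma>')"
      using \<gamma> \<mu>' * mon_eq[OF \<mu>'(6)] by (simp only: cmp_mon pix_path)
    let ?h = "cmp Lin (\<mu> 0) b d f (mon \<mu>)"
    have h: "?h \<in> Hom Lin (\<mu> 0) d"
      using o' H(3) *(1) by (intro Lin.cmp_closed) auto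
    have "sandwich \<mu>' \<nu> (cmp Lin a b d f (mon \<gamma>)) =
        cmp Lin (\<gamma>' 0) d (\<nu> 1) (mon \<nu>) (cmp Lin (\<gamma>' 0) b d f (cmp Lin (\<gamma>' 0) a b (mon \<gamma>) (mon \<mu>')))"
      using *(5) \<mu>'(5) \<gamma>(2) ends Lin.cmp_assoc[OF o'(6,1,2,3) H(2,1) *(1)] by
        (simp only: sandwich_def)
    also have "\<dots> = cmp Lin (\<gamma>' 0) d (\<nu> 1) (mon \<nu>) (cmp Lin (\<gamma>' 0) (\<mu> 0) d ?h (mon \<gamma>'))"
      using Lin.cmp_assoc[OF o'(6,4,2,3) H(4,3) *(1)] sq by (simp only:)
    also have "\<dots> = cmp Lin (\<gamma>' 0) (\<mu> 0) (\<nu> 1) (sandwich \<mu> \<nu> f) (mon \<gamma>')"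
      using Lin.cmp_assoc[OF o'(6,4,3,5) H(4) h H(5)] *(4,5) by (simp only: sandwich_def)
    also have "\<dots> \<in> I (Some (\<gamma>' 0)) (Some (\<nu> 1))"
      using ideal_cmp_right[OF I_ideal, of "Some (\<gamma>' 0)" "Some (\<mu> 0)" "Some (\<nu> 1)" "mon \<gamma>'"
        "sandwich \<mu> \<nu> f"]
        o' *(6) H(4) by (simp del: linearization_simps(2))
    finally show ?thesis
      using * \<mu>' \<gamma> ends Lin.cmp_closed[OF o'(1-3) H(1) *(1)]
      by (intro absorbedI[of _ _ _ \<mu>' \<nu>]) (simp_all add: pix_def del: linearization_simps)
  qed
  have single: "cmp Lin a b d f (Poly_Mapping.single e c) \<in> absorbed a d" if "e \<in> Hom C a b" for e c
    using that mon by (auto simp only: path_cat_simps Lin_cmp_mon_scale(2)[where c = c] intro!: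
      absorbed_scale)
  have "Poly_Mapping.keys g \<subseteq> Hom C a b"
    using g by simp
  then show ?thesis
    by (induction g rule: pm_induct)
      (use o in \<open>simp_all add: absorbed_zero cmp_linearization_add absorbed_add single
        del: path_cat_simps\<close>)
qed

end

context path_triple
begin

lemma keys_smon_sum:
  fixes n :: nat
  assumes "\<And>i. i < n \<Longrightarrow> \<gamma> i \<in> \<Gamma> \<and> \<gamma> i 0 = a \<and> \<gamma> i 1 = b"
  shows "Poly_Mapping.keys (\<Sum>i<n. smon R (c i) (\<gamma> i)) \<subseteq> Hom C a b"
  using assms
proof (induction n)
  case (Suc n)
  have "Poly_Mapping.keys (smon R (c n) (\<gamma> n)) \<subseteq> Hom C a b"
    using Suc.prems[of n] by auto
  then show ?case
    using Suc by (simp add: keys_add_subset del: path_cat_simps keys_single)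
qed simp

end

section \<open>Pixel equivalence: the generators of the pixel ideal are absorbed\<close>

context screened_ideal
begin

text \<open>Turns the equivalence of concatenations into an equality of sandwiches, which extends
  linearly to sums. The outer endpoints agree because equivalent paths have equal endpoints.\<close>

lemma path_pixel_equivE:
  assumes "path_pixel_equiv \<Gamma> R P \<gamma> \<gamma>'"
  obtains \<rho>1 \<rho>2 \<rho>3 \<rho>4 where "\<gamma> \<in> \<Gamma>" "\<gamma>' \<in> \<Gamma>" "pix \<rho>1" "pix \<rho>2" "pix \<rho>3" "pix \<rho>4"
    "\<rho>1 1 = \<gamma> 0" "\<rho>2 1 = \<gamma>' 0" "\<rho>1 0 = \<rho>2 0" "\<rho>3 0 = \<gamma> 1" "\<rho>4 0 = \<gamma>' 1" "\<rho>3 1 = \<rho>4 1"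
    "sandwich \<rho>1 \<rho>3 (mon \<gamma>) = sandwich \<rho>2 \<rho>4 (mon \<gamma>')"
proof -
  obtain \<rho>1 \<rho>2 \<rho>3 \<rho>4 where \<rho>: "\<gamma> \<in> \<Gamma>" "\<gamma>' \<in> \<Gamma>" "\<rho>1 \<in> \<Gamma>" "\<rho>2 \<in> \<Gamma>" "\<rho>3 \<in> \<Gamma>" "\<rho>4 \<in> \<Gamma>"
    "\<exists>Y\<in>P. im \<rho>1 \<union> im \<rho>2 \<subseteq> Y" "\<exists>Y\<in>P. im \<rho>3 \<union> im \<rho>4 \<subseteq> Y"
    "\<rho>1 1 = \<gamma> 0" "\<gamma> 1 = \<rho>3 0" "\<rho>2 1 = \<gamma>' 0" "\<gamma>' 1 = \<rho>4 0"
    and R: "(\<rho>1 \<cdot> \<gamma> \<cdot> \<rho>3, \<rho>2 \<cdot> \<gamma>' \<cdot> \<rho>4) \<in> R"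
    using assms unfolding path_pixel_equiv_def by blast
  have "pix \<rho>1" "pix \<rho>2" "pix \<rho>3" "pix \<rho>4"
    using \<rho> by (auto simp: pix_def in_pixel_def)
  moreover have "\<rho>1 0 = \<rho>2 0" "\<rho>3 1 = \<rho>4 1"
    using endpoints[OF R] by simp_all
  moreover have "sandwich \<rho>1 \<rho>3 (mon \<gamma>) = sandwich \<rho>2 \<rho>4 (mon \<gamma>')"
    using \<rho> mon_eq[OF R] by (simp only: sandwich_mon)
  ultimately show thesis
    using \<rho> by (intro that[of \<rho>1 \<rho>2 \<rho>3 \<rho>4]) auto
qed

text \<open>
  The paths witnessing pixel equivalence depend on the summand; by the Ore conditions finitely many
  of them have a common extension, and parallel paths in a pixel are equivalent.
\<close>

lemma common_witnesses:
  fixes n :: nat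
  assumes "\<And>i. i \<le> n \<Longrightarrow> \<gamma> i 0 = a \<and> \<gamma> i 1 = b \<and> \<gamma>' i 0 = a' \<and> \<gamma>' i 1 = b' \<and>
      path_pixel_equiv \<Gamma> R P (\<gamma> i) (\<gamma>' i)"
  shows "\<exists>\<mu> \<mu>' \<nu> \<nu>'. pix \<mu> \<and> pix \<mu>' \<and> pix \<nu> \<and> pix \<nu>' \<and> \<mu> 1 = a \<and> \<mu>' 1 = a' \<and> \<mu> 0 = \<mu>' 0 \<and>
      \<nu> 0 = b \<and> \<nu>' 0 = b' \<and> \<nu> 1 = \<nu>' 1 \<and>
      (\<forall>i\<le>n. sandwich \<mu> \<nu> (mon (\<gamma> i)) = sandwich \<mu>' \<nu>' (mon (\<gamma>' i)))"
  using assms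
proof (induction n)
  case 0
  have "path_pixel_equiv \<Gamma> R P (\<gamma> 0) (\<gamma>' 0)"
    using 0 by simp
  then obtain \<rho>1 \<rho>2 \<rho>3 \<rho>4 where *: "pix \<rho>1" "pix \<rho>2" "pix \<rho>3" "pix \<rho>4"
    "\<rho>1 1 = \<gamma> 0 0" "\<rho>2 1 = \<gamma>' 0 0" "\<rho>1 0 = \<rho>2 0" "\<rho>3 0 = \<gamma> 0 1" "\<rho>4 0 = \<gamma>' 0 1" "\<rho>3 1 = \<rho>4 1"
    "sandwich \<rho>1 \<rho>3 (mon (\<gamma> 0)) = sandwich \<rho>2 \<rho>4 (mon (\<gamma>' 0))"
    by (rule path_pixel_equivE)
  show ?case
    by (rule exI[of _ \<rho>1], rule exI[of _ \<rho>2], rule exI[of _ \<rho>3], rule exI[of _ \<rho>4])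
      (use * 0[of 0] in auto)
next
  case (Suc n)
  obtain \<mu> \<mu>' \<nu> \<nu>' where \<mu>: "pix \<mu>" "pix \<mu>'" "pix \<nu>" "pix \<nu>'" "\<mu> 1 = a" "\<mu>' 1 = a'" "\<mu> 0 = \<mu>' 0"
    "\<nu> 0 = b" "\<nu>' 0 = b'" "\<nu> 1 = \<nu>' 1"
    and IH: "\<And>i. i \<le> n \<Longrightarrow> sandwich \<mu> \<nu> (mon (\<gamma> i)) = sandwich \<mu>' \<nu>' (mon (\<gamma>' i))"
    using Suc by (metis le_SucI)
  let ?g = "\<gamma> (Suc n)" and ?g' = "\<gamma>' (Suc n)"
  have "path_pixel_equiv \<Gamma> R P ?g ?g'" and g: "?g 0 = a" "?g 1 = b" "?g' 0 = a'" "?g' 1 = b'"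
    using Suc.prems by simp_all
  then obtain \<rho>1 \<rho>2 \<rho>3 \<rho>4 where \<rho>: "pix \<rho>1" "pix \<rho>2" "pix \<rho>3" "pix \<rho>4"
    "\<rho>1 1 = a" "\<rho>2 1 = a'" "\<rho>1 0 = \<rho>2 0" "\<rho>3 0 = b" "\<rho>4 0 = b'" "\<rho>3 1 = \<rho>4 1"
    and sw: "sandwich \<rho>1 \<rho>3 (mon ?g) = sandwich \<rho>2 \<rho>4 (mon ?g')"
    by (auto elim: path_pixel_equivE)
  \<comment> \<open>Both \<open>\<mu>\<close> and \<open>\<rho>1\<close> end at \<open>a\<close>.
    The same \<open>u\<close> and \<open>v\<close> also prolong \<open>\<mu>'\<close> and
    \<open>\<rho>2\<close>, since these start where \<open>\<mu>\<close> and \<open>\<rho>1\<close>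
    do.\<close>
  obtain u v where u: "pix u" "pix v" "u 1 = \<mu> 0" "v 1 = \<rho>1 0" "u 0 = v 0"
    using pix_ore_left[OF \<mu>(1) \<rho>(1)] \<mu>(5) \<rho>(5) by metis
  obtain w z where w: "pix w" "pix z" "\<nu> 1 = w 0" "\<rho>3 1 = z 0" "w 1 = z 1"
    using pix_ore_right[OF \<mu>(3) \<rho>(3)] \<mu>(8) \<rho>(8) by metis
  note paths = \<mu>(1-4)[THEN pix_path] \<rho>(1-4)[THEN pix_path] u(1,2)[THEN pix_path] w(1,2)[THEN
    pix_path]
  have pix: "pix (u \<cdot> \<mu>)" "pix (u \<cdot> \<mu>')" "pix (\<nu> \<cdot> w)" "pix (\<nu>' \<cdot> w)"
      "pix (v \<cdot> \<rho>1)" "pix (v \<cdot> \<rho>2)" "pix (\<rho>3 \<cdot> z)" "pix (\<rho>4 \<cdot> z)"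
    using \<mu> \<rho> u w by (simp_all add: pix_concat)
  have H: "mon (\<gamma> i) \<in> Hom Lin a b" "mon (\<gamma>' i) \<in> Hom Lin a' b'" if "i \<le> Suc n" for i
    using Suc.prems[OF that] by (auto simp: path_pixel_equiv_def intro!: mon_Hom simp del:
      linearization_simps)
  have step: "sandwich (u \<cdot> \<mu>) (\<nu> \<cdot> w) (mon (\<gamma> i)) = sandwich (u \<cdot> \<mu>') (\<nu>' \<cdot> w) (mon (\<gamma>' i))"
    if "i \<le> Suc n" for i
  proof (cases "i = Suc n")
    case False
    then show ?thesis
      using IH[of i] H[of i] \<mu> u w paths that by
        (simp add: sandwich_concat del: linearization_simps)
  next
    case True
    \<comment> \<open>For the new summand the old witnesses are exchanged for its own, the equality
      \<open>sw\<close> is applied between them, and the exchange is undone on the primed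
      side.\<close>
    have "sandwich (u \<cdot> \<mu>) (\<nu> \<cdot> w) (mon ?g) = sandwich (v \<cdot> \<rho>1) (\<rho>3 \<cdot> z) (mon ?g)"
      using \<mu> \<rho> u w pix by (intro sandwich_cong pix_parallel) simp_all
    also have "\<dots> = sandwich (v \<cdot> \<rho>2) (\<rho>4 \<cdot> z) (mon ?g')"
      using sw H[of "Suc n"] \<rho> u w paths by (simp add: sandwich_concat del: linearization_simps)
    also have "\<dots> = sandwich (u \<cdot> \<mu>') (\<nu>' \<cdot> w) (mon ?g')"
      using \<mu> \<rho> u w pix by (intro sandwich_cong pix_parallel) simp_all
    finally show ?thesis
      using True by simp
  qed
  show ?case
    by (rule exI[of _ "u \<cdot> \<mu>"], rule exI[of _ "u \<cdot> \<mu>'"], rule exI[of _ "\<nu> \<cdot> w"], rule exI[of _ "\<nu>'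
      \<cdot> w"])
      (use \<mu> pix step in auto)
qed

lemma sandwich_smon: "sandwich \<mu> \<nu> (smon R c \<gamma>) = pm_scale c (sandwich \<mu> \<nu> (mon \<gamma>))"
proof -
  have "smon R c \<gamma> = pm_scale c (mon \<gamma>)"
    by simp
  then show ?thesis
    by (simp only: sandwich_linear)
qed

lemma sandwich_sum_eq:
  fixes n :: nat
  assumes "\<And>i. i < n \<Longrightarrow> sandwich \<mu> \<nu> (mon (\<gamma> i)) = sandwich \<mu>' \<nu>' (mon (\<gamma>' i))"
  shows "sandwich \<mu> \<nu> (\<Sum>i<n. smon R (c i) (\<gamma> i)) = sandwich \<mu>' \<nu>' (\<Sum>i<n. smon R (c i) (\<gamma>' i))"
  using assms
proof (induction n)
  case (Suc n)
  have "sandwich \<mu> \<nu> (smon R (c n) (\<gamma> n)) = sandwich \<mu>' \<nu>' (smon R (c n) (\<gamma>' n))"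
    using Suc.prems[of n] by (simp only: sandwich_smon[where c = "c n"] lessI)
  then show ?case
    using Suc by simp
qed simp

text \<open>Common witnesses identify a sandwich of \<open>f\<close> with a sandwich of
  \<open>g\<close>, and the latter lies in \<open>I\<close> because \<open>g\<close> does.\<close>

lemma pixel_equiv_absorbed:
  assumes o: "a \<in> X" "b \<in> X" "a' \<in> X" "b' \<in> X" and g: "g \<in> I (Some a') (Some b')"
    and "pixel_equiv \<Gamma> R P a b a' b' f g"
  shows "f \<in> absorbed a b"
proof -
  obtain n :: nat and c \<gamma> \<gamma>' where f: "f = (\<Sum>i<n. smon R (c i) (\<gamma> i))" and g': "g
    = (\<Sum>i<n. smon R (c i) (\<gamma>' i))"
    and \<gamma>: "\<And>i. i < n \<Longrightarrow> \<gamma> i 0 = a \<and> \<gamma> i 1 = b \<and> \<gamma>' i 0 = a' \<and> \<gamma>' i 1 = b' \<and>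
        path_pixel_equiv \<Gamma> R P (\<gamma> i) (\<gamma>' i)"
    using assms(6) unfolding pixel_equiv_def by blast
  show ?thesis
  proof (cases n)
    \<comment> \<open>With no summands nothing places \<open>a\<close> and \<open>a'\<close> in the
      same pixel, so witnesses with a common start may fail to exist; but then \<open>f\<close> is
      zero.\<close>
    case 0
    then show ?thesis
      using o f by (simp add: absorbed_zero)
  next
    case (Suc k)
    have "\<exists>\<mu> \<mu>' \<nu> \<nu>'. pix \<mu> \<and> pix \<mu>' \<and> pix \<nu> \<and> pix \<nu>' \<and> \<mu> 1 = a \<and> \<mu>' 1 = a' \<and> \<mu> 0 = \<mu>' 0 \<and>
      \<nu> 0 = b \<and> \<nu>' 0 = b' \<and> \<nu> 1 = \<nu>' 1 \<and>
      (\<forall>i\<le>k. sandwich \<mu> \<nu> (mon (\<gamma> i)) = sandwich \<mu>' \<nu>' (mon (\<gamma>' i)))"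
      by (rule common_witnesses) (use \<gamma> Suc in auto)
    then obtain \<mu> \<mu>' \<nu> \<nu>' where \<mu>: "pix \<mu>" "pix \<mu>'" "pix \<nu>" "pix \<nu>'" "\<mu> 1 = a" "\<mu>' 1 = a'" "\<mu> 0
      = \<mu>' 0"
      "\<nu> 0 = b" "\<nu>' 0 = b'" "\<nu> 1 = \<nu>' 1"
      and sw: "\<And>i. i \<le> k \<Longrightarrow> sandwich \<mu> \<nu> (mon (\<gamma> i)) = sandwich \<mu>' \<nu>' (mon (\<gamma>' i))"
      by blast
    have "sandwich \<mu> \<nu> f = sandwich \<mu>' \<nu>' g"
      unfolding f g' by (rule sandwich_sum_eq) (use sw Suc in auto)
    then have "sandwich \<mu> \<nu> f \<in> I (Some (\<mu> 0)) (Some (\<nu> 1))"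
      using sandwich_ideal[of \<mu>' \<nu>' g] \<mu> g by (simp add: pix_path)
    moreover have "f \<in> Hom Lin a b"
      using keys_smon_sum[of n \<gamma> a b c] \<gamma> by (simp add: f path_pixel_equiv_def del: path_cat_simps)
    ultimately show ?thesis
      using \<mu> by (intro absorbedI[of f a b \<mu> \<nu>])
  qed
qed

section \<open>The pixel ideal and its quotient\<close>

abbreviation "J \<equiv> pixel_ideal X \<Gamma> R P I"

definition absorbed_ideal where
  "absorbed_ideal x y = (case (x, y) of (Some a, Some b) \<Rightarrow> absorbed a b | _ \<Rightarrow> {0})"

lemma absorbed_ideal_simps [simp]:
  "absorbed_ideal (Some a) (Some b) = absorbed a b"
  "absorbed_ideal None y = {0}" "absorbed_ideal x None = {0}"
  by (simp_all add: absorbed_ideal_def split: option.split)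

lemma absorbed_Hom: "f \<in> absorbed a b \<Longrightarrow> f \<in> Hom Lin a b"
  by (erule absorbedE)

lemma absorbed_ideal_ideal: "is_ideal LC absorbed_ideal"
proof (rule is_idealI)
  fix x y f assume "f \<in> absorbed_ideal x y"
  then show "f \<in> Hom LC x y"
    by (cases x; cases y) (simp_all add: absorbed_Hom del: linearization_simps)
next
  fix x y assume "x \<in> obj LC" "y \<in> obj LC"
  then show "hzero LC x y \<in> absorbed_ideal x y"
    by (cases x; cases y) (auto simp: absorbed_zero)
next
  fix x y f g assume "f \<in> absorbed_ideal x y" "g \<in> absorbed_ideal x y"
  then show "hadd LC x y f g \<in> absorbed_ideal x y"
    by (cases x; cases y) (simp_all add: absorbed_add)
next
  fix x y f a assume "f \<in> absorbed_ideal x y"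
  then show "hscale LC x y a f \<in> absorbed_ideal x y"
    by (cases x; cases y) (simp_all add: absorbed_scale)
next
  fix x y z f g
  assume "x \<in> obj LC" "y \<in> obj LC" "z \<in> obj LC" "f \<in> absorbed_ideal x y" "g \<in> Hom LC y z"
  then show "cmp LC x y z g f \<in> absorbed_ideal x z"
    by (cases x; cases y; cases z)
      (simp_all add: absorbed_cmp_left absorbed_zero image_iff del: linearization_simps(2))
next
  fix x y z f g
  assume "x \<in> obj LC" "y \<in> obj LC" "z \<in> obj LC" "f \<in> Hom LC x y" "g \<in> absorbed_ideal y z"
  then show "cmp LC x y z g f \<in> absorbed_ideal x z"
    by (cases x; cases y; cases z)
      (simp_all add: absorbed_cmp_right absorbed_zero image_iff del: linearization_simps(2))
qed

lemma pixel_generators_absorbed: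
  "{f. \<exists>a\<in>X. \<exists>b\<in>X. \<exists>a'\<in>X. \<exists>b'\<in>X. x = Some a \<and> y = Some b \<and>
      (\<exists>g\<in>I (Some a') (Some b'). pixel_equiv \<Gamma> R P a b a' b' f g)} \<subseteq> absorbed_ideal x y"
  by (clarify, simp only: absorbed_ideal_simps, rule pixel_equiv_absorbed)

lemma pixel_ideal_ideal: "is_ideal LC J"
  unfolding pixel_ideal_def
proof (rule ideal_gen_ideal[OF LC.linear_category_axioms])
  fix u v assume "u \<in> obj LC" "v \<in> obj LC"
  then show "{f. \<exists>a\<in>X. \<exists>b\<in>X. \<exists>a'\<in>X. \<exists>b'\<in>X. u = Some a \<and> v = Some b \<and>
      (\<exists>g\<in>I (Some a') (Some b'). pixel_equiv \<Gamma> R P a b a' b' f g)} \<subseteq> Hom LC u v"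
    using ideal_Hom[OF absorbed_ideal_ideal, of u v]
      by (intro subset_trans[OF pixel_generators_absorbed] subsetI)
qed

text \<open>Minimality of the generated ideal: \<open>absorbed_ideal\<close> is an ideal containing
  all generators.\<close>

lemma pixel_ideal_absorbed:
  assumes "f \<in> J (Some a) (Some b)"
  shows "f \<in> absorbed a b"
proof -
  have "J (Some a) (Some b) \<subseteq> absorbed_ideal (Some a) (Some b)"
    unfolding pixel_ideal_def
    by (rule ideal_gen_least[OF absorbed_ideal_ideal pixel_generators_absorbed])
  then show ?thesis
    using assms by (simp only: absorbed_ideal_simps) (rule subsetD)
qed

lemma path_pixel_equiv_refl:
  assumes "\<gamma> \<in> \<Gamma>"
  shows "path_pixel_equiv \<Gamma> R P \<gamma> \<gamma>"
proof -
  have c: "const_path (\<gamma> 0) \<in> \<Gamma>" "const_path (\<gamma> 1) \<in> \<Gamma>"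
    using assms by (simp_all add: const_closed)
  then have R: "(const_path (\<gamma> 0) \<cdot> \<gamma> \<cdot> const_path (\<gamma> 1), const_path (\<gamma> 0) \<cdot> \<gamma> \<cdot> const_path (\<gamma> 1))
    \<in> R"
    using assms by (intro R_refl concat_closed) simp_all
  show ?thesis
    unfolding path_pixel_equiv_def
    by (rule conjI[OF assms conjI[OF assms]], rule bexI[of _ "const_path (\<gamma> 0)"],
        rule bexI[of _ "const_path (\<gamma> 0)"], rule bexI[of _ "const_path (\<gamma> 1)"],
        rule bexI[of _ "const_path (\<gamma> 1)"])
      (use R c assms ex_pixel[of "\<gamma> 0"] ex_pixel[of "\<gamma> 1"] in simp_all)
qed

text \<open>Pixel equivalence refers to presentations as finite lists of scaled paths; one is
  obtained by enumerating the support of \<open>f\<close> and picking a path in each class.\<close>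

lemma pixel_equiv_refl:
  assumes f: "f \<in> Hom Lin a b"
  shows "pixel_equiv \<Gamma> R P a b a b f f"
proof -
  obtain h :: "nat \<Rightarrow> 'x pth set" where h: "bij_betw h {..<card (Poly_Mapping.keys f)}
    (Poly_Mapping.keys f)"
    using ex_bij_betw_nat_finite[of "Poly_Mapping.keys f"] by (auto simp: lessThan_atLeast0)
  let ?n = "card (Poly_Mapping.keys f)"
  have "\<exists>\<gamma>. h i = path_class R \<gamma> \<and> \<gamma> \<in> \<Gamma> \<and> \<gamma> 0 = a \<and> \<gamma> 1 = b" if "i < ?n" for i
    using bij_betwE[OF h] that f by auto
  then obtain \<gamma> where \<gamma>: "\<And>i. i < ?n \<Longrightarrow> h i = path_class R (\<gamma> i) \<and> \<gamma> i \<in> \<Gamma> \<and> \<gamma> i 0 = a \<and> \<gamma> i 1 = b"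
    by metis
  have "f = (\<Sum>k\<in>Poly_Mapping.keys f. Poly_Mapping.single k (Poly_Mapping.lookup f k))"
    by (rule poly_mapping_sum_single)
  also have "\<dots> = (\<Sum>i<?n. Poly_Mapping.single (h i) (Poly_Mapping.lookup f (h i)))"
    by (rule sum.reindex_bij_betw[OF h, symmetric])
  also have "\<dots> = (\<Sum>i<?n. smon R (Poly_Mapping.lookup f (h i)) (\<gamma> i))"
    using \<gamma> by (intro sum.cong) auto
  finally show ?thesis
    unfolding pixel_equiv_def using \<gamma> path_pixel_equiv_refl
    by (intro exI[of _ ?n] exI[of _ "\<lambda>i. Poly_Mapping.lookup f (h i)"] exI[of _ \<gamma>]) simp
qed

text \<open>Ensures that \<open>quotient_func\<close> has the expected value on a coset of
  \<open>I\<close>: its representatives differ by elements of \<open>I\<close>, hence of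
  \<open>J\<close>.\<close>

lemma I_subset_pixel_ideal:
  assumes "x \<in> obj LC" "y \<in> obj LC" and f: "f \<in> I x y"
  shows "f \<in> J x y"
proof (cases "x = None \<or> y = None")
  case True
  then have "f = hzero LC x y"
    using ideal_Hom[OF I_ideal assms] by auto
  then show ?thesis
    using ideal_hzero[OF pixel_ideal_ideal assms(1,2)] by simp
next
  case False
  then obtain a b where ab: "x = Some a" "y = Some b" "a \<in> X" "b \<in> X"
    using assms by auto
  then have pe: "pixel_equiv \<Gamma> R P a b a b f f"
    using ideal_Hom[OF I_ideal assms] by (intro pixel_equiv_refl) simp
  show ?thesis
    unfolding pixel_ideal_def
    by (rule subsetD[OF ideal_gen_incl[OF assms(1,2)]]) (use ab f pe in blast)
qed

sublocale JQ: ideal_quotient LC J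
  by unfold_locales (rule pixel_ideal_ideal)

sublocale Loc: linear_loc "alg_bar X \<Gamma> R P I" "Sigma_A X \<Gamma> R P I"
  by (intro linear_loc.intro JQ.linear_category_quotient)

lemma quotient_func_coset:
  assumes "x \<in> obj LC" "y \<in> obj LC" "f \<in> Hom LC x y"
  shows "farr (quotient_func LC J) x y (QI.q x y f) = JQ.q x y f"
  unfolding quotient_func_def func.simps
proof (rule UN_eq_const[OF QI.coset_self[OF assms]])
  fix g assume "g \<in> QI.q x y f"
  then obtain i where "i \<in> I x y" "g = hadd LC x y f i"
    by (auto simp: coset_def)
  then show "JQ.q x y g = JQ.q x y f"
    using assms I_subset_pixel_ideal by (simp only: JQ.coset_add)
qed

lemma pi_func_coset:
  assumes "x \<in> obj LC" "y \<in> obj LC" "f \<in> Hom LC x y"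
  shows "farr (pi_func X \<Gamma> R P I) x y (QI.q x y f) =
    farr (lin_loc_func (alg_bar X \<Gamma> R P I) (Sigma_A X \<Gamma> R P I)) x y (JQ.q x y f)"
proof -
  have "fobj (quotient_func LC J) = (\<lambda>x. x)"
    by (simp add: quotient_func_def)
  then show ?thesis
    using quotient_func_coset[OF assms] by (simp add: pi_func_def func_comp_def)
qed

lemma fobj_pi_func: "fobj (pi_func X \<Gamma> R P I) x = x"
  by (simp add: pi_func_def func_comp_def quotient_func_def lin_loc_func_def)

lemma pre_dead_iff:
  "pre_dead X \<Gamma> R I Y \<longleftrightarrow> (\<exists>\<rho>\<in>\<Gamma>. im \<rho> \<subseteq> Y \<and> mon \<rho> \<in> I (Some (\<rho> 0)) (Some (\<rho> 1)))"
proof -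
  have "quot_path X \<Gamma> R I 1 \<rho> = hzero (alg_cat X \<Gamma> R I) (Some (\<rho> 0)) (Some (\<rho> 1)) \<longleftrightarrow>
      mon \<rho> \<in> I (Some (\<rho> 0)) (Some (\<rho> 1))" if "\<rho> \<in> \<Gamma>" for \<rho>
    using QI.coset_eq_hzero_iff[of "Some (\<rho> 0)" "Some (\<rho> 1)" "mon \<rho>"] that mon_Hom[OF that refl
      refl]
    by (simp add: quot_path_def del: linearization_simps)
  then show ?thesis
    by (auto simp: pre_dead_def)
qed

lemma quot_path_J_eq_hzero_iff:
  "\<rho> \<in> \<Gamma> \<Longrightarrow> quot_path X \<Gamma> R J 1 \<rho> = hzero (alg_bar X \<Gamma> R P I) (Some (\<rho> 0)) (Some (\<rho> 1)) \<longleftrightarrow>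
    mon \<rho> \<in> J (Some (\<rho> 0)) (Some (\<rho> 1))"
  using JQ.coset_eq_hzero_iff[of "Some (\<rho> 0)" "Some (\<rho> 1)" "mon \<rho>"] mon_Hom[of \<rho> "\<rho> 0" "\<rho> 1" 1]
  by (simp add: quot_path_def del: linearization_simps)

text \<open>The hypothesis concerns \<open>J\<close>, whereas \<open>pre_dead\<close> asks for a
  path vanishing modulo \<open>I\<close>. The witnesses of absorption meet \<open>\<rho>\<close> at
  its ends, so the concatenation stays in the pixel \<open>Y\<close> and is such a path.\<close>

lemma pre_deadI:
  assumes "pix \<rho>" "mon \<rho> \<in> J (Some (\<rho> 0)) (Some (\<rho> 1))" "Y \<in> P" "im \<rho> \<subseteq> Y"
  shows "pre_dead X \<Gamma> R I Y"
proof -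
  obtain \<mu> \<nu> where *: "pix \<mu>" "pix \<nu>" "\<mu> 1 = \<rho> 0" "\<nu> 0 = \<rho> 1"
    "sandwich \<mu> \<nu> (mon \<rho>) \<in> I (Some (\<mu> 0)) (Some (\<nu> 1))"
    using pixel_ideal_absorbed[OF assms(2)] by (auto elim: absorbedE)
  then have "mon (\<mu> \<cdot> \<rho> \<cdot> \<nu>) \<in> I (Some ((\<mu> \<cdot> \<rho> \<cdot> \<nu>) 0)) (Some ((\<mu> \<cdot> \<rho> \<cdot> \<nu>) 1))"
    using assms(1) by (simp add: sandwich_mon pix_path)
  moreover have "pix (\<mu> \<cdot> \<rho> \<cdot> \<nu>)"
    using * assms(1) by (simp add: pix_concat)
  moreover from this have "im (\<mu> \<cdot> \<rho> \<cdot> \<nu>) \<subseteq> Y"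
    using assms(3,4) * im_endpoints[of \<rho>] by (intro pix_subset) (auto simp: im_path_concat)
  ultimately show ?thesis
    unfolding pre_dead_iff by (auto simp: pix_path)
qed

section \<open>Pixelated representations vanish on the pixel ideal and extend to the
  pixelation\<close>

lemma representation_kernel:
  assumes K: "linear_category K" and M: "linear_functor (alg_cat X \<Gamma> R I) K M"
    and pixelates: "pixelates_A X \<Gamma> R P I K M"
    and o: "x \<in> obj LC" "y \<in> obj LC" and f: "f \<in> J x y"
  shows "farr M x y (QI.q x y f) = hzero K (fobj M x) (fobj M y)"
proof -
  interpret K: linear_category K by fact
  define N where "N = M \<circ>\<^sub>F QI.coset_func"
  have N: "linear_functor LC K N"
    unfolding N_def by (rule linear_functor_comp[OF QI.linear_functor_coset M])
  have N_simps: "fobj N = fobj M" "\<And>x y f. farr N x y f = farr M x y (QI.q x y f)"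
    by (simp_all add: N_def func_comp_def QI.coset_func_def)
  note N' = is_functorD[OF linear_functor_functor[OF N], unfolded N_simps(1)]
  have f_Hom: "f \<in> Hom LC x y"
    by (rule ideal_Hom[OF pixel_ideal_ideal o f])
  \<comment> \<open>In the adjoined zero object the identity is the zero element, and
    \<open>N\<close> preserves both.\<close>
  have None: "idm K (fobj M None) = hzero K (fobj M None) (fobj M None)"
    using N'(3)[of None] functor_hzero[OF LC.linear_category_axioms K N, of None None]
    by (simp add: N_simps lin_path_cat_def)
  \<comment> \<open>The pixel of \<open>\<rho>\<close> is pre-dead, so \<open>M\<close> inverts the
    zero endomorphism of \<open>a\<close>.\<close>
  have dead: "idm K (fobj M (Some a)) = hzero K (fobj M (Some a)) (fobj M (Some a))"
    if *: "pix \<rho>" "mon \<rho> \<in> J (Some (\<rho> 0)) (Some (\<rho> 1))" "a \<in> im \<rho>" for \<rho> a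
  proof -
    obtain Y where Y: "Y \<in> P" "im \<rho> \<subseteq> Y"
      using *(1) by (auto simp: pix_def in_pixel_def)
    then have "is_iso K (fobj M (Some a)) (fobj M (Some a))
        (farr M (Some a) (Some a) (hzero (alg_cat X \<Gamma> R I) (Some a) (Some a)))"
      using pixelates pre_deadI[OF *(1,2) Y] *(3) by (auto simp: pixelates_A_def)
    moreover have "Some a \<in> obj LC"
      using pixel_subset[OF Y(1)] Y *(3) by auto
    ultimately show ?thesis
      using functor_hzero[OF QI.linear_category_quotient K M, of "Some a"
        "Some a"] N'(1)[of "Some a"]
        K.iso_hzero[of "fobj M (Some a)" "fobj M (Some a)"] by simp
  qed
  have iso: "is_iso K (fobj M (Some (\<rho> 0))) (fobj M (Some (\<rho> 1))) (farr N (Some (\<rho> 0)) (Some (\<rho> 1))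
    (mon \<rho>))"
    if "pix \<rho>" "mon \<rho> \<notin> J (Some (\<rho> 0)) (Some (\<rho> 1))" for \<rho>
  proof -
    have "quot_path X \<Gamma> R J 1 \<rho> \<noteq> hzero (alg_bar X \<Gamma> R P I) (Some (\<rho> 0)) (Some (\<rho> 1))"
      using quot_path_J_eq_hzero_iff[OF pix_path] that by blast
    then have "is_iso K (fobj M (Some (\<rho> 0))) (fobj M (Some (\<rho> 1)))
        (farr M (Some (\<rho> 0)) (Some (\<rho> 1)) (quot_path X \<Gamma> R I 1 \<rho>))"
      using pixelates that(1) unfolding pixelates_A_def pix_def by blast
    then show ?thesis
      by (simp only: N_simps quot_path_def)
  qed
  have trivial: "farr N x y f = hzero K (fobj M x) (fobj M y)"
    if "idm K (fobj M x) = hzero K (fobj M x) (fobj M x) \<or> idm K (fobj M y)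
      = hzero K (fobj M y) (fobj M y)"
    using that N'(1,2) o f_Hom by (intro K.Hom_trivial) auto
  have "farr N x y f = hzero K (fobj M x) (fobj M y)"
  proof (cases "x = None \<or> y = None")
    case True
    then show ?thesis
      using None by (intro trivial) auto
  next
    case False
    then obtain a b where [simp]: "x = Some a" "y = Some b" "a \<in> X" "b \<in> X"
      using o by auto
    obtain \<mu> \<nu> where *: "f \<in> Hom Lin a b" "pix \<mu>" "pix \<nu>" "\<mu> 1 = a" "\<nu> 0 = b"
      "sandwich \<mu> \<nu> f \<in> I (Some (\<mu> 0)) (Some (\<nu> 1))"
      using pixel_ideal_absorbed[of f a b] f by (auto elim: absorbedE)
    show ?thesis
    \<comment> \<open>The points \<open>a\<close> and \<open>b\<close> lie on \<open>\<mu>\<close>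
      and \<open>\<nu>\<close>. If one of these paths is in \<open>J\<close>, the corresponding
      point goes to an object with zero identity; otherwise both act as isomorphisms.\<close>
    proof (cases "mon \<mu> \<in> J (Some (\<mu> 0)) (Some (\<mu> 1)) \<or> mon \<nu> \<in> J (Some (\<nu> 0)) (Some (\<nu> 1))")
      case True
      then show ?thesis
        using dead[of \<mu> a] dead[of \<nu> b] * im_endpoints[of \<mu>] im_endpoints[of \<nu>]
          by (intro trivial) auto
    next
      case False
      let ?x = "Some (\<mu> 0)" and ?z = "Some (\<nu> 1)"
      have o': "?x \<in> obj LC" "?z \<in> obj LC" "x \<in> obj LC" "y \<in> obj LC"
        using * o by (simp_all add: pix_path)
      have H: "mon \<mu> \<in> Hom LC ?x x" "mon \<nu> \<in> Hom LC y ?z"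
        using * mon_Hom[of \<mu> "\<mu> 0" a 1] mon_Hom[of \<nu> b "\<nu> 1" 1] by (simp_all add: pix_path)
      have H2: "cmp LC ?x x y f (mon \<mu>) \<in> Hom LC ?x y"
        by (rule LC.cmp_closed[OF o'(1,3,4) H(1) f_Hom])
      have iso_\<mu>: "is_iso K (fobj M ?x) (fobj M x) (farr N ?x x (mon \<mu>))"
        using iso[of \<mu>] * False by simp
      have iso_\<nu>: "is_iso K (fobj M y) (fobj M ?z) (farr N y ?z (mon \<nu>))"
        using iso[of \<nu>] * False by simp
      have Ko: "fobj M ?x \<in> obj K" "fobj M ?z \<in> obj K" "fobj M x \<in> obj K" "fobj M y \<in> obj K"
        using o' N'(1) by auto
      have KH: "farr N x y f \<in> Hom K (fobj M x) (fobj M y)"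
        "farr N ?x x (mon \<mu>) \<in> Hom K (fobj M ?x) (fobj M x)"
        "farr N y ?z (mon \<nu>) \<in> Hom K (fobj M y) (fobj M ?z)"
        using o' H f_Hom N'(2) by blast+
      \<comment> \<open>Elements of \<open>I\<close> represent the zero coset, which
        \<open>M\<close> sends to zero.\<close>
      have "farr N ?x ?z (sandwich \<mu> \<nu> f) = hzero K (fobj M ?x) (fobj M ?z)"
      proof -
        have "QI.q ?x ?z (sandwich \<mu> \<nu> f) = QI.q ?x ?z (hzero LC ?x ?z)"
          using QI.coset_eq_hzero_iff[OF o'(1,2), of
            "sandwich \<mu> \<nu> f"] *(6) ideal_Hom[OF I_ideal o'(1,2) *(6)]
          by blast
        then have "farr N ?x ?z (sandwich \<mu> \<nu> f) = farr N ?x ?z (hzero LC ?x ?z)"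
          by (simp only: N_simps)
        also have "\<dots> = hzero K (fobj M ?x) (fobj M ?z)"
          using functor_hzero[OF LC.linear_category_axioms K N o'(1,2)] by (simp only: N_simps(1))
        finally show ?thesis .
      qed
      moreover have "sandwich \<mu> \<nu> f = cmp LC ?x y ?z (mon \<nu>) (cmp LC ?x x y f (mon \<mu>))"
        using * by (simp add: sandwich_def)
      ultimately have "cmp K (fobj M ?x) (fobj M y) (fobj M ?z) (farr N y ?z (mon \<nu>))
          (cmp K (fobj M ?x) (fobj M x) (fobj M y) (farr N x y f) (farr N ?x x (mon \<mu>))) =
          hzero K (fobj M ?x) (fobj M ?z)"
        using N'(4)[OF o'(1,4,2) H2 H(2)] N'(4)[OF o'(1,3,4) H(1) f_Hom] by simp
      also have "\<dots> = cmp K (fobj M ?x) (fobj M y) (fobj M ?z) (farr N y ?z (mon \<nu>)) (hzero K (fobj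
        M ?x) (fobj M y))"
        using Ko KH by (simp only: K.cmp_hzero_right)
      finally have "cmp K (fobj M ?x) (fobj M x) (fobj M y) (farr N x y f) (farr N ?x x (mon \<mu>)) =
          hzero K (fobj M ?x) (fobj M y)"
        by (rule K.iso_cancel_left[OF Ko(1,4,2) iso_\<nu> K.cmp_closed[OF Ko(1,3,4) KH(2,1)]
          K.hzero_closed[OF Ko(1,4)]])
      also have "\<dots> = cmp K (fobj M ?x) (fobj M x) (fobj M y) (hzero K (fobj M x) (fobj M y)) (farr
        N ?x x (mon \<mu>))"
        using Ko KH by (simp only: K.cmp_hzero_left)
      finally show ?thesis
        by (rule K.iso_cancel_right[OF Ko(1,3,4) iso_\<mu> KH(1) K.hzero_closed[OF Ko(3,4)]])
    qed
  qed
  then show ?thesis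
    by (simp only: N_simps)
qed

text \<open>Two strict factorizations: first through the quotient by \<open>J\<close>, by
  \<open>representation_kernel\<close>, then through the localization, where the two clauses of
  \<open>pixelates_A\<close> match the two kinds of elements of \<open>Sigma_A\<close>.\<close>

lemma representation_extends:
  assumes K: "linear_category K" and M: "linear_functor (alg_cat X \<Gamma> R I) K M"
    and pixelates: "pixelates_A X \<Gamma> R P I K M"
  obtains N where "linear_functor (pixelation_A X \<Gamma> R P I) K N" "fobj N = fobj M"
    "\<And>x y f. \<lbrakk>x \<in> obj LC; y \<in> obj LC; f \<in> Hom (alg_cat X \<Gamma> R I) x y\<rbrakk> \<Longrightarrow>
      farr (pi_func X \<Gamma> R P I) x y f \<in> Hom (pixelation_A X \<Gamma> R P I) x y \<and>
      farr N x y (farr (pi_func X \<Gamma> R P I) x y f) = farr M x y f"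
proof -
  have M0: "linear_functor LC K (M \<circ>\<^sub>F QI.coset_func)"
    by (rule linear_functor_comp[OF QI.linear_functor_coset M])
  have M0_simps: "fobj (M \<circ>\<^sub>F QI.coset_func) = fobj M"
    "farr (M \<circ>\<^sub>F QI.coset_func) x y f = farr M x y (QI.q x y f)" for x y f
    by (simp_all add: func_comp_def QI.coset_func_def)
  obtain N1 where N1: "linear_functor (alg_bar X \<Gamma> R P I) K N1" "fobj N1 = fobj M"
    "\<And>x y f. \<lbrakk>x \<in> obj LC; y \<in> obj LC; f \<in> Hom LC x y\<rbrakk>
      \<Longrightarrow> farr N1 x y (JQ.q x y f) = farr M x y (QI.q x y f)"
  proof (rule JQ.quotient_universal[OF M0 _ K, unfolded M0_simps])
    fix x y f assume "x \<in> obj LC" "y \<in> obj LC" "f \<in> J x y"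
    then show "farr M x y (QI.q x y f) = hzero K (fobj M x) (fobj M y)"
      by (rule representation_kernel[OF assms])
  qed (rule that)
  have inverts: "is_iso K (fobj N1 x) (fobj N1 y) (farr N1 x y s)"
    if o: "x \<in> obj (alg_bar X \<Gamma> R P I)" "y \<in> obj (alg_bar X \<Gamma> R P I)"
      and s: "s \<in> Sigma_A X \<Gamma> R P I x y" for x y s
    using s unfolding Sigma_A_def
  proof (elim UnE)
    assume "s \<in> live_Sigma X \<Gamma> R P I x y"
    then obtain \<rho> where \<rho>: "\<rho> \<in> \<Gamma>" "in_pixel P \<rho>" "x = Some (\<rho> 0)" "y = Some (\<rho> 1)"
      "s = quot_path X \<Gamma> R J 1 \<rho>" "s \<noteq> hzero (alg_bar X \<Gamma> R P I) x y"
      unfolding live_Sigma_def by blast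
    then have "is_iso K (fobj M x) (fobj M y) (farr M x y (quot_path X \<Gamma> R I 1 \<rho>))"
      using pixelates unfolding pixelates_A_def by blast
    moreover have "farr N1 x y s = farr M x y (quot_path X \<Gamma> R I 1 \<rho>)"
      using N1(3)[of x y "mon \<rho>"] o mon_Hom[OF \<rho>(1) refl refl, of 1] \<rho>(3-5)
      by (simp add: quot_path_def del: linearization_simps)
    ultimately show ?thesis
      by (simp add: N1(2))
  next
    assume "s \<in> {f. f = hzero (alg_bar X \<Gamma> R P I) x y \<and>
         (\<exists>Y\<in>P. pre_dead X \<Gamma> R I Y \<and> (\<exists>a\<in>Y. \<exists>b\<in>Y. x = Some a \<and> y = Some b))}"
    then have "is_iso K (fobj M x) (fobj M y) (farr M x y (hzero (alg_cat X \<Gamma> R I) x y))"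
      and s0: "s = hzero (alg_bar X \<Gamma> R P I) x y"
      using pixelates unfolding pixelates_A_def by blast+
    moreover have "farr N1 x y s = farr M x y (hzero (alg_cat X \<Gamma> R I) x y)"
      using N1(3)[of x y "hzero LC x y"] o LC.hzero_closed[of x y] s0 by
        (simp del: linearization_simps LC_simps)
    ultimately show ?thesis
      by (simp add: N1(2))
  qed
  obtain N where N: "linear_functor (pixelation_A X \<Gamma> R P I) K N" "fobj N = fobj N1"
    "\<And>x y f. \<lbrakk>x \<in> obj (alg_bar X \<Gamma> R P I); y \<in> obj (alg_bar X \<Gamma> R P I); f \<in> Hom (alg_bar X \<Gamma> R P I)
      x y\<rbrakk> \<Longrightarrow>
      farr N x y (farr (lin_loc_func (alg_bar X \<Gamma> R P I) (Sigma_A X \<Gamma> R P I)) x y f)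
        = farr N1 x y f"
    using Loc.loc_universal[OF K N1(1) inverts] by blast
  show thesis
  proof (rule that[OF N(1)])
    show "fobj N = fobj M"
      using N(2) N1(2) by simp
    fix x y f assume o: "x \<in> obj LC" "y \<in> obj LC" and f: "f \<in> Hom (alg_cat X \<Gamma> R I) x y"
    then obtain g where g: "g \<in> Hom LC x y" "f = QI.q x y g"
      by (auto simp del: LC_simps)
    have H: "JQ.q x y g \<in> Hom (alg_bar X \<Gamma> R P I) x y"
      using g by (simp del: LC_simps)
    have pi: "farr (pi_func X \<Gamma> R P I) x y f =
        farr (lin_loc_func (alg_bar X \<Gamma> R P I) (Sigma_A X \<Gamma> R P I)) x y (JQ.q x y g)"
      using pi_func_coset[OF o g(1)] g(2) by simp
    have "farr (lin_loc_func (alg_bar X \<Gamma> R P I) (Sigma_A X \<Gamma> R P I)) x y (JQ.q x y g) \<in>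
        Hom (pixelation_A X \<Gamma> R P I) x y"
      using functor_arr[OF linear_functor_functor[OF Loc.linear_functor_loc], of x y
        "JQ.q x y g"] o H
      by (simp add: lin_loc_func_def del: LC_simps)
    moreover have "farr N x y (farr (lin_loc_func (alg_bar X \<Gamma> R P I) (Sigma_A X \<Gamma> R P I)) x y
      (JQ.q x y g)) =
        farr M x y f"
      using N(3)[OF _ _ H] N1(3)[OF o g(1)] o g(2) by (simp del: LC_simps)
    ultimately show "farr (pi_func X \<Gamma> R P I) x y f \<in> Hom (pixelation_A X \<Gamma> R P I) x y \<and>
        farr N x y (farr (pi_func X \<Gamma> R P I) x y f) = farr M x y f"
      using pi by simp
  qed
qed

end

section \<open>The category of the quiver of a pixelation\<close>

context screened_ideal
begin

abbreviation "L \<equiv> pixelation_A X \<Gamma> R P I"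

abbreviation "loc \<equiv> lin_loc_func (alg_bar X \<Gamma> R P I) (Sigma_A X \<Gamma> R P I)"

sublocale L: linear_category L
  by (rule Loc.loc_linear_category)

lemma obj_L: "obj L = insert None (Some ` X)"
  by (simp add: lin_localization_def)

lemma fobj_loc [simp]: "fobj loc x = x"
  by (simp add: lin_loc_func_def)

lemmas loc_functor = is_functorD[OF linear_functor_functor[OF Loc.linear_functor_loc], unfolded
  fobj_loc]

lemma loc_hzero:
  "\<lbrakk>x \<in> obj LC; y \<in> obj LC\<rbrakk> \<Longrightarrow> farr loc x y (hzero (alg_bar X \<Gamma> R P I) x y) = hzero L x y"
  using functor_hzero[OF JQ.linear_category_quotient L.linear_category_axioms
    Loc.linear_functor_loc, of x y]
  by simp

lemma idm_L_None: "idm L None = hzero L None None"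
proof -
  have "idm LC None = 0"
    by (simp add: lin_path_cat_def)
  then show ?thesis
    using loc_functor(3)[of None] loc_hzero[of None None] by simp
qed

lemma live_subset_Sigma: "live_Sigma X \<Gamma> R P I x y \<subseteq> Sigma_A X \<Gamma> R P I x y"
  by (auto simp: Sigma_A_def)

lemma quot_path_Hom:
  assumes "\<gamma> \<in> \<Gamma>" "\<gamma> 0 = x" "\<gamma> 1 = y"
  shows "quot_path X \<Gamma> R J c \<gamma> \<in> Hom (alg_bar X \<Gamma> R P I) (Some x) (Some y)"
  using mon_Hom[OF assms, of c] assms by (simp add: quot_path_def del: linearization_simps)

lemma live_Sigma_Hom:
  "\<sigma> \<in> live_Sigma X \<Gamma> R P I x y \<Longrightarrow> \<sigma> \<in> Hom (alg_bar X \<Gamma> R P I) x y"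
  using quot_path_Hom[OF _ refl refl] unfolding live_Sigma_def by blast

lemma frac_A_eq:
  "frac_A X \<Gamma> R P I x z y \<sigma> f = cmp L x z y (Loc.Z.q z y (bwd z y \<sigma>)) (farr loc x z f)"
  by (simp add: lin_frac_def lin_loc_func_def)

lemma bwd_L:
  assumes "x \<in> obj LC" "y \<in> obj LC" "\<sigma> \<in> Sigma_A X \<Gamma> R P I y x" "\<sigma> \<in> Hom (alg_bar X \<Gamma> R P I) y x"
  shows "Loc.Z.q x y (bwd x y \<sigma>) \<in> Hom L x y"
  using Loc.bwd_Hom[of x y \<sigma>] assms by (simp add: lin_localization_def del: Loc.Z_simps(2)
    LC_simps(2))

lemma frac_A_Hom:
  assumes "x \<in> obj LC" "y \<in> obj LC" "z \<in> obj LC"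
    and "\<sigma> \<in> Sigma_A X \<Gamma> R P I y z" "\<sigma> \<in> Hom (alg_bar X \<Gamma> R P I) y z"
      "f \<in> Hom (alg_bar X \<Gamma> R P I) x z"
  shows "frac_A X \<Gamma> R P I x z y \<sigma> f \<in> Hom L x y"
proof -
  have o: "x \<in> obj L" "y \<in> obj L" "z \<in> obj L"
    using assms by (simp_all add: obj_L)
  have "farr loc x z f \<in> Hom L x z"
    using loc_functor(2)[of x z f] assms by (simp del: JQ.quotient_simps(2))
  then show ?thesis
    unfolding frac_A_eq by (rule L.cmp_closed[OF o(1,3,2) _ bwd_L[OF assms(3,2,4,5)]])
qed

lemma frac_A_hscale:
  assumes "x \<in> obj LC" "y \<in> obj LC" "z \<in> obj LC"
    and "\<sigma> \<in> Sigma_A X \<Gamma> R P I y z" "\<sigma> \<in> Hom (alg_bar X \<Gamma> R P I) y z"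
      "f \<in> Hom (alg_bar X \<Gamma> R P I) x z"
  shows "frac_A X \<Gamma> R P I x z y \<sigma> (hscale (alg_bar X \<Gamma> R P I) x z c f) =
    hscale L x y c (frac_A X \<Gamma> R P I x z y \<sigma> f)"
proof -
  have o: "x \<in> obj L" "y \<in> obj L" "z \<in> obj L"
    using assms by (simp_all add: obj_L)
  have "farr loc x z (hscale (alg_bar X \<Gamma> R P I) x z c f) = hscale L x z c (farr loc x z f)"
    using functor_hscale[OF Loc.linear_functor_loc, of x z f c] assms
    by (simp del: JQ.quotient_simps(2))
  moreover have "farr loc x z f \<in> Hom L x z"
    using loc_functor(2)[of x z f] assms by (simp del: JQ.quotient_simps(2))
  ultimately show ?thesis
    unfolding frac_A_eq using o bwd_L[OF assms(3,2,4,5)] by (simp only: L.cmp_scale_right)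
qed

lemma unit_pseudo_arrow_Hom:
  assumes "x \<in> X" "y \<in> X" "a \<in> unit_pseudo_arrows_A X \<Gamma> R P I x y"
  shows "a \<in> Hom L (Some x) (Some y)"
proof -
  obtain \<gamma> \<sigma> where *: "\<gamma> \<in> \<Gamma>" "\<sigma> \<in> live_Sigma X \<Gamma> R P I (Some y) (Some (\<gamma> 1))" "\<gamma> 0 = x"
    "a = frac_A X \<Gamma> R P I (Some x) (Some (\<gamma> 1)) (Some y) \<sigma> (quot_path X \<Gamma> R J 1 \<gamma>)"
    using assms(3) unfolding unit_pseudo_arrows_A_def by blast
  show ?thesis
    unfolding *(4) using assms * live_subset_Sigma
    by (intro frac_A_Hom live_Sigma_Hom quot_path_Hom) auto
qed

text \<open>
  A pseudo arrow \<open>\<sigma>\<^sup>-\<^sup>1 c[\<gamma>]\<close> is nonzero, so \<open>\<sigma>\<close> cannot be a zero isomorphism, and \<open>\<sigma>\<^sup>-\<^sup>1[\<gamma>]\<close>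
  is a pseudo arrow in the same class.
\<close>

lemma ex_unit_pseudo_arrow:
  assumes o: "x \<in> X" "y \<in> X" and b: "b \<in> pseudo_arrows_A X \<Gamma> R P I x y // scalar_equiv X \<Gamma> R P I x
    y"
  shows "\<exists>a. a \<in> b \<and> a \<in> unit_pseudo_arrows_A X \<Gamma> R P I x y"
proof -
  obtain a where a: "a \<in> pseudo_arrows_A X \<Gamma> R P I x y" "b = scalar_equiv X \<Gamma> R P I x y `` {a}"
    using b by (auto elim: quotientE)
  obtain \<gamma> \<sigma> c where *: "\<gamma> \<in> \<Gamma>" "\<sigma> \<in> Sigma_A X \<Gamma> R P I (Some y) (Some (\<gamma> 1))" "\<gamma> 0 = x"
    "crosses_once P \<gamma>" "a = frac_A X \<Gamma> R P I (Some x) (Some (\<gamma> 1)) (Some y) \<sigma> (quot_path X \<Gamma> R J c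
      \<gamma>)"
    and nz: "a \<noteq> hzero L (Some x) (Some y)"
    using a(1) unfolding pseudo_arrows_A_def by blast
  let ?z = "Some (\<gamma> 1)"
  have oLC: "Some x \<in> obj LC" "Some y \<in> obj LC" "?z \<in> obj LC"
    using o * by auto
  have oL: "Some x \<in> obj L" "Some y \<in> obj L" "?z \<in> obj L"
    using oLC by (simp_all add: obj_L)
  have \<sigma>_Hom: "\<sigma> \<in> Hom (alg_bar X \<Gamma> R P I) (Some y) ?z"
  proof (cases "\<sigma> \<in> live_Sigma X \<Gamma> R P I (Some y) ?z")
    case False
    then have "\<sigma> = hzero (alg_bar X \<Gamma> R P I) (Some y) ?z"
      using *(2) unfolding Sigma_A_def by blast
    then show ?thesis
      using linear_category.hzero_closed[OF JQ.linear_category_quotient, of "Some y" ?z] oLC by simp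
  qed (rule live_Sigma_Hom)
  note q = quot_path_Hom[OF *(1,3) refl]
  have live: "\<sigma> \<in> live_Sigma X \<Gamma> R P I (Some y) ?z"
  \<comment> \<open>A non-live \<open>\<sigma>\<close> is zero; being inverted, it makes
    \<open>y\<close> an object with zero identity, so every morphism into \<open>y\<close>, in
    particular \<open>a\<close>, would be zero.\<close>
  proof (rule ccontr)
    assume "\<sigma> \<notin> live_Sigma X \<Gamma> R P I (Some y) ?z"
    then have "\<sigma> = hzero (alg_bar X \<Gamma> R P I) (Some y) ?z"
      using *(2) unfolding Sigma_A_def by blast
    then have "is_iso L (Some y) ?z (hzero L (Some y) ?z)"
      using Loc.loc_iso[OF _ _ *(2) \<sigma>_Hom] loc_hzero[OF oLC(2,3)] oLC by simp
    then have "idm L (Some y) = hzero L (Some y) (Some y)"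
      by (rule L.iso_hzero[OF oL(2,3)])
    moreover have "a \<in> Hom L (Some x) (Some y)"
      unfolding *(5) by (rule frac_A_Hom[OF oLC *(2) \<sigma>_Hom q])
    ultimately show False
      using L.Hom_trivial[OF oL(1,2)] nz by blast
  qed
  define a' where "a' = frac_A X \<Gamma> R P I (Some x) ?z (Some y) \<sigma> (quot_path X \<Gamma> R J 1 \<gamma>)"
  have a'_Hom: "a' \<in> Hom L (Some x) (Some y)"
    unfolding a'_def by (rule frac_A_Hom[OF oLC *(2) \<sigma>_Hom q])
  have "quot_path X \<Gamma> R J c \<gamma> = hscale (alg_bar X \<Gamma> R P I) (Some x) ?z c (quot_path X \<Gamma> R J 1 \<gamma>)"
    using JQ.quotient_hscale[OF oLC(1,3), of "mon \<gamma>" c] mon_Hom[OF *(1,3) refl, of 1] *(3)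
    by (simp add: quot_path_def del: linearization_simps(2))
  then have aa': "a = hscale L (Some x) (Some y) c a'"
    unfolding *(5) a'_def using frac_A_hscale[OF oLC *(2) \<sigma>_Hom q] by simp
  have a'_nz: "a' \<noteq> hzero L (Some x) (Some y)" and c: "c \<noteq> 0"
    using nz aa' a'_Hom oL by (auto simp: L.hscale_hzero L.hscale_0)
  have unit: "a' \<in> unit_pseudo_arrows_A X \<Gamma> R P I x y"
    unfolding unit_pseudo_arrows_A_def using a'_nz a'_def live * by blast
  have "a' \<in> pseudo_arrows_A X \<Gamma> R P I x y"
    unfolding pseudo_arrows_A_def using a'_nz a'_def * by blast
  \<comment> \<open>Here \<open>a\<close> is the multiple \<open>c a'\<close>, so the pair belongs
    to the converse part of the generating relation; \<open>c\<close> is nonzero because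
    \<open>a\<close> is.\<close>
  then have "(a, a') \<in> scalar_equiv X \<Gamma> R P I x y"
    unfolding scalar_equiv_def Let_def using a(1) aa' c by (intro r_into_rtrancl) auto
  then show ?thesis
    using a(2) unit by blast
qed

section \<open>The functor \<open>Phi\<close> and linearity of the quotient by its kernel\<close>

context
  fixes s :: "'x set \<Rightarrow> 'x"
  assumes s: "\<And>U. U \<in> P \<Longrightarrow> s U \<in> U"
begin

abbreviation "Q \<equiv> (quiver_A X \<Gamma> R P I s)"

text \<open>Names the choice made inside \<open>Phi\<close>; \<open>ex_unit_pseudo_arrow\<close>
  shows that it is meaningful on arrows of the quiver.\<close>

definition "unit_arr W W' b =
  (SOME a. a \<in> b \<and> a \<in> unit_pseudo_arrows_A X \<Gamma> R P I (s W) (s W'))"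

definition "word_func =
  \<lparr>fobj = \<lambda>W. Some (s W), farr = word_ext L (\<lambda>W. Some (s W)) unit_arr\<rparr>"

lemma s_in: "U \<in> Verts Q \<Longrightarrow> s U \<in> X"
  using s pixel_subset by (auto simp: quiver_A_def)

lemma word_func_functor: "is_functor (free_cat Q) L word_func"
  unfolding word_func_def
proof (rule L.word_ext_functor)
  show "Some (s v) \<in> obj L" if "v \<in> Verts Q" for v
    using s_in[OF that] by (simp add: obj_L)
  fix u v b assume uv: "u \<in> Verts Q" "v \<in> Verts Q" and "b \<in> Arrows Q u v"
  then have "\<exists>a. a \<in> b \<and> a \<in> unit_pseudo_arrows_A X \<Gamma> R P I (s u) (s v)"
    by (intro ex_unit_pseudo_arrow s_in) (simp_all add: quiver_A_def)
  from someI_ex[OF this] show "unit_arr u v b \<in> Hom L (Some (s u)) (Some (s v))"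
    by (intro unit_pseudo_arrow_Hom s_in uv) (simp add: unit_arr_def)
qed

text \<open>Away from the zero object \<open>Phi\<close> is the linear extension of the word
  functor, so the general results on \<open>lin_ext\<close> apply.\<close>

lemma Phi_simps:
  "fobj (Phi X \<Gamma> R P I s) = map_option s"
  "farr (Phi X \<Gamma> R P I s) (Some U) (Some V) f = farr (lin_ext L word_func) U V f"
  "u = None \<or> v = None \<Longrightarrow> farr (Phi X \<Gamma> R P I s) u v f = hzero L (map_option s u) (map_option s v)"
proof -
  have "unit_arr = (\<lambda>W W' b. SOME a. a \<in> b \<and> a \<in> unit_pseudo_arrows_A X \<Gamma> R P I (s W) (s W'))"
    by (simp add: fun_eq_iff unit_arr_def)
  then show "farr (Phi X \<Gamma> R P I s) (Some U) (Some V) f = farr (lin_ext L word_func) U V f"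
    by (simp add: Phi_def Let_def lin_ext_def lin_word_ext_def word_func_def)
  show "fobj (Phi X \<Gamma> R P I s) = map_option s"
    by (simp add: Phi_def Let_def)
  show "u = None \<or> v = None \<Longrightarrow> farr (Phi X \<Gamma> R P I s) u v f
    = hzero L (map_option s u) (map_option s v)"
    by (auto simp: Phi_def Let_def split: option.split)
qed

lemma linear_category_Q_A:
  "linear_category (Q_A X \<Gamma> R P I s :: (_, _ \<Rightarrow>\<^sub>0 'k, 'k) lincat)"
  unfolding Q_A_def
  by (intro linear_category_adjoin_zero linear_category_linearization category_free_cat)

lemma linear_functor_Phi: "linear_functor (Q_A X \<Gamma> R P I s) L (Phi X \<Gamma> R P I s)"
  unfolding Q_A_def
  by (rule linear_functor_adjoin_zero[OF linear_category_linearization[OF category_free_cat]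
        L.linear_category_axioms lin_ext_linear[OF category_free_cat L.linear_category_axioms
          word_func_functor]
        _ idm_L_None])
    (simp_all add: obj_L Phi_simps lin_ext_def word_func_def)

text \<open>The relations divided out form the kernel of a linear functor, hence an ideal. The
  result is needed as the source category in \<open>quasi_inverse_linear\<close>.\<close>

lemma linear_category_Qbar_A: "linear_category (Qbar_A X \<Gamma> R P I s)"
proof -
  have "Phi_ker X \<Gamma> R P I s = (\<lambda>u v. {f \<in> Hom (Q_A X \<Gamma> R P I s) u v.
      farr (Phi X \<Gamma> R P I s) u v f = hzero L (fobj (Phi X \<Gamma> R P I s) u) (fobj (Phi X \<Gamma> R P I s)
        v)})"
    by (simp add: fun_eq_iff Phi_ker_def)
  then have "is_ideal (Q_A X \<Gamma> R P I s) (Phi_ker X \<Gamma> R P I s)"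
    using kernel_ideal[OF linear_category_Q_A L.linear_category_axioms linear_functor_Phi] by simp
  then interpret ideal_quotient "Q_A X \<Gamma> R P I s" "Phi_ker X \<Gamma> R P I s"
    by (simp add: ideal_quotient_def ideal_quotient_axioms_def linear_category_Q_A)
  show ?thesis
    unfolding Qbar_A_def by (rule linear_category_quotient)
qed

end

end

section \<open>Representations of pixelations\<close>

text \<open>A path based ideal is prescribed only at pairs of objects; at other arguments it may
  differ from the generated ideal.\<close>

lemma is_ideal_cong:
  assumes "\<And>x y. \<lbrakk>x \<in> obj D; y \<in> obj D\<rbrakk> \<Longrightarrow> I x y = J x y"
  shows "is_ideal D I \<longleftrightarrow> is_ideal D J"
  using assms by (simp add: is_ideal_def)

text \<open>Each generator is a sum over classes of paths with the same endpoints, hence a morphism,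
  so the family it belongs to generates an ideal.\<close>

lemma (in path_triple) path_based_ideal:
  fixes I :: "('x, 'k :: {comm_ring, comm_monoid_mult}) path_ideal"
  assumes "path_based X \<Gamma> R I"
  shows "is_ideal (lin_path_cat X \<Gamma> R) I"
proof -
  let ?LC = "lin_path_cat X \<Gamma> R :: ('x option, 'x pth set \<Rightarrow>\<^sub>0 'k, 'k) lincat"
  have LC: "linear_category ?LC"
    unfolding lin_path_cat_def
    by (rule linear_category_adjoin_zero[OF linear_category_linearization[OF category_path_cat]])
  have obj: "obj ?LC = insert None (Some ` X)"
    by (simp add: lin_path_cat_def)
  obtain S where S: "\<forall>x y. \<forall>f\<in>S x y. \<exists>a b. x = Some a \<and> y = Some b \<and>
        (\<exists>(n :: nat) c \<gamma>. f = (\<Sum>i<n. smon R (c i) (\<gamma> i)) \<and>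
           (\<forall>i<n. \<gamma> i \<in> \<Gamma> \<and> \<gamma> i 0 = a \<and> \<gamma> i 1 = b \<and> (\<forall>d. c i * d = 0 \<longrightarrow> d = 0)))"
    and I: "\<forall>x\<in>insert None (Some ` X). \<forall>y\<in>insert None (Some ` X). I x y = ideal_gen ?LC S x y"
    using assms unfolding path_based_def by (elim exE conjE) (rule that)
  have "S u v \<subseteq> Hom ?LC u v" for u v
  proof
    fix f assume "f \<in> S u v"
    from S[rule_format, OF this] obtain a b and n :: nat and c \<gamma> where *: "u = Some a" "v = Some b"
      "f = (\<Sum>i<n. smon R (c i) (\<gamma> i))" "\<forall>i<n. \<gamma> i \<in> \<Gamma> \<and> \<gamma> i 0 = a \<and> \<gamma> i 1 = b"
      by blast
    then show "f \<in> Hom ?LC u v"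
      using keys_smon_sum[of n \<gamma> a b c] by (simp add: lin_path_cat_def del: path_cat_simps)
  qed
  then have "is_ideal ?LC (ideal_gen ?LC S)"
    by (intro ideal_gen_ideal[OF LC])
  then show ?thesis
    using is_ideal_cong[of ?LC I "ideal_gen ?LC S"] I unfolding obj by blast
qed

context screened_ideal
begin

text \<open>The representation is \<open>N \<circ>\<^sub>F F\<close>, with \<open>N\<close> the
  extension of \<open>M\<close> and \<open>F\<close> a quasi-inverse of \<open>G\<close>: composing
  with \<open>G\<close> and then with \<open>pi_func\<close> leaves \<open>N\<close> on the image of
  \<open>pi_func\<close>, up to isomorphism, and there it restricts to \<open>M\<close>.\<close>

lemma representation_of_quiver:
  assumes K: "linear_category K" and M: "linear_functor (alg_cat X \<Gamma> R I) K M"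
    and pixelates: "pixelates_A X \<Gamma> R P I K M" and s: "\<And>U. U \<in> P \<Longrightarrow> s U \<in> U"
    and G: "canonical_G X \<Gamma> R P I s G"
  shows "\<exists>Mbar. linear_functor (Qbar_A X \<Gamma> R P I s) K Mbar \<and>
    nat_isomorphic (alg_cat X \<Gamma> R I) K (Mbar \<circ>\<^sub>F G \<circ>\<^sub>F pi_func X \<Gamma> R P I) M"
proof -
  let ?Q = "Qbar_A X \<Gamma> R P I s" and ?pi = "pi_func X \<Gamma> R P I"
  obtain N where N: "linear_functor L K N" "fobj N = fobj M"
    and N_pi: "\<And>x y f. \<lbrakk>x \<in> obj LC; y \<in> obj LC; f \<in> Hom (alg_cat X \<Gamma> R I) x y\<rbrakk> \<Longrightarrow>
      farr ?pi x y f \<in> Hom L x y \<and> farr N x y (farr ?pi x y f) = farr M x y f"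
    using representation_extends[OF K M pixelates] by blast
  have G_lin: "linear_functor L ?Q G" and "is_equivalence L ?Q G"
    using G by (simp_all add: canonical_G_def)
  then obtain F where F: "is_functor ?Q L F" "nat_isomorphic L L (F \<circ>\<^sub>F G) id_func"
    "nat_isomorphic ?Q ?Q (G \<circ>\<^sub>F F) id_func"
    unfolding is_equivalence_def by blast
  have F_lin: "linear_functor ?Q L F"
    by (rule quasi_inverse_linear[OF L.linear_category_axioms linear_category_Qbar_A[OF s] G_lin F])
  have "nat_isomorphic (alg_cat X \<Gamma> R I) K (N \<circ>\<^sub>F F \<circ>\<^sub>F G \<circ>\<^sub>F ?pi) M"
  proof (rule nat_isomorphic_extension[OF linear_functor_functor[OF N(1)] F(2)])
    show "is_functor L L (F \<circ>\<^sub>F G)"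
      by (rule functor_comp_functor[OF linear_functor_functor[OF G_lin] F(1)])
  qed (use N_pi N(2) in \<open>simp_all add: fobj_pi_func obj_L del: QI.quotient_simps(2)\<close>)
  moreover have "linear_functor ?Q K (N \<circ>\<^sub>F F)"
    by (rule linear_functor_comp[OF F_lin N(1)])
  ultimately show ?thesis
    by blast
qed

end

text \<open>Here \<open>C\<close> itself is localized, with no ideal to pass through: being
  pixelated says exactly that \<open>M\<close> inverts \<open>Sigma_C\<close>, and the universal
  property applies directly.\<close>

lemma (in path_triple) representation_of_path_quiver:
  assumes K: "category K" and M: "is_functor C K M" and pixelates: "pixelates_C \<Gamma> R P K M"
    and H: "canonical_H X \<Gamma> R P s H"
  shows "\<exists>Mbar. is_functor (Qbar_C X \<Gamma> R P s) K Mbar \<and>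
    nat_isomorphic C K (Mbar \<circ>\<^sub>F H \<circ>\<^sub>F p_func X \<Gamma> R P) M"
proof -
  let ?Q = "Qbar_C X \<Gamma> R P s" and ?L = "pixelation_C X \<Gamma> R P" and ?p = "p_func X \<Gamma> R P"
  interpret K: category K by fact
  have "inverting_functor C K (Sigma_C \<Gamma> R P) M"
    using category_path_cat M pixelates
    by (simp add: inverting_functor_def inverting_functor_axioms_def K.category_axioms
      pixelates_C_def)
  then obtain N where N: "is_functor ?L K N" "fobj N = fobj M"
    and N_p: "\<And>x y f. \<lbrakk>x \<in> obj C; y \<in> obj C; f \<in> Hom C x y\<rbrakk>
      \<Longrightarrow> farr N x y (farr ?p x y f) = farr M x y f"
    by (rule localization_universal) blast
  have "is_equivalence ?L ?Q H"
    using H by (simp add: canonical_H_def)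
  then obtain F where F: "is_functor ?L ?Q H" "is_functor ?Q ?L F"
    "nat_isomorphic ?L ?L (F \<circ>\<^sub>F H) id_func"
    unfolding is_equivalence_def by blast
  have obj: "obj ?L = X"
    by (simp add: localization_def quotient_cat_def zigzag_quiver_def)
  have p: "fobj ?p x = x" for x
    by (simp add: loc_func_def)
  have p_arr: "farr ?p x y f \<in> Hom ?L x y" if "x \<in> obj C" "y \<in> obj C" "f \<in> Hom C x y" for x y f
    using that by (auto simp: loc_func_def localization_def quotient_cat_def zigzag_quiver_def
        simp del: path_cat_simps(2) intro!: quotientI)
  have "nat_isomorphic C K (N \<circ>\<^sub>F F \<circ>\<^sub>F H \<circ>\<^sub>F ?p) M"
    by (rule nat_isomorphic_extension[OF N(1) F(3) functor_comp_functor[OF F(1,2)]])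
      (use N(2) N_p p_arr in \<open>simp_all add: p obj del: path_cat_simps(2)\<close>)
  moreover have "is_functor ?Q K (N \<circ>\<^sub>F F)"
    by (rule functor_comp_functor[OF F(2) N(1)])
  ultimately show ?thesis
    by blast
qed

theorem theorem3p7:
  fixes K :: "('o, 'm, 'k :: {comm_ring, comm_monoid_mult}) lincat"
    and X :: "'x set" and \<Gamma> :: "'x pth set" and R :: "'x pth rel"
    and I :: "('x, 'k) path_ideal"
  assumes "abelian_category K" and "path_triple X \<Gamma> R" and "path_based X \<Gamma> R I"
  shows
    "(\<forall>M P s G.
        linear_functor (alg_cat X \<Gamma> R I) K M \<and> screen X \<Gamma> R P \<and> pixelates_A X \<Gamma> R P I K M \<and>
        (\<forall>U\<in>P. s U \<in> U) \<and> canonical_G X \<Gamma> R P I s G \<longrightarrow>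
        (\<exists>Mbar. linear_functor (Qbar_A X \<Gamma> R P I s) K Mbar \<and>
           nat_isomorphic (alg_cat X \<Gamma> R I) K (Mbar \<circ>\<^sub>F G \<circ>\<^sub>F pi_func X \<Gamma> R P I) M)) \<and>
     (\<forall>M P s H.
        is_functor (path_cat X \<Gamma> R) K M \<and> screen X \<Gamma> R P \<and> pixelates_C \<Gamma> R P K M \<and>
        (\<forall>U\<in>P. s U \<in> U) \<and> canonical_H X \<Gamma> R P s H \<longrightarrow>
        (\<exists>Mbar. is_functor (Qbar_C X \<Gamma> R P s) K Mbar \<and>
           nat_isomorphic (path_cat X \<Gamma> R) K (Mbar \<circ>\<^sub>F H \<circ>\<^sub>F p_func X \<Gamma> R P) M))"
proof -
  interpret K: abelian_category K by fact
  interpret path_triple X \<Gamma> R by fact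
  show ?thesis
  proof (intro conjI allI impI; elim conjE)
    fix M P s G
    assume *: "linear_functor (alg_cat X \<Gamma> R I) K M" "screen X \<Gamma> R P" "pixelates_A X \<Gamma> R P I K M"
      "\<forall>U\<in>P. s U \<in> U" "canonical_G X \<Gamma> R P I s G"
    interpret screen X \<Gamma> R P by fact
    interpret screened_ideal X \<Gamma> R P I
      by unfold_locales (rule path_based_ideal[OF assms(3)])
    show "\<exists>Mbar. linear_functor (Qbar_A X \<Gamma> R P I s) K Mbar \<and>
        nat_isomorphic (alg_cat X \<Gamma> R I) K (Mbar \<circ>\<^sub>F G \<circ>\<^sub>F pi_func X \<Gamma> R P I) M"
      by (rule representation_of_quiver[OF K.linear_category_axioms *(1,3) _ *(5)])
        (use *(4) in blast)
  next
    fix M P s H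
    assume "is_functor (path_cat X \<Gamma> R) K M" "pixelates_C \<Gamma> R P K M" "canonical_H X \<Gamma> R P s H"
    then show "\<exists>Mbar. is_functor (Qbar_C X \<Gamma> R P s) K Mbar \<and>
        nat_isomorphic (path_cat X \<Gamma> R) K (Mbar \<circ>\<^sub>F H \<circ>\<^sub>F p_func X \<Gamma> R P) M"
      by (rule representation_of_path_quiver[OF K.category_axioms])
  qed
qed

end
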